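(* Let $\Omega$ be a Polish space and $(X_t)_{t\ge0}$ be a reversible Markov process on $\Omega$ with stationary measure $\mu$. Then, for any $g:\Omega\to\mathcal{H}_d$ belonging to the domain of $\Gamma$ (and such that $e^g\in\mathcal{D}(\mathcal{L})$) and any $p\ge1$, $$\mathrm{Tr}\Big[\big(\mathcal{E}(e^g)\big)^p\Big]\le\Big\|\,\|\Gamma(g)\|^p\,\Big\|_{L_\infty}\,\mathrm{Tr}\big(\mathbb{E}_\mu[e^{2pg}]\big),$$ where $\mathcal{E}$ and $\Gamma$ are respectively the matrix Dirichlet form and the matrix carré du champ operator associated with $(X_t)_{t\ge0}$.
   Context: $\mathcal{H}_d$ is the set of $d\times d$ Hermitian matrices, $\|\cdot\|$ is the operator norm, and $\|\cdot\|_{L_\infty}$ is the essential supremum over $\Omega$ with respect to $\mu$. Expectations of matrix-valued functions are entrywise. The Markov process $(X_t)_{t\ge0}$ has Markov semigroup $P_tf(x)=\mathbb{E}[f(X_t)\mid X_0=x]$ on $L^2(\mu)$ and infinitesimal generator $\mathcal{L}f=\lim_{t\to0}(P_tf-f)/t$ with $L^2(\mu)$-domain $\mathcal{D}(\mathcal{L})$. It is reversible if $\langle f,P_tg\rangle_\mu=\langle P_tf,g\rangle_\mu$ for all $f,g\in L^2(\mu)$, $t\ge 0$. $P_t$ and $\mathcal{L}$ act on matrix-valued functions entrywise; a matrix-valued function belongs to $\mathcal{D}(\mathcal{L})$ (or a subalgebra $\mathcal{A}$ of it) if all its entries do. The matrix Dirichlet form is $\mathcal{E}(f)=-\mathbb{E}_\mu[f\,\mathcal{L}(f)]$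 for $f\in\mathcal{D}(\mathcal{L})$, a positive semi-definite matrix by reversibility. Given an algebra $\mathcal{A}\subseteq\mathcal{D}(\mathcal{L})$ (the domain of $\Gamma$), the matrix carré du champ operator is $\Gamma(f)=\frac12\big(\mathcal{L}(f^2)-f\mathcal{L}(f)-\mathcal{L}(f)f\big)$ for $f\in\mathcal{A}$. *)

theory Defs
  imports "HOL-Probability.Probability"
begin

section \<open>Hermitian matrices\<close>

definition cadjoint :: "complex^'d^'d \<Rightarrow> complex^'d^'d" where
  "cadjoint A = (\<chi> i j. cnj (A $ j $ i))"

definition hermitian_mat :: "complex^'d^'d \<Rightarrow> bool" where
  "hermitian_mat A \<longleftrightarrow> cadjoint A = A"

definition unitary_mat :: "complex^'d^'d \<Rightarrow> bool" where
  "unitary_mat U \<longleftrightarrow> cadjoint U ** U = mat 1 \<and> U ** cadjoint U = mat 1"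

definition real_diag :: "('d \<Rightarrow> real) \<Rightarrow> complex^'d^'d" where
  "real_diag l = (\<chi> i j. if i = j then complex_of_real (l i) else 0)"

text \<open>Functional calculus for Hermitian matrices: if \<open>A = U diag(l) U\<^sup>*\<close> with \<open>U\<close> unitary, then
  \<open>\<phi>(A) = U diag(\<phi> \<circ> l) U\<^sup>*\<close>. The value does not depend on the diagonalisation chosen, see
  \<open>hermitian_fun_eq\<close>. (The operations \<open>*\<close>, \<open>^\<close> that the library provides on vectors act
  componentwise, so they are not matrix operations.)\<close>

definition hermitian_fun :: "(real \<Rightarrow> real) \<Rightarrow> complex^'d^'d \<Rightarrow> complex^'d^'d" where
  "hermitian_fun \<phi> A = (SOME B. \<exists>U l. unitary_mat U \<and>
      A = U ** real_diag l ** cadjoint U \<and>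
      B = U ** real_diag (\<lambda>i. \<phi> (l i)) ** cadjoint U)"

lemma real_diag_mult_left: "(real_diag l ** W) $ i $ j = complex_of_real (l i) * W $ i $ j"
proof -
  have "(real_diag l ** W) $ i $ j = (\<Sum>k\<in>UNIV. if k = i then complex_of_real (l i) * W $ i $ j else 0)"
    unfolding real_diag_def matrix_matrix_mult_def
    by (simp only: vec_lambda_beta, rule sum.cong[OF refl], simp)
  then show ?thesis by simp
qed

lemma real_diag_mult_right: "(W ** real_diag l) $ i $ j = W $ i $ j * complex_of_real (l j)"
proof -
  have "(W ** real_diag l) $ i $ j = (\<Sum>k\<in>UNIV. if k = j then W $ i $ j * complex_of_real (l j) else 0)"
    unfolding real_diag_def matrix_matrix_mult_def
    by (simp only: vec_lambda_beta, rule sum.cong[OF refl], simp)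
  then show ?thesis by simp
qed

lemma hermitian_fun_eq:
  assumes U: "unitary_mat U" and A: "A = U ** real_diag l ** cadjoint U"
  shows "hermitian_fun \<phi> A = U ** real_diag (\<lambda>i. \<phi> (l i)) ** cadjoint U"
proof -
  let ?Q = "\<lambda>B. \<exists>U l. unitary_mat U \<and> A = U ** real_diag l ** cadjoint U \<and>
      B = U ** real_diag (\<lambda>i. \<phi> (l i)) ** cadjoint U"
  have unique: "B = U ** real_diag (\<lambda>i. \<phi> (l i)) ** cadjoint U" if "?Q B" for B
  proof -
    from that obtain V m where V: "unitary_mat V"
      and AV: "A = V ** real_diag m ** cadjoint V"
      and B: "B = V ** real_diag (\<lambda>i. \<phi> (m i)) ** cadjoint V" by blast
    define W where "W = cadjoint V ** U"
    have VV: "cadjoint V ** V = mat 1" "V ** cadjoint V = mat 1"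
      and UU: "cadjoint U ** U = mat 1" "U ** cadjoint U = mat 1"
      using U V unfolding unitary_mat_def by auto
    have "cadjoint V ** A ** U = (cadjoint V ** V) ** real_diag m ** W"
      unfolding AV W_def by (simp only: matrix_mul_assoc)
    moreover have "cadjoint V ** A ** U = W ** real_diag l ** (cadjoint U ** U)"
      unfolding A W_def by (simp only: matrix_mul_assoc)
    ultimately have "real_diag m ** W = W ** real_diag l"
      by (simp add: VV UU)
    then have "complex_of_real (m i) * W $ i $ j = W $ i $ j * complex_of_real (l j)" for i j
      by (metis real_diag_mult_left real_diag_mult_right)
    then have eig: "m i = l j \<or> W $ i $ j = 0" for i j
      by (metis mult.commute mult_left_cancel of_real_eq_iff)
    have "complex_of_real (\<phi> (m i)) * W $ i $ j = W $ i $ j * complex_of_real (\<phi> (l j))" for i j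
      using eig[of i j] by (auto simp: mult.commute)
    then have D: "real_diag (\<lambda>i. \<phi> (m i)) ** W = W ** real_diag (\<lambda>i. \<phi> (l i))"
      by (simp add: vec_eq_iff real_diag_mult_left real_diag_mult_right)
    have "V ** (real_diag (\<lambda>i. \<phi> (m i)) ** W) ** cadjoint U
        = V ** real_diag (\<lambda>i. \<phi> (m i)) ** cadjoint V ** (U ** cadjoint U)"
      unfolding W_def by (simp only: matrix_mul_assoc)
    then have "B = V ** (real_diag (\<lambda>i. \<phi> (m i)) ** W) ** cadjoint U"
      by (simp add: B UU)
    also have "\<dots> = (V ** cadjoint V) ** U ** real_diag (\<lambda>i. \<phi> (l i)) ** cadjoint U"
      unfolding D unfolding W_def by (simp only: matrix_mul_assoc)
    also have "\<dots> = U ** real_diag (\<lambda>i. \<phi> (l i)) ** cadjoint U"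
      by (simp add: VV)
    finally show ?thesis .
  qed
  have "\<exists>B. ?Q B" using U A by blast
  then show ?thesis
    unfolding hermitian_fun_def by (rule someI2_ex) (rule unique)
qed

definition herm_exp :: "complex^'d^'d \<Rightarrow> complex^'d^'d" where
  "herm_exp = hermitian_fun exp"

definition herm_powr :: "complex^'d^'d \<Rightarrow> real \<Rightarrow> complex^'d^'d" where
  "herm_powr A p = hermitian_fun (\<lambda>s. s powr p) A"

definition op_norm :: "complex^'d^'d \<Rightarrow> real" where
  "op_norm A = onorm (\<lambda>v. A *v v)"


section \<open>Markov processes\<close>

text \<open>A Markov process on a state space \<open>'w\<close> is given by its coordinates \<open>X t\<close> on a sample space
  \<open>F\<close> together with its laws \<open>Pr x\<close> when started at \<open>x\<close>. Thus \<open>Pr x\<close> is the conditional law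
  given \<open>X 0 = x\<close>, and integration against \<open>Pr x\<close> is conditional expectation given \<open>X 0 = x\<close>.
  Only times \<open>t \<ge> 0\<close> are meaningful.\<close>

definition past :: "'s measure \<Rightarrow> (real \<Rightarrow> 's \<Rightarrow> 'w::topological_space) \<Rightarrow> real \<Rightarrow> 's measure" where
  "past F X s = sigma (space F) {X u -` B \<inter> space F | u B. 0 \<le> u \<and> u \<le> s \<and> B \<in> sets borel}"

locale markov_process =
  fixes F :: "'s measure"
    and X :: "real \<Rightarrow> 's \<Rightarrow> 'w::polish_space"
    and Pr :: "'w \<Rightarrow> 's measure"
  assumes measurable_X: "\<And>t. 0 \<le> t \<Longrightarrow> X t \<in> measurable F borel"
    and kernel: "Pr \<in> measurable borel (prob_algebra F)"
    and start: "\<And>x. AE \<omega> in Pr x. X 0 \<omega> = x"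
    and markov: "\<And>x s t B. \<lbrakk>0 \<le> s; 0 \<le> t; B \<in> sets borel\<rbrakk> \<Longrightarrow>
      AE \<omega> in Pr x. real_cond_exp (Pr x) (past F X s) (\<lambda>\<omega>'. indicator B (X (s + t) \<omega>')) \<omega>
        = measure (Pr (X s \<omega>)) {\<omega>' \<in> space F. X t \<omega>' \<in> B}"

definition stationary_measure ::
  "(real \<Rightarrow> 's \<Rightarrow> 'w::polish_space) \<Rightarrow> ('w \<Rightarrow> 's measure) \<Rightarrow> 'w measure \<Rightarrow> bool" where
  "stationary_measure X Pr \<mu> \<longleftrightarrow> prob_space \<mu> \<and> sets \<mu> = sets borel \<and>
     (\<forall>t\<ge>0. \<mu> \<bind> (\<lambda>x. distr (Pr x) borel (X t)) = \<mu>)"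

definition markov_semigroup ::
  "(real \<Rightarrow> 's \<Rightarrow> 'w) \<Rightarrow> ('w \<Rightarrow> 's measure) \<Rightarrow> real \<Rightarrow> ('w \<Rightarrow> complex) \<Rightarrow> 'w \<Rightarrow> complex" where
  "markov_semigroup X Pr t f x = (\<integral>\<omega>. f (X t \<omega>) \<partial>Pr x)"


section \<open>Generator, Dirichlet form and carre du champ\<close>

text \<open>Elements of the complex space \<open>L\<^sup>2(\<mu>)\<close> are represented by functions, not by their classes
  modulo \<open>\<mu>\<close>-almost everywhere equality.\<close>

definition L2 :: "'w measure \<Rightarrow> ('w \<Rightarrow> complex) set" where
  "L2 \<mu> = {f \<in> borel_measurable \<mu>. integrable \<mu> (\<lambda>x. (cmod (f x))\<^sup>2)}"

definition L2_norm :: "'w measure \<Rightarrow> ('w \<Rightarrow> complex) \<Rightarrow> real" where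
  "L2_norm \<mu> f = sqrt (\<integral>x. (cmod (f x))\<^sup>2 \<partial>\<mu>)"

definition L2_inner :: "'w measure \<Rightarrow> ('w \<Rightarrow> complex) \<Rightarrow> ('w \<Rightarrow> complex) \<Rightarrow> complex" where
  "L2_inner \<mu> f h = (\<integral>x. cnj (f x) * h x \<partial>\<mu>)"

definition reversible ::
  "'w measure \<Rightarrow> (real \<Rightarrow> ('w \<Rightarrow> complex) \<Rightarrow> 'w \<Rightarrow> complex) \<Rightarrow> bool" where
  "reversible \<mu> P \<longleftrightarrow>
     (\<forall>f\<in>L2 \<mu>. \<forall>h\<in>L2 \<mu>. \<forall>t\<ge>0. L2_inner \<mu> f (P t h) = L2_inner \<mu> (P t f) h)"

definition is_generator_of ::
  "'w measure \<Rightarrow> (real \<Rightarrow> ('w \<Rightarrow> complex) \<Rightarrow> 'w \<Rightarrow> complex) \<Rightarrow> ('w \<Rightarrow> complex) \<Rightarrow> ('w \<Rightarrow> complex) \<Rightarrow> bool"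
  where
  "is_generator_of \<mu> P f h \<longleftrightarrow> h \<in> L2 \<mu> \<and>
     ((\<lambda>t. L2_norm \<mu> (\<lambda>x. (P t f x - f x) / complex_of_real t - h x)) \<longlongrightarrow> 0) (at_right 0)"

definition generator_domain ::
  "'w measure \<Rightarrow> (real \<Rightarrow> ('w \<Rightarrow> complex) \<Rightarrow> 'w \<Rightarrow> complex) \<Rightarrow> ('w \<Rightarrow> complex) set" where
  "generator_domain \<mu> P = {f \<in> L2 \<mu>. \<exists>h. is_generator_of \<mu> P f h}"

text \<open>The \<open>L\<^sup>2\<close> limit is unique up to \<open>\<mu>\<close>-null sets; the generator picks a representative.\<close>

definition generator ::
  "'w measure \<Rightarrow> (real \<Rightarrow> ('w \<Rightarrow> complex) \<Rightarrow> 'w \<Rightarrow> complex) \<Rightarrow> ('w \<Rightarrow> complex) \<Rightarrow> 'w \<Rightarrow> complex" where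
  "generator \<mu> P f = (SOME h. is_generator_of \<mu> P f h)"

definition function_algebra :: "('w \<Rightarrow> complex) set \<Rightarrow> bool" where
  "function_algebra A \<longleftrightarrow> (\<lambda>x. 0) \<in> A \<and>
     (\<forall>c. \<forall>f\<in>A. (\<lambda>x. c * f x) \<in> A) \<and>
     (\<forall>f\<in>A. \<forall>h\<in>A. (\<lambda>x. f x + h x) \<in> A \<and> (\<lambda>x. f x * h x) \<in> A)"

definition entries_in :: "('w \<Rightarrow> complex) set \<Rightarrow> ('w \<Rightarrow> complex^'d^'d) \<Rightarrow> bool" where
  "entries_in A f \<longleftrightarrow> (\<forall>i j. (\<lambda>x. f x $ i $ j) \<in> A)"

definition entrywise ::
  "(('w \<Rightarrow> complex) \<Rightarrow> 'w \<Rightarrow> complex) \<Rightarrow> ('w \<Rightarrow> complex^'d^'d) \<Rightarrow> 'w \<Rightarrow> complex^'d^'d" where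
  "entrywise T f x = (\<chi> i j. T (\<lambda>y. f y $ i $ j) x)"

definition mat_expectation :: "'w measure \<Rightarrow> ('w \<Rightarrow> complex^'d^'d) \<Rightarrow> complex^'d^'d" where
  "mat_expectation \<mu> f = (\<chi> i j. \<integral>x. f x $ i $ j \<partial>\<mu>)"

text \<open>\<open>Tr(E[f])\<close> in \<open>[0, \<infinity>]\<close> for \<open>f\<close> with positive semi-definite values. The entries of such
  an \<open>f\<close> (if measurable) are all integrable iff the diagonal ones are, and otherwise the sum of
  the expectations of the diagonal entries is \<open>\<infinity>\<close>.\<close>

definition trace_expectation :: "'w measure \<Rightarrow> ('w \<Rightarrow> complex^'d^'d) \<Rightarrow> ennreal" where
  "trace_expectation \<mu> f =
     (if \<forall>i j. integrable \<mu> (\<lambda>x. f x $ i $ j) then ennreal (Re (trace (mat_expectation \<mu> f))) else \<infinity>)"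

definition dirichlet_form ::
  "'w measure \<Rightarrow> (real \<Rightarrow> ('w \<Rightarrow> complex) \<Rightarrow> 'w \<Rightarrow> complex) \<Rightarrow> ('w \<Rightarrow> complex^'d^'d) \<Rightarrow> complex^'d^'d"
  where
  "dirichlet_form \<mu> P f = - mat_expectation \<mu> (\<lambda>x. f x ** entrywise (generator \<mu> P) f x)"

definition carre_du_champ ::
  "'w measure \<Rightarrow> (real \<Rightarrow> ('w \<Rightarrow> complex) \<Rightarrow> 'w \<Rightarrow> complex) \<Rightarrow> ('w \<Rightarrow> complex^'d^'d) \<Rightarrow> 'w \<Rightarrow> complex^'d^'d"
  where
  "carre_du_champ \<mu> P f x = (1 / 2) *\<^sub>R
     (entrywise (generator \<mu> P) (\<lambda>y. f y ** f y) x
        - f x ** entrywise (generator \<mu> P) f x - entrywise (generator \<mu> P) f x ** f x)"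

end

theory Submission
  imports Defs
begin

text \<open>
  By reversibility the Dirichlet form of \<open>f = e\<^sup>g\<close> is the limit of
  \<open>(1/2t) E (f(X\<^sub>0) - f(X\<^sub>t))\<^sup>2\<close>, and \<open>\<Gamma>(g)(x)\<close> is the limit of the same quadratic expression for
  \<open>g\<close>, conditioned on \<open>X\<^sub>0 = x\<close>. With \<open>A = g(X\<^sub>0)\<close>, \<open>B = g(X\<^sub>t)\<close>, \<open>D = A - B\<close> one has
  \<open>e\<^sup>A - e\<^sup>B = \<integral>\<^bsub>[0,1]\<^esub> e\<^bsup>sA\<^esup> D e\<^bsup>(1-s)B\<^esup> ds\<close>. By duality, \<open>Tr \<E>(f)\<^sup>p\<close> is controlled through
  \<open>Tr Z \<E>(f)\<close> for a constant positive matrix \<open>Z\<close>, hence through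
  \<open>\<parallel>e\<^bsup>sA\<^esup> D e\<^bsup>(1-s)B\<^esup> Z\<^bsup>1/2\<^esup>\<parallel>\<^sup>2 = Tr (Y D W D)\<close> in the Hilbert-Schmidt norm, where \<open>W = e\<^bsup>2sA\<^esup>\<close> and
  \<open>Y = e\<^bsup>(1-s)B\<^esup> Z e\<^bsup>(1-s)B\<^esup>\<close>. Young's inequality in eigenbases of \<open>W\<close> and \<open>Y\<close> separates the two
  weights into \<open>Tr (Y\<^bsup>r'\<^esup> D\<^sup>2)\<close> and \<open>Tr (W\<^sup>r D\<^sup>2)\<close> with \<open>r = p/s\<close>; in the limit \<open>t \<rightarrow> 0\<close> these are at
  most \<open>\<parallel>\<Gamma>(g)\<parallel>\<close> times traces, and a trace Hoelder inequality bounds \<open>Tr Y\<^bsup>r'\<^esup>\<close>.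

  Since \<open>e\<^bsup>2pg\<^esup>\<close> need not be bounded, this is carried out for \<open>f / (1 + \<epsilon> f)\<close>, whose increments are
  \<open>(1 + \<epsilon> e\<^sup>A)\<^sup>-\<^sup>1 (e\<^sup>A - e\<^sup>B) (1 + \<epsilon> e\<^sup>B)\<^sup>-\<^sup>1\<close>. The energy at a fixed time increases
  when the time is halved, so a bound as \<open>t \<rightarrow> 0\<close> for the truncations holds at every \<open>t\<close>, passes to
  \<open>\<epsilon> \<rightarrow> 0\<close> by Fatou's lemma, and only then \<open>t \<rightarrow> 0\<close> is taken for \<open>f\<close> itself.
\<close>

section \<open>The spectral theorem for Hermitian matrices\<close>

text \<open>The obstacle is noncommutativity: the integrand \<open>e^{sA} D e^{(1-s)B}\<close>
  involves both endpoints, whereas \<open>\<Gamma>(g)\<close> controls \<open>D\<close> only against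
  a weight depending on one endpoint. Young's inequality decouples them, and the exponent
  \<open>r = p/s\<close> is forced, since it turns \<open>W = e^{2sA}\<close> into
  \<open>e^{2pA}\<close> for every \<open>s\<close>. The Hoelder bound for the other weight brings
  \<open>(1-s)/p\<close> in front of the trace of \<open>e^{2pB}\<close>, the first weight brings
  \<open>s/p\<close>; their sum \<open>1/p\<close> no longer depends on \<open>s\<close>. The dual
  matrix is \<open>Z = Y^{p-1}\<close> with \<open>Y = \<E>(f)/C\<close>, where \<open>C\<close>
  bounds \<open>\<parallel>\<Gamma>(g)\<parallel>\<close>. Then
  \<open>Tr Z \<E>(f) = C Tr Y^p\<close>, and the estimate reads
  \<open>Tr Y^p \<le> (1 - 1/p) Tr Y^p + (1/p) Tr E e^{2pg}\<close>, where the first term can be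
  absorbed without loss in the constant. The truncation is chosen because its divided differences
  are those of \<open>exp\<close> divided by a function of \<open>a\<close> times a function of
  \<open>b\<close>, so the integral representation survives with bounded outer factors. The
  truncations are not known to lie in the domain of the generator; hence the detour through energies
  at a fixed time.\<close>

definition cdot :: "complex^'n \<Rightarrow> complex^'n \<Rightarrow> complex" where
  "cdot u v = (\<Sum>i\<in>UNIV. cnj (u $ i) * v $ i)"

text \<open>The product \<open>\<bullet>\<close> on complex vectors is only real bilinear;
  \<open>cdot\<close> retains the imaginary part, without which orthogonality would mean real
  orthogonality.\<close>

lemma inner_eq_Re_cdot: "u \<bullet> v = Re (cdot u v)"
  by (simp add: cdot_def inner_vec_def inner_complex_def)

lemma cdot_self: "cdot v v = complex_of_real ((norm v)\<^sup>2)"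
proof -
  have "cdot v v = (\<Sum>i\<in>UNIV. complex_of_real ((norm (v $ i))\<^sup>2))"
    unfolding cdot_def by (intro sum.cong refl) (metis complex_norm_square mult.commute)
  also have "\<dots> = complex_of_real ((norm v)\<^sup>2)"
    by (simp add: norm_vec_def L2_set_def sum_nonneg)
  finally show ?thesis .
qed

lemma cdot_add_right: "cdot u (v + w) = cdot u v + cdot u w"
  by (simp add: cdot_def sum.distrib algebra_simps)

lemma cdot_diff_right: "cdot u (v - w) = cdot u v - cdot u w"
  by (simp add: cdot_def sum_subtractf algebra_simps)

lemma cdot_scale_right: "cdot u (c *s v) = c * cdot u v"
  by (simp add: cdot_def sum_distrib_left algebra_simps)

lemma cdot_scale_left: "cdot (c *s u) v = cnj c * cdot u v"
  by (simp add: cdot_def sum_distrib_left algebra_simps)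

lemma cdot_scaleR_right: "cdot u (c *\<^sub>R v) = of_real c * cdot u v"
  by (simp add: cdot_def sum_distrib_left scaleR_conv_of_real[where 'a=complex] algebra_simps)

lemma cnj_cdot: "cnj (cdot u v) = cdot v u"
  by (simp add: cdot_def mult.commute)

lemma cdot_adjoint: "cdot u (A *v v) = cdot (cadjoint A *v u) v"
proof -
  have "cdot u (A *v v) = (\<Sum>i\<in>UNIV. \<Sum>j\<in>UNIV. cnj (u $ i) * (A $ i $ j * v $ j))"
    by (simp add: cdot_def matrix_vector_mult_def sum_distrib_left)
  also have "\<dots> = (\<Sum>j\<in>UNIV. \<Sum>i\<in>UNIV. cnj (u $ i) * (A $ i $ j * v $ j))"
    by (rule sum.swap)
  also have "\<dots> = cdot (cadjoint A *v u) v"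
    by (simp add: cdot_def matrix_vector_mult_def cadjoint_def sum_distrib_left sum_distrib_right mult_ac)
  finally show ?thesis .
qed

lemma continuous_on_cdot [continuous_intros]:
  "continuous_on S f \<Longrightarrow> continuous_on S g \<Longrightarrow> continuous_on S (\<lambda>x. cdot (f x) (g x))"
  unfolding cdot_def by (intro continuous_intros)

lemma bounded_linear_matrix_vector: "bounded_linear (\<lambda>v. (A :: complex^'n^'m) *v v)"
  by (rule linear_conv_bounded_linear[THEN iffD1])
     (auto intro!: linearI simp: matrix_vector_mult_def vec_eq_iff sum.distrib algebra_simps scaleR_sum_right)

text \<open>The first-order condition at a maximum: for small \<open>t\<close> the linear term
  decides the sign.\<close>

lemma quadratic_nonpos_imp_zero:
  fixes a b :: real
  assumes "\<And>t. 2 * t * a + t\<^sup>2 * b \<le> 0"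
  shows "a = 0"
proof (rule ccontr)
  assume "a \<noteq> 0"
  \<comment> \<open>Makes \<open>2 * c + b\<close> positive, so that the linear term wins at
    \<open>t = a / c\<close>.\<close>
  define c where "c = \<bar>b\<bar> + 1"
  define t where "t = a / c"
  have c: "c > 0" "2 * c + b > 0" by (auto simp: c_def)
  have "a = t * c" "t \<noteq> 0" using c \<open>a \<noteq> 0\<close> by (auto simp: t_def)
  then have "2 * t * a + t\<^sup>2 * b = t\<^sup>2 * (2 * c + b)"
    by (simp add: algebra_simps power2_eq_square)
  moreover have "\<dots> > 0" using c \<open>t \<noteq> 0\<close> by simp
  ultimately show False using assms[of t] by linarith
qed

text \<open>Complex orthogonality to \<open>u i\<close> is real orthogonality to both
  \<open>u i\<close> and \<open>\<i> *s u i\<close>, and these at most \<open>2 * card S\<close>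
  vectors cannot span the real dimension \<open>2 * CARD('d)\<close>.\<close>

lemma exists_cdot_orthogonal:
  fixes u :: "'d \<Rightarrow> complex^'d"
  assumes "card S < CARD('d)"
  shows "\<exists>v. norm v = 1 \<and> (\<forall>i\<in>S. cdot (u i) v = 0)"
proof -
  define T where "T = u ` S \<union> (\<lambda>i. \<i> *s u i) ` S"
  have fin: "finite S" by simp
  have "dim T \<le> card T" using fin by (intro dim_le_card') (auto simp: T_def)
  also have "\<dots> \<le> card S + card S"
    unfolding T_def using fin by (intro order.trans[OF card_Un_le] add_mono card_image_le)
  also have "\<dots> < DIM(complex^'d)" using assms by simp
  finally obtain x where x: "x \<noteq> 0" "\<And>y. y \<in> span T \<Longrightarrow> orthogonal x y"
    using orthogonal_to_subspace_exists by blast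
  have "cdot (u i) x = 0" if "i \<in> S" for i
  proof -
    have "u i \<in> span T" "\<i> *s u i \<in> span T"
      using that by (auto simp: T_def intro!: span_base)
    then have "x \<bullet> u i = 0" "x \<bullet> (\<i> *s u i) = 0" using x(2) by (auto simp: orthogonal_def)
    then have "Re (cdot x (u i)) = 0" "Im (cdot x (u i)) = 0"
      by (auto simp: inner_eq_Re_cdot cdot_scale_right)
    then have "cdot x (u i) = 0" by (simp add: complex_eq_iff)
    then show ?thesis by (metis cnj_cdot complex_cnj_zero)
  qed
  then have "norm (x /\<^sub>R norm x) = 1 \<and> (\<forall>i\<in>S. cdot (u i) (x /\<^sub>R norm x) = 0)"
    using x(1) by (simp add: cdot_scaleR_right)
  then show ?thesis by blast
qed

text \<open>Compactness yields a maximiser \<open>v\<close> of the quadratic form on the unit sphere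
  of the complement. The residual \<open>A *v v - m *\<^sub>R v\<close> stays in the complement
  because each \<open>u i\<close> is an eigenvector, so it is an admissible direction; the first
  variation along it is its own squared norm, which must vanish.\<close>

lemma hermitian_eigenvector_in_complement:
  fixes A :: "complex^'d^'d" and u :: "'d \<Rightarrow> complex^'d"
  assumes A: "hermitian_mat A" and S: "card S < CARD('d)"
    and eig: "\<And>i. i \<in> S \<Longrightarrow> A *v u i = of_real (l i) *s u i"
  shows "\<exists>v m. norm v = 1 \<and> (\<forall>i\<in>S. cdot (u i) v = 0) \<and> A *v v = of_real m *s v"
proof -
  have sa: "u \<bullet> (A *v w) = (A *v u) \<bullet> w" for u w
    using A by (simp add: inner_eq_Re_cdot cdot_adjoint hermitian_mat_def)
  interpret bl: bounded_linear "\<lambda>v. A *v v" by (rule bounded_linear_matrix_vector)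
  define K where "K = {v. norm v = 1 \<and> (\<forall>i\<in>S. cdot (u i) v = 0)}"
  have "K = sphere 0 1 \<inter> (\<Inter>i\<in>S. {v. cdot (u i) v = 0})"
    by (auto simp: K_def)
  moreover have "closed {v. cdot (u i) v = 0}" for i
    by (intro closed_Collect_eq continuous_intros)
  ultimately have "compact K" by (simp add: compact_Int_closed closed_INT)
  moreover have "K \<noteq> {}" using exists_cdot_orthogonal[OF S, of u] by (auto simp: K_def)
  moreover have "continuous_on K (\<lambda>v. v \<bullet> (A *v v))"
    by (intro continuous_intros bl.continuous_on)
  ultimately obtain v where v: "v \<in> K" and max: "\<And>w. w \<in> K \<Longrightarrow> w \<bullet> (A *v w) \<le> v \<bullet> (A *v v)"
    using continuous_attains_sup[of K] by blast
  define m where "m = v \<bullet> (A *v v)"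
  have nv: "norm v = 1" and ov: "\<And>i. i \<in> S \<Longrightarrow> cdot (u i) v = 0" using v by (auto simp: K_def)
  have bound: "w \<bullet> (A *v w) \<le> m * (w \<bullet> w)" if "\<And>i. i \<in> S \<Longrightarrow> cdot (u i) w = 0" for w
  proof (cases "w = 0")
    case False
    then have "w /\<^sub>R norm w \<in> K" using that by (simp add: K_def cdot_scaleR_right)
    from max[OF this] have "(w \<bullet> (A *v w)) / (norm w)\<^sup>2 \<le> m"
      by (simp add: m_def bl.scaleR power2_eq_square divide_inverse mult_ac)
    then show ?thesis using False by (simp add: divide_le_eq dot_square_norm)
  qed simp
  define w where "w = A *v v - m *\<^sub>R v"
  have ow: "cdot (u i) w = 0" if "i \<in> S" for i
  proof -
    have "cdot (u i) (A *v v) = cdot (A *v u i) v"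
      using A by (simp add: cdot_adjoint hermitian_mat_def)
    also have "\<dots> = 0" using that by (simp add: eig cdot_scale_left ov)
    finally show ?thesis using that by (simp add: w_def cdot_diff_right cdot_scaleR_right ov)
  qed
  have "2 * t * (w \<bullet> w) + t\<^sup>2 * (w \<bullet> (A *v w) - m * (w \<bullet> w)) \<le> 0" for t
  proof -
    have "(v + t *\<^sub>R w) \<bullet> (A *v (v + t *\<^sub>R w)) \<le> m * ((v + t *\<^sub>R w) \<bullet> (v + t *\<^sub>R w))"
      by (intro bound) (simp add: cdot_add_right cdot_scaleR_right ov ow)
    moreover have "v \<bullet> v = 1" using nv by (simp add: dot_square_norm)
    moreover have "v \<bullet> (A *v w) = w \<bullet> (A *v v)" by (metis sa inner_commute)
    moreover have "w \<bullet> (A *v v) = w \<bullet> w + m * (w \<bullet> v)"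
      by (simp add: w_def inner_diff_right)
    ultimately have "m + 2 * t * (w \<bullet> w + m * (w \<bullet> v)) + t\<^sup>2 * (w \<bullet> (A *v w))
        \<le> m * (1 + 2 * t * (w \<bullet> v) + t\<^sup>2 * (w \<bullet> w))"
      by (simp add: bl.add bl.scaleR inner_add_left inner_add_right m_def[symmetric]
          inner_commute[of v w] power2_eq_square)
         (simp add: algebra_simps)
    then show ?thesis by (simp add: algebra_simps)
  qed
  then have "w \<bullet> w = 0" by (rule quadratic_nonpos_imp_zero)
  then have "A *v v = m *\<^sub>R v" by (simp add: w_def)
  then have "A *v v = of_real m *s v" by (simp add: vec_eq_iff scaleR_conv_of_real[where 'a=complex])
  then show ?thesis using nv ov by blast
qed

lemma hermitian_orthonormal_eigenvectors:
  fixes A :: "complex^'d^'d" and S :: "'d set"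
  assumes A: "hermitian_mat A"
  shows "\<exists>u l. (\<forall>i\<in>S. A *v u i = of_real (l i) *s u i) \<and>
    (\<forall>i\<in>S. \<forall>j\<in>S. cdot (u i) (u j) = (if i = j then 1 else 0))"
using finite[of S]
proof (induction S rule: finite_induct)
  case (insert x S)
  then obtain u l where u: "\<forall>i\<in>S. A *v u i = of_real (l i) *s u i"
    "\<forall>i\<in>S. \<forall>j\<in>S. cdot (u i) (u j) = (if i = j then 1 else 0)" by blast
  have "S \<subset> UNIV" using insert(2) by blast
  then have "card S < CARD('d)" by (rule psubset_card_mono[OF finite])
  then obtain v m where v: "norm v = 1" "\<forall>i\<in>S. cdot (u i) v = 0" "A *v v = of_real m *s v"
    using hermitian_eigenvector_in_complement[OF A, of S u l] u by blast
  have "\<forall>i\<in>S. cdot v (u i) = 0" using v(2) by (metis cnj_cdot complex_cnj_zero)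
  moreover have "cdot v v = 1" using v(1) by (simp add: cdot_self)
  ultimately show ?case using u v insert(2)
    by (intro exI[of _ "u(x := v)"] exI[of _ "l(x := m)"]) auto
qed simp

lemma cadjoint_mult: "cadjoint (A ** B) = cadjoint B ** cadjoint A"
  by (simp add: cadjoint_def matrix_matrix_mult_def vec_eq_iff mult.commute)

lemma cadjoint_cadjoint [simp]: "cadjoint (cadjoint A) = A"
  by (simp add: cadjoint_def vec_eq_iff)

theorem hermitian_spectral:
  fixes A :: "complex^'d^'d"
  assumes A: "hermitian_mat A"
  obtains U l where "unitary_mat U" "A = U ** real_diag l ** cadjoint U"
proof -
  obtain u :: "'d \<Rightarrow> complex^'d" and l where u: "\<And>i. A *v u i = of_real (l i) *s u i"
    and on: "\<And>i j. cdot (u i) (u j) = (if i = j then 1 else 0)"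
    using hermitian_orthonormal_eigenvectors[OF A, of UNIV] by auto
  define U :: "complex^'d^'d" where "U = (\<chi> i j. u j $ i)"
  have *: "cadjoint U ** U = mat 1"
    using on by (simp add: vec_eq_iff matrix_matrix_mult_def cadjoint_def U_def mat_def cdot_def)
  then have **: "U ** cadjoint U = mat 1" by (rule matrix_left_right_inverse[THEN iffD1])
  have "(A ** U) $ i $ j = (U ** real_diag l) $ i $ j" for i j
  proof -
    have "(A ** U) $ i $ j = (A *v u j) $ i"
      by (simp add: matrix_matrix_mult_def matrix_vector_mult_def U_def)
    then show ?thesis by (simp add: u real_diag_mult_right) (simp add: U_def)
  qed
  then have AU: "A ** U = U ** real_diag l" by (simp add: vec_eq_iff)
  have AUU: "A ** U ** cadjoint U = A" by (simp add: ** flip: matrix_mul_assoc)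
  show ?thesis
  proof (rule that)
    show "unitary_mat U" using * ** by (simp add: unitary_mat_def)
    show "A = U ** real_diag l ** cadjoint U" using AUU unfolding AU by (rule sym)
  qed
qed

section \<open>Scalar inequalities\<close>

lemma weighted_young:
  fixes a b :: real
  assumes "0 \<le> \<alpha>" "0 \<le> \<beta>" "\<alpha> + \<beta> = 1" "0 \<le> a" "0 \<le> b"
  shows "a powr \<alpha> * b powr \<beta> \<le> \<alpha> * a + \<beta> * b"
proof (cases "a = 0 \<or> b = 0")
  case True
  then show ?thesis using assms by auto
next
  case False
  then show ?thesis using assms by (intro Youngs_inequality_0) auto
qed

text \<open>Convexity: \<open>z powr q\<close> lies above its tangent at \<open>m\<close>. It is
  Young's inequality with weights \<open>1 / q\<close> and \<open>1 - 1 / q\<close>.\<close>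

lemma powr_tangent:
  fixes m z q :: real
  assumes "1 \<le> q" "0 \<le> m" "0 \<le> z"
  shows "q * z * m powr (q - 1) \<le> z powr q + (q - 1) * m powr q"
proof -
  have "z * m powr (q - 1) = (z powr q) powr (1 / q) * (m powr q) powr (1 - 1 / q)"
  proof -
    have "q * (1 - 1 / q) = q - 1" "q * (1 / q) = 1" using assms by (auto simp: field_simps)
    then show ?thesis using assms by (simp only: powr_powr) simp
  qed
  also have "\<dots> \<le> (1 / q) * z powr q + (1 - 1 / q) * m powr q"
    using assms by (intro weighted_young) auto
  finally have "q * (z * m powr (q - 1)) \<le> q * ((1 / q) * z powr q + (1 - 1 / q) * m powr q)"
    using assms by (intro mult_left_mono) auto
  also have "\<dots> = z powr q + (q - 1) * m powr q" using assms by (simp add: field_simps)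
  finally show ?thesis by (simp add: mult_ac)
qed

text \<open>The tangent inequality, unlike Jensen's, tolerates weights of total mass less than \<open>1\<close>.\<close>

lemma jensen_powr_substochastic:
  fixes c z :: "'n::finite \<Rightarrow> real"
  assumes q: "1 \<le> q" and c: "\<And>l. 0 \<le> c l" "(\<Sum>l\<in>UNIV. c l) \<le> 1" and z: "\<And>l. 0 \<le> z l"
  shows "(\<Sum>l\<in>UNIV. c l * z l) powr q \<le> (\<Sum>l\<in>UNIV. c l * z l powr q)"
proof -
  define m where "m = (\<Sum>l\<in>UNIV. c l * z l)"
  have m: "0 \<le> m" unfolding m_def using c z by (intro sum_nonneg) auto
  have "q * m * m powr (q - 1) = (\<Sum>l\<in>UNIV. c l * (q * z l * m powr (q - 1)))"
  proof -
    have "(\<Sum>l\<in>UNIV. c l * (q * z l * m powr (q - 1))) = q * (\<Sum>l\<in>UNIV. c l * z l) * m powr (q - 1)"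
      by (simp add: sum_distrib_left sum_distrib_right mult_ac)
    then show ?thesis by (simp add: m_def)
  qed
  also have "\<dots> \<le> (\<Sum>l\<in>UNIV. c l * (z l powr q + (q - 1) * m powr q))"
    using q m z c by (intro sum_mono mult_left_mono powr_tangent) auto
  also have "\<dots> = (\<Sum>l\<in>UNIV. c l * z l powr q) + (\<Sum>l\<in>UNIV. c l) * ((q - 1) * m powr q)"
    by (simp only: distrib_left sum.distrib sum_distrib_right)
  \<comment> \<open>The missing mass is harmless because \<open>(q - 1) * m powr q\<close> is
    nonnegative.\<close>
  also have "\<dots> \<le> (\<Sum>l\<in>UNIV. c l * z l powr q) + 1 * ((q - 1) * m powr q)"
    using q c by (intro add_left_mono mult_right_mono) auto
  finally have "q * (m * m powr (q - 1)) \<le> (\<Sum>l\<in>UNIV. c l * z l powr q) + (q - 1) * m powr q"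
    by (simp add: mult_ac)
  moreover have "m * m powr (q - 1) = m powr q"
    using m q by (cases "m = 0") (auto simp: powr_mult_base)
  ultimately show ?thesis by (simp add: m_def algebra_simps)
qed

text \<open>Sums at most one, rather than equal to one: the entries will be squared moduli of
  partial isometries, whose columns belonging to zero singular values vanish.\<close>

definition doubly_substochastic :: "('n::finite \<Rightarrow> 'n \<Rightarrow> real) \<Rightarrow> bool" where
  "doubly_substochastic c \<longleftrightarrow> (\<forall>j l. 0 \<le> c j l) \<and>
     (\<forall>j. (\<Sum>l\<in>UNIV. c j l) \<le> 1) \<and> (\<forall>l. (\<Sum>j\<in>UNIV. c j l) \<le> 1)"

text \<open>The sums over \<open>l\<close> make Jensen's inequality applicable for each
  \<open>j\<close>; the sums over \<open>j\<close> enter after the order of summation is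
  exchanged.\<close>

lemma sum_powr_doubly_substochastic_le:
  fixes z :: "'n::finite \<Rightarrow> real"
  assumes q: "1 \<le> q" and c: "doubly_substochastic c" and z: "\<And>l. 0 \<le> z l"
  shows "(\<Sum>j\<in>UNIV. (\<Sum>l\<in>UNIV. c j l * z l) powr q) \<le> (\<Sum>l\<in>UNIV. z l powr q)"
proof -
  have "(\<Sum>j\<in>UNIV. (\<Sum>l\<in>UNIV. c j l * z l) powr q) \<le> (\<Sum>j\<in>UNIV. \<Sum>l\<in>UNIV. c j l * z l powr q)"
    using assms by (intro sum_mono jensen_powr_substochastic) (auto simp: doubly_substochastic_def)
  also have "\<dots> = (\<Sum>l\<in>UNIV. (\<Sum>j\<in>UNIV. c j l) * z l powr q)"
    by (subst sum.swap) (simp add: sum_distrib_right)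
  also have "\<dots> \<le> (\<Sum>l\<in>UNIV. 1 * z l powr q)"
    using c by (intro sum_mono mult_right_mono) (auto simp: doubly_substochastic_def)
  finally show ?thesis by simp
qed

lemma doubly_substochastic_nonneg:
  "doubly_substochastic c \<Longrightarrow> (\<And>l. 0 \<le> z l) \<Longrightarrow> 0 \<le> (\<Sum>l\<in>UNIV. c j l * z l)"
  by (intro sum_nonneg mult_nonneg_nonneg) (auto simp: doubly_substochastic_def)

text \<open>For \<open>p = 1\<close> the numbers \<open>x l powr (p - 1)\<close> are \<open>0\<close> or \<open>1\<close>, and the first summand on the right vanishes.\<close>

lemma doubly_substochastic_holder:
  fixes x k y :: "'n::finite \<Rightarrow> real"
  assumes p: "1 \<le> p" and s: "0 < s" "s < 1"
    and c: "doubly_substochastic c" and e: "doubly_substochastic e"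
    and x: "\<And>l. 0 \<le> x l" and k: "\<And>l. 0 \<le> k l" and y: "\<And>j. 0 \<le> y j"
    and le: "\<And>j. y j \<le> (\<Sum>l\<in>UNIV. c j l * x l powr (p - 1)) * (\<Sum>l\<in>UNIV. e j l * (k l)\<^sup>2)"
  shows "(1 - s / p) * (\<Sum>j\<in>UNIV. y j powr (1 / (1 - s / p)))
    \<le> (1 - 1 / p) * (\<Sum>l\<in>UNIV. x l powr p) + ((1 - s) / p) * (\<Sum>l\<in>UNIV. k l powr (2 * p / (1 - s)))"
proof -
  \<comment> \<open>Its reciprocal is the exponent conjugate to \<open>p / s\<close>.\<close>
  define \<alpha> where "\<alpha> = 1 - s / p"
  define \<zeta> where "\<zeta> j = (\<Sum>l\<in>UNIV. c j l * x l powr (p - 1))" for j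
  define \<kappa> where "\<kappa> j = (\<Sum>l\<in>UNIV. e j l * (k l)\<^sup>2)" for j
  have sp: "s / p < 1" using p s by (simp add: divide_less_eq)
  have \<alpha>: "0 < \<alpha>" "\<alpha> \<le> 1" using sp p s by (auto simp: \<alpha>_def)
  have \<zeta>: "0 \<le> \<zeta> j" for j unfolding \<zeta>_def by (intro doubly_substochastic_nonneg[OF c]) auto
  have \<kappa>: "0 \<le> \<kappa> j" for j unfolding \<kappa>_def by (intro doubly_substochastic_nonneg[OF e]) auto
  have y_le: "y j powr (1 / \<alpha>) \<le> \<zeta> j powr (1 / \<alpha>) * \<kappa> j powr (1 / \<alpha>)" for j
    using le[of j] y[of j] \<zeta>[of j] \<kappa>[of j] \<alpha>
    by (subst powr_mult[symmetric]) (auto simp: \<zeta>_def \<kappa>_def intro!: powr_mono2)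
  have "(\<Sum>j\<in>UNIV. \<kappa> j powr (p / (1 - s))) \<le> (\<Sum>l\<in>UNIV. ((k l)\<^sup>2) powr (p / (1 - s)))"
    unfolding \<kappa>_def using p s by (intro sum_powr_doubly_substochastic_le e) (auto simp: le_divide_eq)
  also have "\<dots> = (\<Sum>l\<in>UNIV. k l powr (2 * p / (1 - s)))"
  proof (intro sum.cong refl)
    fix l
    have "(k l)\<^sup>2 = k l powr 2" using k[of l] by simp
    then show "((k l)\<^sup>2) powr (p / (1 - s)) = k l powr (2 * p / (1 - s))" by (simp add: powr_powr)
  qed
  finally have K: "(\<Sum>j\<in>UNIV. \<kappa> j powr (p / (1 - s))) \<le> (\<Sum>l\<in>UNIV. k l powr (2 * p / (1 - s)))" .
  have "\<alpha> * (\<Sum>j\<in>UNIV. y j powr (1 / \<alpha>))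
    \<le> (1 - 1 / p) * (\<Sum>l\<in>UNIV. x l powr p) + ((1 - s) / p) * (\<Sum>j\<in>UNIV. \<kappa> j powr (p / (1 - s)))"
  proof (cases "p = 1")
    case True
    have "\<zeta> j powr (1 / \<alpha>) \<le> 1" for j
    proof -
      have "\<zeta> j \<le> (\<Sum>l\<in>UNIV. c j l)"
        unfolding \<zeta>_def using c True by (intro sum_mono) (auto simp: doubly_substochastic_def)
      also have "\<dots> \<le> 1" using c by (auto simp: doubly_substochastic_def)
      finally show ?thesis using \<zeta>[of j] \<alpha> powr_le1[of "1 / \<alpha>" "\<zeta> j"] by auto
    qed
    then have "y j powr (1 / \<alpha>) \<le> \<kappa> j powr (1 / \<alpha>)" for j
      using y_le[of j] mult_right_mono[of "\<zeta> j powr (1 / \<alpha>)" 1 "\<kappa> j powr (1 / \<alpha>)"]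
      by (metis mult_1 order.trans powr_ge_zero)
    then have "\<alpha> * (\<Sum>j\<in>UNIV. y j powr (1 / \<alpha>)) \<le> \<alpha> * (\<Sum>j\<in>UNIV. \<kappa> j powr (1 / \<alpha>))"
      using \<alpha> by (intro mult_left_mono sum_mono) auto
    then show ?thesis by (simp add: True \<alpha>_def)
  next
    case False
    then have p: "1 < p" using p by simp
    \<comment> \<open>As \<open>\<alpha>\<close> equals \<open>(1 - 1 / p) + (1 - s) / p\<close>,
      dividing these two numbers by \<open>\<alpha>\<close> gives Young weights. They produce the
      exponents \<open>p / (p - 1)\<close> and \<open>p / (1 - s)\<close>, for which Jensen's
      inequality returns \<open>x l powr p\<close> and
      \<open>k l powr (2 * p / (1 - s))\<close>.\<close>
    have "\<alpha> * y j powr (1 / \<alpha>)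
      \<le> (1 - 1 / p) * \<zeta> j powr (p / (p - 1)) + ((1 - s) / p) * \<kappa> j powr (p / (1 - s))" for j
    proof -
      have "\<zeta> j powr (1 / \<alpha>) * \<kappa> j powr (1 / \<alpha>) =
          (\<zeta> j powr (p / (p - 1))) powr ((1 - 1 / p) / \<alpha>) * (\<kappa> j powr (p / (1 - s))) powr (((1 - s) / p) / \<alpha>)"
      proof -
        have "(p / (p - 1)) * ((1 - 1 / p) / \<alpha>) = 1 / \<alpha>"
          using p \<alpha> by (simp add: field_simps)
        moreover have "(p / (1 - s)) * (((1 - s) / p) / \<alpha>) = 1 / \<alpha>"
          using p s \<alpha> by (simp add: field_simps)
        ultimately show ?thesis by (simp only: powr_powr)
      qed
      moreover have sum1: "(1 - 1 / p) / \<alpha> + ((1 - s) / p) / \<alpha> = 1"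
      proof -
        have "(1 - 1 / p) + (1 - s) / p = \<alpha>" by (simp add: \<alpha>_def diff_divide_distrib)
        then show ?thesis using \<alpha> by (metis add_divide_distrib divide_self_if order_less_irrefl)
      qed
      ultimately have "\<zeta> j powr (1 / \<alpha>) * \<kappa> j powr (1 / \<alpha>) \<le> ((1 - 1 / p) / \<alpha>) * \<zeta> j powr (p / (p - 1)) + (((1 - s) / p) / \<alpha>) * \<kappa> j powr (p / (1 - s))"
        using p s \<alpha> sum1 by (simp only:, intro weighted_young) auto
      then have "y j powr (1 / \<alpha>) \<le> ((1 - 1 / p) / \<alpha>) * \<zeta> j powr (p / (p - 1)) + (((1 - s) / p) / \<alpha>) * \<kappa> j powr (p / (1 - s))"
        using y_le[of j] by simp
      then have "\<alpha> * y j powr (1 / \<alpha>) \<le> \<alpha> * (((1 - 1 / p) / \<alpha>) * \<zeta> j powr (p / (p - 1)) + (((1 - s) / p) / \<alpha>) * \<kappa> j powr (p / (1 - s)))"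
        using \<alpha> by (intro mult_left_mono) auto
      then show ?thesis using \<alpha> by (simp add: distrib_left)
    qed
    then have "\<alpha> * (\<Sum>j\<in>UNIV. y j powr (1 / \<alpha>)) \<le> (\<Sum>j\<in>UNIV. (1 - 1 / p) * \<zeta> j powr (p / (p - 1)) + ((1 - s) / p) * \<kappa> j powr (p / (1 - s)))"
      by (subst sum_distrib_left) (intro sum_mono)
    also have "\<dots> = (1 - 1 / p) * (\<Sum>j\<in>UNIV. \<zeta> j powr (p / (p - 1))) + ((1 - s) / p) * (\<Sum>j\<in>UNIV. \<kappa> j powr (p / (1 - s)))"
      by (simp add: sum.distrib sum_distrib_left)
    also have "(\<Sum>j\<in>UNIV. \<zeta> j powr (p / (p - 1))) \<le> (\<Sum>l\<in>UNIV. (x l powr (p - 1)) powr (p / (p - 1)))"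
      unfolding \<zeta>_def using p by (intro sum_powr_doubly_substochastic_le c) (auto simp: le_divide_eq)
    also have "\<dots> = (\<Sum>l\<in>UNIV. x l powr p)" using p by (simp add: powr_powr)
    finally show ?thesis using p by (simp add: mult_left_mono)
  qed
  also have "\<dots> \<le> (1 - 1 / p) * (\<Sum>l\<in>UNIV. x l powr p) + ((1 - s) / p) * (\<Sum>l\<in>UNIV. k l powr (2 * p / (1 - s)))"
    using K p s by (intro add_left_mono mult_left_mono) auto
  finally show ?thesis by (simp add: \<alpha>_def)
qed

section \<open>Trace inequalities\<close>

abbreviation conj_diag :: "complex^'n^'n \<Rightarrow> ('n \<Rightarrow> real) \<Rightarrow> complex^'n^'n" where
  "conj_diag U l \<equiv> U ** real_diag l ** cadjoint U"

lemma real_diag_mult: "real_diag a ** real_diag b = real_diag (\<lambda>i. a i * b i)"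
  by (simp add: vec_eq_iff real_diag_mult_left) (simp add: real_diag_def)

lemma cadjoint_real_diag [simp]: "cadjoint (real_diag a) = real_diag a"
  by (simp add: vec_eq_iff cadjoint_def real_diag_def)

lemma cnj_mult_self: "cnj z * z = complex_of_real ((cmod z)\<^sup>2)"
  by (metis complex_norm_square mult.commute)

lemma cadjoint_mult_self_diag:
  "(cadjoint M ** M) $ j $ j = complex_of_real (\<Sum>i\<in>UNIV. (cmod (M $ i $ j))\<^sup>2)"
  by (simp add: matrix_matrix_mult_def cadjoint_def cnj_mult_self del: of_real_power)

lemma norm_matrix_sq: "(norm (M :: complex^'n^'m))\<^sup>2 = (\<Sum>i\<in>UNIV. \<Sum>j\<in>UNIV. (cmod (M $ i $ j))\<^sup>2)"
  by (simp add: norm_vec_def L2_set_def sum_nonneg)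

lemma trace_cadjoint_mult: "trace (cadjoint M ** M) = complex_of_real ((norm M)\<^sup>2)"
  unfolding trace_def cadjoint_mult_self_diag norm_matrix_sq by (subst sum.swap) simp

lemma unitary_matD:
  assumes "unitary_mat U"
  shows "cadjoint U ** U = mat 1" "U ** cadjoint U = mat 1"
  using assms by (auto simp: unitary_mat_def)

lemma unitary_cancel:
  assumes "unitary_mat U"
  shows "cadjoint U ** (U ** A) = A" "U ** (cadjoint U ** A) = A"
  by (simp_all add: matrix_mul_assoc unitary_matD[OF assms])

lemma unitary_cadjoint: "unitary_mat U \<Longrightarrow> unitary_mat (cadjoint U)"
  by (auto simp: unitary_mat_def)

lemma norm_unitary_mult:
  fixes U M :: "complex^'n^'n"
  assumes "unitary_mat U" shows "norm (U ** M) = norm M"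
proof -
  have "complex_of_real ((norm (U ** M))\<^sup>2) = of_real ((norm M)\<^sup>2)"
    unfolding trace_cadjoint_mult[symmetric]
    by (simp add: cadjoint_mult unitary_cancel[OF assms] del: of_real_power flip: matrix_mul_assoc)
  then show ?thesis by (metis of_real_eq_iff norm_ge_zero power2_eq_imp_eq)
qed

text \<open>The squared norm is the trace of \<open>L ** (M ** cadjoint M) ** cadjoint L\<close>.
  This allows a non-Hermitian \<open>M\<close> to be replaced by a square root adapted to the
  eigenbasis of \<open>M ** cadjoint M\<close>.\<close>

lemma norm_mult_right_cong:
  fixes L M N :: "complex^'n^'n"
  assumes "M ** cadjoint M = N ** cadjoint N"
  shows "norm (L ** M) = norm (L ** N)"
proof -
  have *: "trace (cadjoint (L ** M) ** (L ** M)) = trace (L ** (M ** cadjoint M) ** cadjoint L)"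
    for M :: "complex^'n^'n"
    by (subst trace_mul_sym) (simp add: cadjoint_mult matrix_mul_assoc)
  have "complex_of_real ((norm (L ** M))\<^sup>2) = complex_of_real ((norm (L ** N))\<^sup>2)"
    unfolding trace_cadjoint_mult[symmetric] * by (simp add: assms)
  then show ?thesis by (metis of_real_eq_iff norm_ge_zero power2_eq_imp_eq)
qed

text \<open>Cyclicity of the trace moves \<open>D ** V\<close> together with its adjoint; the inner
  sum is the squared norm of \<open>D\<close> applied to column \<open>j\<close> of
  \<open>V\<close>.\<close>

lemma trace_spectral_mult_sq:
  fixes D V :: "complex^'n^'n"
  assumes D: "hermitian_mat D"
  shows "Re (trace (conj_diag V c ** (D ** D)))
    = (\<Sum>j\<in>UNIV. c j * (\<Sum>i\<in>UNIV. (cmod ((D ** V) $ i $ j))\<^sup>2))"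
proof -
  have "trace (conj_diag V c ** (D ** D)) = trace (V ** (real_diag c ** cadjoint V ** (D ** D)))"
    by (simp only: matrix_mul_assoc)
  also have "\<dots> = trace (real_diag c ** cadjoint V ** (D ** D) ** V)" by (rule trace_mul_sym)
  also have "\<dots> = trace (real_diag c ** (cadjoint (D ** V) ** (D ** V)))"
    using D by (simp add: cadjoint_mult hermitian_mat_def matrix_mul_assoc)
  also have "\<dots> = (\<Sum>j\<in>UNIV. complex_of_real (c j * (\<Sum>i\<in>UNIV. (cmod ((D ** V) $ i $ j))\<^sup>2)))"
    unfolding trace_def real_diag_mult_left cadjoint_mult_self_diag by simp
  finally show ?thesis by simp
qed

lemma column_norms_unitary:
  fixes U M :: "complex^'n^'n"
  assumes "unitary_mat U"
  shows "(\<Sum>i\<in>UNIV. (cmod ((U ** M) $ i $ j))\<^sup>2) = (\<Sum>i\<in>UNIV. (cmod (M $ i $ j))\<^sup>2)"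
proof -
  have "cadjoint (U ** M) ** (U ** M) = cadjoint M ** M"
    by (simp add: cadjoint_mult unitary_cancel[OF assms] flip: matrix_mul_assoc)
  then show ?thesis using cadjoint_mult_self_diag[of M j] cadjoint_mult_self_diag[of "U ** M" j] by (metis of_real_eq_iff)
qed

lemma hermitian_real_diag_conj: "hermitian_mat (conj_diag U l)"
  by (simp add: hermitian_mat_def cadjoint_mult matrix_mul_assoc)

text \<open>Between the two eigenbases \<open>D\<close> becomes
  \<open>E = cadjoint U ** D ** V\<close>, and the left side is the sum of
  \<open>(w i)\<^sup>2 * y j\<close> times the squared modulus of the entry of \<open>E\<close>.
  Scalar Young separates \<open>i\<close> from \<open>j\<close>; the free index then sums to the
  squared length of \<open>D\<close> applied to a column of \<open>V\<close> or of
  \<open>U\<close>.\<close>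

lemma matrix_young:
  fixes D M U V :: "complex^'n^'n"
  assumes D: "hermitian_mat D" and U: "unitary_mat U" and V: "unitary_mat V"
    and M: "M ** cadjoint M = conj_diag V y"
    and w: "\<And>i. 0 \<le> w i" and y: "\<And>i. 0 \<le> y i"
    and \<alpha>: "0 < \<alpha>" "0 < \<beta>" "\<alpha> + \<beta> = 1"
  shows "(norm (conj_diag U w ** D ** M))\<^sup>2
    \<le> \<alpha> * Re (trace (conj_diag V (\<lambda>i. y i powr (1 / \<alpha>)) ** (D ** D)))
      + \<beta> * Re (trace (conj_diag U (\<lambda>i. w i powr (2 / \<beta>)) ** (D ** D)))"
proof -
  define E where "E = cadjoint U ** D ** V"
  let ?sq = "\<lambda>i j. (cmod (E $ i $ j))\<^sup>2"
  \<comment> \<open>\<open>V ** real_diag (sqrt \<circ> y)\<close> has the same product with its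
    adjoint as \<open>M\<close>, so it may replace \<open>M\<close> inside the norm.\<close>
  have sqrt_y: "(V ** real_diag (\<lambda>i. sqrt (y i))) ** cadjoint (V ** real_diag (\<lambda>i. sqrt (y i))) = M ** cadjoint M"
  proof -
    have "real_diag (\<lambda>i. sqrt (y i)) ** real_diag (\<lambda>i. sqrt (y i)) = real_diag y"
      using y by (simp add: real_diag_mult)
    then show ?thesis unfolding M by (metis cadjoint_mult cadjoint_real_diag matrix_mul_assoc)
  qed
  have "norm (conj_diag U w ** D ** M)
      = norm (conj_diag U w ** D ** (V ** real_diag (\<lambda>i. sqrt (y i))))"
    by (rule norm_mult_right_cong) (rule sqrt_y[symmetric])
  also have "\<dots> = norm (U ** (real_diag w ** E ** real_diag (\<lambda>i. sqrt (y i))))"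
    by (simp add: E_def matrix_mul_assoc)
  also have "\<dots> = norm (real_diag w ** E ** real_diag (\<lambda>i. sqrt (y i)))"
    by (rule norm_unitary_mult[OF U])
  finally have "(norm (conj_diag U w ** D ** M))\<^sup>2
      = (\<Sum>i\<in>UNIV. \<Sum>j\<in>UNIV. (w i)\<^sup>2 * y j * ?sq i j)"
    using y by (simp add: norm_matrix_sq real_diag_mult_left real_diag_mult_right norm_mult power_mult_distrib mult_ac)
  also have "\<dots> \<le> (\<Sum>i\<in>UNIV. \<Sum>j\<in>UNIV. (\<alpha> * y j powr (1 / \<alpha>) + \<beta> * w i powr (2 / \<beta>)) * ?sq i j)"
  proof (intro sum_mono mult_right_mono)
    fix i j :: 'n
    have "y j = (y j powr (1 / \<alpha>)) powr \<alpha>" using \<alpha> y[of j] by (simp add: powr_powr)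
    moreover have "(w i)\<^sup>2 = (w i powr (2 / \<beta>)) powr \<beta>" using \<alpha> w[of i] by (simp add: powr_powr)
    ultimately have "(w i)\<^sup>2 * y j = (y j powr (1 / \<alpha>)) powr \<alpha> * (w i powr (2 / \<beta>)) powr \<beta>"
      by (metis mult.commute)
    also have "\<dots> \<le> \<alpha> * y j powr (1 / \<alpha>) + \<beta> * w i powr (2 / \<beta>)"
      using \<alpha> by (intro weighted_young) auto
    finally show "(w i)\<^sup>2 * y j \<le> \<alpha> * y j powr (1 / \<alpha>) + \<beta> * w i powr (2 / \<beta>)" .
  qed simp
  also have "\<dots> = \<alpha> * (\<Sum>j\<in>UNIV. y j powr (1 / \<alpha>) * (\<Sum>i\<in>UNIV. ?sq i j))
      + \<beta> * (\<Sum>i\<in>UNIV. w i powr (2 / \<beta>) * (\<Sum>j\<in>UNIV. ?sq i j))"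
  proof -
    have "(\<Sum>i\<in>UNIV. \<Sum>j\<in>UNIV. (\<alpha> * y j powr (1 / \<alpha>) + \<beta> * w i powr (2 / \<beta>)) * ?sq i j)
      = (\<Sum>i\<in>UNIV. \<Sum>j\<in>UNIV. \<alpha> * (y j powr (1 / \<alpha>) * ?sq i j))
        + (\<Sum>i\<in>UNIV. \<Sum>j\<in>UNIV. \<beta> * (w i powr (2 / \<beta>) * ?sq i j))"
      by (simp only: distrib_right sum.distrib mult.assoc)
    also have "(\<Sum>i\<in>UNIV. \<Sum>j\<in>UNIV. \<alpha> * (y j powr (1 / \<alpha>) * ?sq i j))
      = (\<Sum>j\<in>UNIV. \<Sum>i\<in>UNIV. \<alpha> * (y j powr (1 / \<alpha>) * ?sq i j))"
      by (rule sum.swap)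
    finally show ?thesis by (simp only: sum_distrib_left)
  qed
  also have "(\<Sum>j\<in>UNIV. y j powr (1 / \<alpha>) * (\<Sum>i\<in>UNIV. ?sq i j))
     = Re (trace (conj_diag V (\<lambda>i. y i powr (1 / \<alpha>)) ** (D ** D)))"
    unfolding trace_spectral_mult_sq[OF D] E_def
    by (simp add: column_norms_unitary[OF unitary_cadjoint[OF U]] flip: matrix_mul_assoc)
  also have "(\<Sum>i\<in>UNIV. w i powr (2 / \<beta>) * (\<Sum>j\<in>UNIV. ?sq i j))
     = Re (trace (conj_diag U (\<lambda>i. w i powr (2 / \<beta>)) ** (D ** D)))"
  proof -
    have "?sq i j = (cmod ((cadjoint V ** (D ** U)) $ j $ i))\<^sup>2" for i j
    proof -
      have "cadjoint V ** (D ** U) = cadjoint E"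
        using D by (simp add: E_def cadjoint_mult hermitian_mat_def)
      then show ?thesis by (simp add: cadjoint_def)
    qed
    then show ?thesis
      unfolding trace_spectral_mult_sq[OF D]
      by (simp add: column_norms_unitary[OF unitary_cadjoint[OF V]])
  qed
  finally show ?thesis .
qed

text \<open>Column sums are the diagonal entries \<open>e j\<close>. For rows,
  \<open>N = T ** cadjoint T\<close> satisfies \<open>cadjoint N ** N = N\<close>, so a diagonal
  entry \<open>t\<close> of \<open>N\<close> obeys \<open>t\<^sup>2 \<le> t\<close>.\<close>

lemma partial_isometry_doubly_substochastic:
  fixes T :: "complex^'n^'n"
  assumes TT: "cadjoint T ** T = real_diag e" and Te: "T ** real_diag e = T"
    and e: "\<And>j. 0 \<le> e j" "\<And>j. e j \<le> 1"
  shows "doubly_substochastic (\<lambda>j l. (cmod (T $ l $ j))\<^sup>2)"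
proof -
  have col: "(\<Sum>l\<in>UNIV. (cmod (T $ l $ j))\<^sup>2) \<le> 1" for j
  proof -
    have "complex_of_real (\<Sum>l\<in>UNIV. (cmod (T $ l $ j))\<^sup>2) = of_real (e j)"
      unfolding cadjoint_mult_self_diag[symmetric] TT by (simp add: real_diag_def)
    then show ?thesis using e(2)[of j] by (simp only: of_real_eq_iff)
  qed
  have row: "(\<Sum>j\<in>UNIV. (cmod (T $ l $ j))\<^sup>2) \<le> 1" for l
  proof -
    define N where "N = T ** cadjoint T"
    define t where "t = (\<Sum>j\<in>UNIV. (cmod (T $ l $ j))\<^sup>2)"
    have N_diag: "N $ l $ l = complex_of_real t"
      using cadjoint_mult_self_diag[of "cadjoint T" l] by (simp add: N_def t_def cadjoint_def)
    have "cadjoint N ** N = T ** (cadjoint T ** T) ** cadjoint T"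
      by (simp add: N_def cadjoint_mult matrix_mul_assoc)
    also have "\<dots> = N" by (simp add: TT Te N_def)
    finally have "complex_of_real (\<Sum>i\<in>UNIV. (cmod (N $ i $ l))\<^sup>2) = of_real t"
      by (simp only: cadjoint_mult_self_diag[symmetric] N_diag)
    then have "(\<Sum>i\<in>UNIV. (cmod (N $ i $ l))\<^sup>2) = t" by (simp only: of_real_eq_iff)
    moreover have "(cmod (N $ l $ l))\<^sup>2 \<le> (\<Sum>i\<in>UNIV. (cmod (N $ i $ l))\<^sup>2)"
      by (rule member_le_sum) auto
    ultimately have "t\<^sup>2 \<le> t" by (simp add: N_diag)
    then have "\<not> 1 < t" using mult_strict_left_mono[of 1 t t] by (auto simp: power2_eq_square)
    then show ?thesis by (simp add: t_def)
  qed
  show ?thesis using col row by (simp add: doubly_substochastic_def)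
qed

lemma unitary_doubly_substochastic:
  assumes "unitary_mat U" shows "doubly_substochastic (\<lambda>j l. (cmod (U $ l $ j))\<^sup>2)"
  by (rule partial_isometry_doubly_substochastic[where e = "\<lambda>_. 1"])
     (auto simp: unitary_matD[OF assms] real_diag_def vec_eq_iff mat_def
       real_diag_mult_right[unfolded real_diag_def])

lemma unitary_mult: "unitary_mat U \<Longrightarrow> unitary_mat V \<Longrightarrow> unitary_mat (U ** V)"
  unfolding unitary_mat_def by (metis cadjoint_mult matrix_mul_assoc matrix_mul_lid)

lemma cmod_cadjoint_mult_sq_le:
  fixes M N :: "complex^'n^'n"
  shows "(cmod ((cadjoint M ** N) $ j $ j))\<^sup>2 \<le> (\<Sum>i\<in>UNIV. (cmod (M $ i $ j))\<^sup>2) * (\<Sum>i\<in>UNIV. (cmod (N $ i $ j))\<^sup>2)"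
proof -
  have "cmod ((cadjoint M ** N) $ j $ j) \<le> (\<Sum>i\<in>UNIV. \<bar>cmod (M $ i $ j)\<bar> * \<bar>cmod (N $ i $ j)\<bar>)"
    by (simp add: matrix_matrix_mult_def cadjoint_def) (rule sum_norm_le, simp add: norm_mult)
  also have "\<dots> \<le> L2_set (\<lambda>i. cmod (M $ i $ j)) UNIV * L2_set (\<lambda>i. cmod (N $ i $ j)) UNIV"
    by (rule L2_set_mult_ineq)
  finally have "(cmod ((cadjoint M ** N) $ j $ j))\<^sup>2 \<le> (L2_set (\<lambda>i. cmod (M $ i $ j)) UNIV * L2_set (\<lambda>i. cmod (N $ i $ j)) UNIV)\<^sup>2"
    by (intro power_mono) auto
  also have "\<dots> = (\<Sum>i\<in>UNIV. (cmod (M $ i $ j))\<^sup>2) * (\<Sum>i\<in>UNIV. (cmod (N $ i $ j))\<^sup>2)"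
    by (simp add: power_mult_distrib L2_set_def sum_nonneg)
  finally show ?thesis .
qed

lemma column_norm_spectral_mult:
  fixes U T :: "complex^'n^'n"
  assumes "unitary_mat U"
  shows "(\<Sum>i\<in>UNIV. (cmod ((conj_diag U a ** T) $ i $ j))\<^sup>2)
    = (\<Sum>l\<in>UNIV. (cmod ((cadjoint U ** T) $ l $ j))\<^sup>2 * (a l)\<^sup>2)"
proof -
  have "conj_diag U a ** T = U ** (real_diag a ** (cadjoint U ** T))"
    by (simp only: matrix_mul_assoc)
  then show ?thesis
    by (simp only: column_norms_unitary[OF assms] real_diag_mult_left)
       (simp add: norm_mult power_mult_distrib mult.commute)
qed

text \<open>With the singular value decomposition \<open>Q K V = H diag(\<surd>y)\<close>, where \<open>H\<close> is a partial isometry,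
  \<open>\<surd>y\<^sub>j = \<langle>Q h\<^sub>j, K v\<^sub>j\<rangle>\<close>.\<close>

lemma singular_values_product_le:
  fixes U P V :: "complex^'n^'n"
  assumes U: "unitary_mat U" and P: "unitary_mat P" and V: "unitary_mat V"
    and K: "K = conj_diag U k" and Q: "Q = conj_diag P x"
    and Y: "K ** Q ** Q ** K = conj_diag V y" and y: "\<And>j. 0 \<le> y j"
  obtains c e where "doubly_substochastic c" "doubly_substochastic e"
    "\<And>j. y j \<le> (\<Sum>l\<in>UNIV. c j l * (x l)\<^sup>2) * (\<Sum>l\<in>UNIV. e j l * (k l)\<^sup>2)"
proof -
  have aK: "cadjoint K = K" and aQ: "cadjoint Q = Q"
    unfolding K Q using hermitian_real_diag_conj by (auto simp: hermitian_mat_def)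
  define S where "S = Q ** K ** V"
  have SS: "cadjoint S ** S = real_diag y"
  proof -
    have "cadjoint S ** S = cadjoint V ** (K ** Q ** Q ** K) ** V"
      by (simp add: S_def cadjoint_mult aK aQ matrix_mul_assoc)
    also have "\<dots> = (cadjoint V ** V) ** real_diag y ** (cadjoint V ** V)"
      unfolding Y by (simp only: matrix_mul_assoc)
    finally show ?thesis by (simp add: unitary_matD[OF V])
  qed
  \<comment> \<open>Division by zero gives \<open>0\<close>, so columns of \<open>S\<close> with
    \<open>y j = 0\<close> are sent to zero columns of \<open>H\<close>; this is what makes
    \<open>H\<close> a partial isometry.\<close>
  define \<delta> where "\<delta> j = 1 / sqrt (y j)" for j
  define \<eta> where "\<eta> j = (if y j = 0 then 0 else 1 :: real)" for j
  define H where "H = S ** real_diag \<delta>"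
  have HS: "cadjoint H ** S = real_diag (\<lambda>j. sqrt (y j))"
  proof -
    have "\<delta> j * y j = sqrt (y j)" for j using y[of j] by (simp add: \<delta>_def real_div_sqrt)
    then show ?thesis by (simp add: H_def cadjoint_mult SS real_diag_mult flip: matrix_mul_assoc)
  qed
  have HH: "cadjoint H ** H = real_diag \<eta>"
  proof -
    have "sqrt (y j) * \<delta> j = \<eta> j" for j using y[of j] by (simp add: \<delta>_def \<eta>_def)
    then show ?thesis by (subst (2) H_def) (simp add: HS matrix_mul_assoc real_diag_mult)
  qed
  have H\<eta>: "H ** real_diag \<eta> = H"
  proof -
    have "(\<lambda>j. \<delta> j * \<eta> j) = \<delta>" by (auto simp: \<delta>_def \<eta>_def)
    then show ?thesis by (simp add: H_def real_diag_mult flip: matrix_mul_assoc)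
  qed
  define T where "T = cadjoint P ** H"
  have T: "doubly_substochastic (\<lambda>j l. (cmod (T $ l $ j))\<^sup>2)"
  proof (rule partial_isometry_doubly_substochastic[where e = \<eta>])
    show "cadjoint T ** T = real_diag \<eta>"
      by (simp add: T_def cadjoint_mult unitary_cancel[OF P] HH flip: matrix_mul_assoc)
    show "T ** real_diag \<eta> = T" by (simp add: T_def H\<eta> flip: matrix_mul_assoc)
  qed (auto simp: \<eta>_def)
  define E where "E = cadjoint U ** V"
  have E: "doubly_substochastic (\<lambda>j l. (cmod (E $ l $ j))\<^sup>2)"
    unfolding E_def by (intro unitary_doubly_substochastic unitary_mult unitary_cadjoint U V)
  have "y j \<le> (\<Sum>l\<in>UNIV. (cmod (T $ l $ j))\<^sup>2 * (x l)\<^sup>2) * (\<Sum>l\<in>UNIV. (cmod (E $ l $ j))\<^sup>2 * (k l)\<^sup>2)" for j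
  proof -
    \<comment> \<open>After Cauchy-Schwarz, column \<open>j\<close> of \<open>Q ** H\<close> is
      measured in the eigenbasis \<open>P\<close> and that of \<open>K ** V\<close> in the
      eigenbasis \<open>U\<close>; the coordinates are the entries of \<open>T\<close> and
      \<open>E\<close>.\<close>
    have "cadjoint (Q ** H) ** (K ** V) = real_diag (\<lambda>j. sqrt (y j))"
      using HS by (simp add: S_def cadjoint_mult aQ matrix_mul_assoc)
    then have "(cadjoint (Q ** H) ** (K ** V)) $ j $ j = complex_of_real (sqrt (y j))"
      by (simp add: real_diag_def)
    then have "y j = (cmod ((cadjoint (Q ** H) ** (K ** V)) $ j $ j))\<^sup>2" using y[of j] by simp
    also have "\<dots> \<le> (\<Sum>i\<in>UNIV. (cmod ((Q ** H) $ i $ j))\<^sup>2) * (\<Sum>i\<in>UNIV. (cmod ((K ** V) $ i $ j))\<^sup>2)"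
      by (rule cmod_cadjoint_mult_sq_le)
    finally show ?thesis
      by (simp only: Q K column_norm_spectral_mult[OF P] column_norm_spectral_mult[OF U] T_def E_def)
  qed
  with T E show ?thesis by (rule that)
qed

section \<open>Positive semidefinite matrices and their traces\<close>

definition psd :: "complex^'n^'n \<Rightarrow> bool" where
  "psd A \<longleftrightarrow> (\<exists>U l. unitary_mat U \<and> A = conj_diag U l \<and> (\<forall>i. 0 \<le> l i))"

lemma trace_real_diag_conj:
  assumes "unitary_mat U"
  shows "trace (conj_diag U l) = complex_of_real (\<Sum>i\<in>UNIV. l i)"
proof -
  have "trace (conj_diag U l) = trace (cadjoint U ** (U ** real_diag l))"
    by (rule trace_mul_sym)
  then show ?thesis by (simp add: unitary_cancel[OF assms]) (simp add: trace_def real_diag_def)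
qed

lemma hermitian_hermitian_fun: "hermitian_mat A \<Longrightarrow> hermitian_mat (hermitian_fun \<phi> A)"
  by (metis hermitian_fun_eq hermitian_real_diag_conj hermitian_spectral)

lemma psd_hermitian: "psd A \<Longrightarrow> hermitian_mat A"
  by (auto simp: psd_def hermitian_real_diag_conj)

lemma psd_hermitian_fun:
  assumes "hermitian_mat A" "\<And>x. 0 \<le> \<phi> x" shows "psd (hermitian_fun \<phi> A)"
proof -
  obtain U l where "unitary_mat U" "A = conj_diag U l"
    using hermitian_spectral[OF assms(1)] .
  then show ?thesis unfolding psd_def using assms(2) by (metis (no_types) hermitian_fun_eq)
qed

text \<open>The eigenvalue \<open>l j\<close> is the squared length of column \<open>j\<close> of
  \<open>cadjoint M ** U\<close>.\<close>

lemma psd_mult_cadjoint: "psd ((M :: complex^'n^'n) ** cadjoint M)"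
proof -
  have "hermitian_mat (M ** cadjoint M)" by (simp add: hermitian_mat_def cadjoint_mult)
  then obtain U l where U: "unitary_mat U" and M: "M ** cadjoint M = conj_diag U l"
    by (rule hermitian_spectral)
  have "cadjoint (cadjoint M ** U) ** (cadjoint M ** U) = cadjoint U ** (M ** cadjoint M) ** U"
    by (simp add: cadjoint_mult matrix_mul_assoc)
  also have "\<dots> = (cadjoint U ** U) ** real_diag l ** (cadjoint U ** U)"
    unfolding M by (simp only: matrix_mul_assoc)
  also have "\<dots> = real_diag l" by (simp add: unitary_matD[OF U])
  finally have "complex_of_real (l j) = of_real (\<Sum>i\<in>UNIV. (cmod ((cadjoint M ** U) $ i $ j))\<^sup>2)" for j
    by (simp add: cadjoint_mult_self_diag[symmetric] real_diag_def del: of_real_sum)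
  then have "0 \<le> l j" for j by (simp only: of_real_eq_iff) (simp add: sum_nonneg)
  with U M show ?thesis unfolding psd_def by blast
qed

lemma real_diag_conj_entry:
  "(conj_diag U l) $ i $ j = (\<Sum>k\<in>UNIV. complex_of_real (l k) * (U $ i $ k * cnj (U $ j $ k)))"
  by (subst matrix_matrix_mult_def) (simp add: real_diag_mult_right cadjoint_def mult_ac)

lemma cmod_unitary_entry_le: 
  assumes "unitary_mat U" shows "cmod (U $ i $ j) \<le> 1"
proof -
  have "(cmod (U $ i $ j))\<^sup>2 \<le> (\<Sum>l\<in>UNIV. (cmod (U $ l $ j))\<^sup>2)" by (rule member_le_sum) auto
  also have "\<dots> \<le> 1" using unitary_doubly_substochastic[OF assms] by (auto simp: doubly_substochastic_def)
  finally show ?thesis using power2_le_imp_le[of "cmod (U $ i $ j)" 1] by simp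
qed

lemma psd_trace_nonneg: "psd V \<Longrightarrow> 0 \<le> Re (trace V)"
  by (auto simp: psd_def trace_real_diag_conj intro!: sum_nonneg)

text \<open>Converts trace bounds on a weight into the entrywise bound that the error estimate for
  weighted energies requires. Entries of a unitary matrix have modulus at most one.\<close>

lemma psd_entry_le_trace:
  assumes "psd V" shows "cmod (V $ i $ j) \<le> Re (trace V)"
proof -
  obtain U l where U: "unitary_mat U" and V: "V = conj_diag U l" and l: "\<And>i. 0 \<le> l i"
    using assms by (auto simp: psd_def)
  have "cmod (V $ i $ j) \<le> (\<Sum>k\<in>UNIV. l k)"
    unfolding V real_diag_conj_entry
  proof (rule sum_norm_le)
    fix k
    have "cmod (U $ i $ k) * cmod (U $ j $ k) \<le> 1 * 1"
      by (intro mult_mono cmod_unitary_entry_le U) auto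
    then show "cmod (complex_of_real (l k) * (U $ i $ k * cnj (U $ j $ k))) \<le> l k"
      using l[of k] by (simp add: norm_mult mult_left_le)
  qed
  then show ?thesis by (simp add: V trace_real_diag_conj[OF U])
qed

text \<open>In the eigenbasis of \<open>V\<close> each diagonal entry of \<open>G\<close> is some
  \<open>cdot u (G *v u)\<close> with \<open>u\<close> a unit vector. The real part is taken since
  \<open>G\<close> will be a value of \<open>\<Gamma>\<close>, built from arbitrary representatives
  of \<open>L2\<close> classes and thus perhaps not Hermitian at an individual point.\<close>

lemma Re_trace_psd_mult_le:
  fixes V G :: "complex^'n^'n"
  assumes "psd V" shows "Re (trace (V ** G)) \<le> Re (trace V) * op_norm G"
proof -
  obtain U l where U: "unitary_mat U" and V: "V = conj_diag U l" and l: "\<And>i. 0 \<le> l i"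
    using assms by (auto simp: psd_def)
  have "trace (V ** G) = trace (U ** (real_diag l ** cadjoint U ** G))" by (simp add: V matrix_mul_assoc)
  also have "\<dots> = trace (real_diag l ** (cadjoint U ** G ** U))"
    by (subst trace_mul_sym) (simp add: matrix_mul_assoc)
  also have "\<dots> = (\<Sum>k\<in>UNIV. complex_of_real (l k) * (cadjoint U ** (G ** U)) $ k $ k)"
    unfolding trace_def real_diag_mult_left by (simp add: matrix_mul_assoc)
  finally have "Re (trace (V ** G)) = (\<Sum>k\<in>UNIV. l k * Re ((cadjoint U ** (G ** U)) $ k $ k))" by simp
  also have "\<dots> \<le> (\<Sum>k\<in>UNIV. l k * op_norm G)"
  proof (intro sum_mono mult_left_mono l)
    fix k
    define u where "u = (\<chi> m. U $ m $ k)"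
    have "cdot u u = (cadjoint U ** U) $ k $ k"
      by (simp add: cdot_def u_def matrix_matrix_mult_def cadjoint_def)
    then have "complex_of_real ((norm u)\<^sup>2) = of_real 1" by (simp add: cdot_self unitary_matD[OF U] mat_def)
    then have "(norm u)\<^sup>2 = 1" by (simp only: of_real_eq_iff)
    then have u: "norm u = 1" using norm_ge_zero[of u] by (auto simp: power2_eq_1_iff)
    have "(cadjoint U ** (G ** U)) $ k $ k = cdot u (G *v u)"
      by (simp add: cdot_def u_def matrix_matrix_mult_def matrix_vector_mult_def cadjoint_def)
    then have "Re ((cadjoint U ** (G ** U)) $ k $ k) = u \<bullet> (G *v u)" by (simp add: inner_eq_Re_cdot)
    also have "\<dots> \<le> norm u * norm (G *v u)" by (rule norm_cauchy_schwarz)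
    also have "\<dots> \<le> op_norm G"
      using onorm[OF bounded_linear_matrix_vector, of G u] u by (simp add: op_norm_def)
    finally show "Re ((cadjoint U ** (G ** U)) $ k $ k) \<le> op_norm G" .
  qed
  also have "\<dots> = Re (trace V) * op_norm G" by (simp add: V trace_real_diag_conj[OF U] sum_distrib_right)
  finally show ?thesis .
qed

lemma op_norm_nonneg: "0 \<le> op_norm G"
  unfolding op_norm_def by (intro onorm_pos_le bounded_linear_matrix_vector)

text \<open>\<open>damp \<epsilon> 1\<close> is the truncation \<open>e\<^sup>x / (1 + \<epsilon> e\<^sup>x)\<close> of the exponential; the factors \<open>e\<^bsup>sA\<^esup>\<close> and
  \<open>e\<^bsup>(1-s)B\<^esup>\<close> of its increments become \<open>damp \<epsilon> s\<close> and \<open>damp \<epsilon> (1 - s)\<close>.\<close>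

definition damp :: "real \<Rightarrow> real \<Rightarrow> real \<Rightarrow> real" where
  "damp \<epsilon> s x = exp (s * x) / (1 + \<epsilon> * exp x)"

lemma damp_denominator: "0 < \<epsilon> \<Longrightarrow> 1 < 1 + \<epsilon> * exp (x :: real)"
  by simp

lemma damp_pos: "0 < \<epsilon> \<Longrightarrow> 0 < damp \<epsilon> s x"
  unfolding damp_def by (intro divide_pos_pos) (auto intro: add_pos_pos)

lemma damp_1_le:
  assumes "0 < \<epsilon>" shows "damp \<epsilon> 1 x \<le> 1 / \<epsilon>" "damp \<epsilon> 1 x \<le> exp x"
proof -
  have "0 < 1 + \<epsilon> * exp x" using assms by (intro add_pos_pos) auto
  then show "damp \<epsilon> 1 x \<le> 1 / \<epsilon>" "damp \<epsilon> 1 x \<le> exp x"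
    using assms by (auto simp: damp_def field_simps)
qed

text \<open>With \<open>c = 1 + \<epsilon> * exp x\<close> the two sides are
  \<open>exp (a * x)\<close> divided by \<open>c powr (a / s)\<close> and by
  \<open>c powr a\<close>, where \<open>c \<ge> 1\<close> and \<open>a \<le> a / s\<close>. This is
  how powers of \<open>damp \<epsilon> s\<close> get a bound free of \<open>s\<close>.\<close>

lemma damp_powr_le:
  assumes "0 < \<epsilon>" "0 < s" "s \<le> 1" "0 \<le> a"
  shows "damp \<epsilon> s x powr (a / s) \<le> damp \<epsilon> 1 x powr a"
proof -
  define c where "c = 1 + \<epsilon> * exp x"
  have c: "1 \<le> c" using damp_denominator[OF assms(1), of x] by (simp add: c_def)
  have "damp \<epsilon> s x powr (a / s) = exp (a * x) / c powr (a / s)"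
    using assms c by (simp add: damp_def c_def[symmetric] powr_divide) (simp add: powr_def)
  also have "\<dots> \<le> exp (a * x) / c powr a"
  proof -
    have "a * s \<le> a * 1" using assms by (intro mult_left_mono) auto
    then have "a \<le> a / s" using assms by (simp add: le_divide_eq)
    then have "c powr a \<le> c powr (a / s)" using c by (intro powr_mono)
    then show ?thesis using c by (intro divide_left_mono mult_pos_pos) auto
  qed
  also have "\<dots> = damp \<epsilon> 1 x powr a"
    using c by (simp add: damp_def c_def[symmetric] powr_divide) (simp add: powr_def)
  finally show ?thesis .
qed

lemma continuous_on_damp: "0 < \<epsilon> \<Longrightarrow> continuous_on S (damp \<epsilon> s)"
proof -
  assume "0 < \<epsilon>"
  then have "1 + \<epsilon> * exp x \<noteq> 0" for x :: real using damp_denominator[of \<epsilon> x] by linarith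
  then show ?thesis unfolding damp_def by (intro continuous_intros) auto
qed

text \<open>The weights \<open>Y\<^bsup>r'\<^esup>/r'\<close> and (up to the factor \<open>s/p\<close>) an upper bound of \<open>W\<^sup>r\<close> that does not depend
  on \<open>s\<close>, for \<open>1/r' = 1 - s/p\<close>. The maximum makes the function continuous; \<open>K Q Q K\<close> is positive.\<close>

definition young_weight :: "real \<Rightarrow> real \<Rightarrow> real \<Rightarrow> complex^'n^'n \<Rightarrow> complex^'n^'n \<Rightarrow> complex^'n^'n" where
  "young_weight \<epsilon> p s Q B = (let K = hermitian_fun (damp \<epsilon> (1 - s)) B in
     (1 - s / p) *\<^sub>R hermitian_fun (\<lambda>y. max 0 y powr (1 / (1 - s / p))) (K ** Q ** Q ** K))"

definition power_weight :: "real \<Rightarrow> real \<Rightarrow> complex^'n^'n \<Rightarrow> complex^'n^'n" where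
  "power_weight \<epsilon> p = hermitian_fun (\<lambda>x. damp \<epsilon> 1 x powr (2 * p))"

lemma Re_trace_scaleR_mult: "Re (trace ((c *\<^sub>R A) ** B)) = c * Re (trace (A ** B))"
  by (simp add: trace_def matrix_matrix_mult_def sum_distrib_left algebra_simps)

lemma Re_trace_scaleR: "Re (trace (c *\<^sub>R A)) = c * Re (trace A)"
  by (simp add: trace_def sum_distrib_left)

lemma scaleR_real_diag_conj:
  "c *\<^sub>R (conj_diag U l) = conj_diag U (\<lambda>i. c * l i)"
  by (simp add: vec_eq_iff real_diag_conj_entry scaleR_conv_of_real[where 'a=complex] sum_distrib_left mult_ac)

lemma psd_scaleR: "psd A \<Longrightarrow> 0 \<le> c \<Longrightarrow> psd (c *\<^sub>R A)"
proof -
  assume "psd A" "0 \<le> c"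
  then obtain U l where U: "unitary_mat U" "A = conj_diag U l" "\<And>i. 0 \<le> l i"
    by (auto simp: psd_def)
  then have "c *\<^sub>R A = conj_diag U (\<lambda>i. c * l i)"
    by (simp add: scaleR_real_diag_conj)
  with U \<open>0 \<le> c\<close> show ?thesis unfolding psd_def by (metis mult_nonneg_nonneg)
qed

lemma hermitian_sandwich:
  assumes "hermitian_mat K" "hermitian_mat Q"
  shows "K ** Q ** Q ** K = (K ** Q) ** cadjoint (K ** Q)"
  using assms by (simp add: hermitian_mat_def cadjoint_mult matrix_mul_assoc)

lemma psd_power_weight: "hermitian_mat A \<Longrightarrow> psd (power_weight \<epsilon> p A)"
  unfolding power_weight_def by (intro psd_hermitian_fun) auto

lemma psd_young_weight:
  assumes "hermitian_mat B" "hermitian_mat Q" "s \<le> p" "0 < p"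
  shows "psd (young_weight \<epsilon> p s Q B)"
  unfolding young_weight_def Let_def using assms
  by (intro psd_scaleR psd_hermitian_fun, subst hermitian_sandwich)
     (auto intro: psd_hermitian psd_mult_cadjoint hermitian_hermitian_fun simp: divide_le_eq)

text \<open>The first bound degenerates as \<open>\<epsilon>\<close> tends to \<open>0\<close> and
  only supplies boundedness for fixed \<open>\<epsilon>\<close>; the second is uniform in
  \<open>\<epsilon>\<close> and leads to the final right-hand side.\<close>

lemma Re_trace_power_weight_le:
  fixes A :: "complex^'n^'n"
  assumes A: "hermitian_mat A" and "0 < \<epsilon>" "0 \<le> p"
  shows "Re (trace (power_weight \<epsilon> p A)) \<le> real CARD('n) * (1 / \<epsilon>) powr (2 * p)"
    and "Re (trace (power_weight \<epsilon> p A)) \<le> Re (trace (herm_exp ((2 * p) *\<^sub>R A)))"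
proof -
  obtain U l where U: "unitary_mat U" and Al: "A = conj_diag U l"
    using hermitian_spectral[OF A] .
  have pw: "Re (trace (power_weight \<epsilon> p A)) = (\<Sum>i\<in>UNIV. damp \<epsilon> 1 (l i) powr (2 * p))"
    by (simp add: power_weight_def hermitian_fun_eq[OF U Al] trace_real_diag_conj[OF U])
  have "\<dots> \<le> (\<Sum>i::'n\<in>UNIV. (1 / \<epsilon>) powr (2 * p))"
    using assms by (intro sum_mono powr_mono2 damp_1_le(1) less_imp_le[OF damp_pos]) auto
  then show "Re (trace (power_weight \<epsilon> p A)) \<le> real CARD('n) * (1 / \<epsilon>) powr (2 * p)"
    by (simp add: pw)
  have "(2 * p) *\<^sub>R A = conj_diag U (\<lambda>i. 2 * p * l i)"
    by (simp add: Al scaleR_real_diag_conj)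
  then have "Re (trace (herm_exp ((2 * p) *\<^sub>R A))) = (\<Sum>i\<in>UNIV. exp (2 * p * l i))"
    by (simp add: herm_exp_def hermitian_fun_eq[OF U] trace_real_diag_conj[OF U])
  moreover have "(\<Sum>i\<in>UNIV. damp \<epsilon> 1 (l i) powr (2 * p)) \<le> (\<Sum>i\<in>UNIV. exp (2 * p * l i))"
  proof (intro sum_mono)
    fix i
    have "damp \<epsilon> 1 (l i) powr (2 * p) \<le> exp (l i) powr (2 * p)"
      using assms by (intro powr_mono2 damp_1_le(2) less_imp_le[OF damp_pos]) auto
    then show "damp \<epsilon> 1 (l i) powr (2 * p) \<le> exp (2 * p * l i)" by (simp add: powr_def)
  qed
  ultimately show "Re (trace (power_weight \<epsilon> p A)) \<le> Re (trace (herm_exp ((2 * p) *\<^sub>R A)))"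
    by (simp add: pw)
qed

text \<open>This is \<open>matrix_young\<close> with \<open>M = K ** Q\<close> and conjugate weights
  \<open>1 - s / p\<close> and \<open>s / p\<close>. The exponent \<open>2 / (s / p)\<close> raises
  \<open>damp \<epsilon> s\<close> exactly so far that \<open>damp \<epsilon> 1\<close> to the power
  \<open>2 * p\<close> dominates it.\<close>

lemma weighted_difference_young:
  fixes A B D Q :: "complex^'n^'n"
  assumes A: "hermitian_mat A" and B: "hermitian_mat B" and Q: "hermitian_mat Q" and D: "hermitian_mat D"
    and \<epsilon>: "0 < \<epsilon>" and p: "1 \<le> p" and s: "0 < s" "s < 1"
  shows "(norm (hermitian_fun (damp \<epsilon> s) A ** D ** hermitian_fun (damp \<epsilon> (1 - s)) B ** Q))\<^sup>2
    \<le> Re (trace (young_weight \<epsilon> p s Q B ** (D ** D))) + (s / p) * Re (trace (power_weight \<epsilon> p A ** (D ** D)))"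
proof -
  define K where "K = hermitian_fun (damp \<epsilon> (1 - s)) B"
  have K: "hermitian_mat K" unfolding K_def by (rule hermitian_hermitian_fun[OF B])
  have sp: "0 < 1 - s / p" "0 < s / p" using p s by (auto simp: divide_less_eq)
  obtain U l where U: "unitary_mat U" and Al: "A = conj_diag U l"
    using hermitian_spectral[OF A] .
  obtain V y where V: "unitary_mat V" and M: "(K ** Q) ** cadjoint (K ** Q) = conj_diag V y"
    and y: "\<And>i. 0 \<le> y i"
    using psd_mult_cadjoint[of "K ** Q"] by (auto simp: psd_def)
  have yw: "young_weight \<epsilon> p s Q B = (1 - s / p) *\<^sub>R (conj_diag V (\<lambda>i. y i powr (1 / (1 - s / p))))"
    using y hermitian_fun_eq[OF V M]
    by (simp add: young_weight_def Let_def K_def[symmetric] hermitian_sandwich[OF K Q] max_absorb2)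
  have "(norm (hermitian_fun (damp \<epsilon> s) A ** D ** (K ** Q)))\<^sup>2
    \<le> (1 - s / p) * Re (trace (conj_diag V (\<lambda>i. y i powr (1 / (1 - s / p))) ** (D ** D)))
      + s / p * Re (trace (conj_diag U (\<lambda>i. damp \<epsilon> s (l i) powr (2 / (s / p))) ** (D ** D)))"
    unfolding hermitian_fun_eq[OF U Al]
    using sp by (intro matrix_young D U V M y less_imp_le[OF damp_pos[OF \<epsilon>]]) auto
  moreover have "Re (trace (conj_diag U (\<lambda>i. damp \<epsilon> s (l i) powr (2 / (s / p))) ** (D ** D)))
      \<le> Re (trace (power_weight \<epsilon> p A ** (D ** D)))"
  proof -
    have "damp \<epsilon> s (l i) powr (2 / (s / p)) \<le> damp \<epsilon> 1 (l i) powr (2 * p)" for i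
      using damp_powr_le[of \<epsilon> s "2 * p" "l i"] \<epsilon> p s by simp
    then show ?thesis
      unfolding power_weight_def hermitian_fun_eq[OF U Al] trace_spectral_mult_sq[OF D]
      by (intro sum_mono mult_right_mono sum_nonneg) auto
  qed
  then have "s / p * Re (trace (conj_diag U (\<lambda>i. damp \<epsilon> s (l i) powr (2 / (s / p))) ** (D ** D)))
      \<le> s / p * Re (trace (power_weight \<epsilon> p A ** (D ** D)))"
    using sp by (intro mult_left_mono) auto
  moreover have "hermitian_fun (damp \<epsilon> s) A ** D ** hermitian_fun (damp \<epsilon> (1 - s)) B ** Q
      = hermitian_fun (damp \<epsilon> s) A ** D ** (K ** Q)"
    by (simp only: K_def matrix_mul_assoc)
  ultimately show ?thesis unfolding yw Re_trace_scaleR_mult by simp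
qed

text \<open>A trace Hoelder inequality. The exponent of \<open>Q\<close> makes \<open>Q ** Q\<close>
  the power \<open>p - 1\<close> of \<open>X\<close>, and the eigenvalues of
  \<open>K ** Q ** Q ** K\<close> are controlled by those of \<open>X\<close> and of
  \<open>K\<close> through \<open>singular_values_product_le\<close>. The coefficient
  \<open>(1 - s) / p\<close> complements the \<open>s / p\<close> of
  \<open>weighted_difference_young\<close>.\<close>

lemma Re_trace_young_weight_le:
  fixes B X :: "complex^'n^'n"
  assumes B: "hermitian_mat B" and X: "psd X" and Q: "Q = hermitian_fun (\<lambda>x. x powr ((p - 1) / 2)) X"
    and \<epsilon>: "0 < \<epsilon>" and p: "1 \<le> p" and s: "0 < s" "s < 1"
  shows "Re (trace (young_weight \<epsilon> p s Q B))
    \<le> (1 - 1 / p) * Re (trace (herm_powr X p)) + ((1 - s) / p) * Re (trace (power_weight \<epsilon> p B))"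
proof -
  define K where "K = hermitian_fun (damp \<epsilon> (1 - s)) B"
  obtain U l where U: "unitary_mat U" and Bl: "B = conj_diag U l"
    using hermitian_spectral[OF B] .
  obtain P x where P: "unitary_mat P" and Xx: "X = conj_diag P x" and x: "\<And>i. 0 \<le> x i"
    using X by (auto simp: psd_def)
  note Kl = hermitian_fun_eq[OF U Bl, of "damp \<epsilon> (1 - s)", folded K_def]
  note Qx = hermitian_fun_eq[OF P Xx, of "\<lambda>x. x powr ((p - 1) / 2)", folded Q]
  have K: "hermitian_mat K" and QH: "hermitian_mat Q"
    using Kl Qx by (auto simp: hermitian_real_diag_conj)
  obtain V y where V: "unitary_mat V" and M: "K ** Q ** Q ** K = conj_diag V y"
    and y: "\<And>i. 0 \<le> y i"
    using psd_mult_cadjoint[of "K ** Q"] unfolding hermitian_sandwich[OF K QH] by (auto simp: psd_def)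
  obtain c e where c: "doubly_substochastic c" and e: "doubly_substochastic e"
    and le: "\<And>j. y j \<le> (\<Sum>m\<in>UNIV. c j m * (x m powr ((p - 1) / 2))\<^sup>2) * (\<Sum>m\<in>UNIV. e j m * (damp \<epsilon> (1 - s) (l m))\<^sup>2)"
    using singular_values_product_le[OF U P V Kl Qx M y] by blast
  have sq: "(x m powr ((p - 1) / 2))\<^sup>2 = x m powr (p - 1)" for m
    by (simp add: power2_eq_square flip: powr_add)
  have "Re (trace (young_weight \<epsilon> p s Q B)) = (1 - s / p) * (\<Sum>j\<in>UNIV. y j powr (1 / (1 - s / p)))"
    using y
    by (simp add: Re_trace_scaleR young_weight_def Let_def K_def[symmetric] hermitian_fun_eq[OF V M] max_absorb2 trace_real_diag_conj[OF V])
  also have "\<dots> \<le> (1 - 1 / p) * (\<Sum>m\<in>UNIV. x m powr p) + ((1 - s) / p) * (\<Sum>m\<in>UNIV. damp \<epsilon> (1 - s) (l m) powr (2 * p / (1 - s)))"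
    using le unfolding sq
    by (intro doubly_substochastic_holder[OF p s c e]) (auto intro: x y less_imp_le[OF damp_pos[OF \<epsilon>]])
  also have "\<dots> \<le> (1 - 1 / p) * (\<Sum>m\<in>UNIV. x m powr p) + ((1 - s) / p) * (\<Sum>m\<in>UNIV. damp \<epsilon> 1 (l m) powr (2 * p))"
    using \<epsilon> p s by (intro add_left_mono mult_left_mono sum_mono damp_powr_le) auto
  finally show ?thesis
    by (simp add: herm_powr_def power_weight_def hermitian_fun_eq[OF P Xx] hermitian_fun_eq[OF U Bl]
        trace_real_diag_conj[OF P] trace_real_diag_conj[OF U])
qed

section \<open>Differences of exponentials as midpoint sums\<close>

text \<open>The midpoint rule for the integral of \<open>e^{sa} (a - b) e^{(1-s)b}\<close> over
  \<open>[0,1]\<close> can be summed exactly. With \<open>h = (a - b) / n\<close> and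
  \<open>\<Delta> = e^{h/2} - e^{-h/2}\<close>, multiplication by \<open>\<Delta>\<close> telescopes
  the geometric sum, so the value is \<open>(exp a - exp b) / (\<Delta> / h)\<close>, and
  \<open>\<Delta> / h\<close> tends to the derivative \<open>1\<close>. Midpoints also keep every
  node strictly between \<open>0\<close> and \<open>1\<close>.\<close>

lemma midpoint_sum_exp_tendsto:
  fixes a b :: real
  shows "(\<lambda>n. (1 / real n) * (\<Sum>k<n. exp ((real k + 1/2) / real n * a) * (a - b) * exp ((1 - (real k + 1/2) / real n) * b)))
    \<longlonglongrightarrow> exp a - exp b"
proof (cases "a = b")
  case False
  define d where "d = a - b"
  have d: "d \<noteq> 0" using False by (simp add: d_def)
  have "DERIV (\<lambda>h::real. exp (h / 2) - exp (- h / 2)) 0 :> 1"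
    by (auto intro!: derivative_eq_intros)
  then have lim0: "((\<lambda>h::real. (exp (h / 2) - exp (- h / 2)) / h) \<longlongrightarrow> 1) (at 0)"
    by (simp add: DERIV_def)
  have "filterlim (\<lambda>n. d / real n) (at 0) sequentially"
    using d by (auto simp: filterlim_at eventually_sequentially intro!: exI[of _ 1] tendsto_divide_0[OF tendsto_const] filterlim_at_top_imp_at_infinity filterlim_real_sequentially)
  from filterlim_compose[OF lim0 this]
  have "(\<lambda>n. (exp a - exp b) / ((exp (d / real n / 2) - exp (- (d / real n) / 2)) / (d / real n))) \<longlonglongrightarrow> (exp a - exp b) / 1"
    by (intro tendsto_intros) auto
  moreover have "(1 / real n) * (\<Sum>k<n. exp ((real k + 1/2) / real n * a) * (a - b) * exp ((1 - (real k + 1/2) / real n) * b))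
      = (exp a - exp b) / ((exp (d / real n / 2) - exp (- (d / real n) / 2)) / (d / real n))" if "n > 0" for n
  proof -
    define h where "h = d / real n"
    have h: "h \<noteq> 0" "real n * h = d" using d that by (auto simp: h_def)
    define \<Delta> where "\<Delta> = exp (h / 2) - exp (- h / 2)"
    have "\<Delta> \<noteq> 0" using h by (auto simp: \<Delta>_def)
    have term_eq: "exp ((real k + 1/2) / real n * a) * (a - b) * exp ((1 - (real k + 1/2) / real n) * b)
        = d * exp (b + (real k + 1/2) * h)" for k
    proof -
      have "(real k + 1/2) / real n * a + (1 - (real k + 1/2) / real n) * b = b + (real k + 1/2) * h"
        using that by (simp add: h_def d_def field_simps)
      then show ?thesis by (simp add: d_def mult_ac flip: exp_add)
    qed
    have "exp (b + (real k + 1/2) * h) * \<Delta> = exp (b + real (Suc k) * h) - exp (b + real k * h)" for k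
      unfolding \<Delta>_def right_diff_distrib exp_add[symmetric] by (simp add: algebra_simps)
    then have "(\<Sum>k<n. exp (b + (real k + 1/2) * h)) * \<Delta> = (\<Sum>k<n. exp (b + real (Suc k) * h) - exp (b + real k * h))"
      by (simp add: sum_distrib_right)
    also have "\<dots> = exp (b + real n * h) - exp (b + real 0 * h)" by (rule sum_lessThan_telescope)
    also have "\<dots> = exp a - exp b" using h by (simp add: d_def)
    finally have S: "(\<Sum>k<n. exp (b + (real k + 1/2) * h)) = (exp a - exp b) / \<Delta>"
      using \<open>\<Delta> \<noteq> 0\<close> by (simp add: eq_divide_eq)
    have "(1 / real n) * (\<Sum>k<n. d * exp (b + (real k + 1/2) * h)) = h * ((exp a - exp b) / \<Delta>)"
      unfolding S[symmetric] by (simp add: h_def sum_distrib_left mult_ac)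
    also have "\<dots> = (exp a - exp b) / (\<Delta> / h)" using h by simp
    finally show ?thesis by (simp only: term_eq) (simp only: h_def \<Delta>_def)
  qed
  ultimately show ?thesis
    by (subst tendsto_cong[OF eventually_mono[OF eventually_gt_at_top[of 0]]]) auto
qed simp

text \<open>The denominators \<open>1 + \<epsilon> * exp a\<close> and
  \<open>1 + \<epsilon> * exp b\<close> do not involve \<open>s\<close> and factor out of the sum;
  the same two factors turn \<open>exp a - exp b\<close> into the increment of
  \<open>damp \<epsilon> 1\<close>.\<close>

lemma damp_midpoint_sum_tendsto:
  assumes "0 < \<epsilon>"
  shows "(\<lambda>n. (1 / real n) * (\<Sum>k<n. damp \<epsilon> ((real k + 1/2) / real n) a * (a - b) * damp \<epsilon> (1 - (real k + 1/2) / real n) b))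
    \<longlonglongrightarrow> damp \<epsilon> 1 a - damp \<epsilon> 1 b"
proof -
  define c where "c = (1 + \<epsilon> * exp a) * (1 + \<epsilon> * exp b)"
  have nz: "1 + \<epsilon> * exp a \<noteq> 0" "1 + \<epsilon> * exp b \<noteq> 0"
    using damp_denominator[OF assms, of a] damp_denominator[OF assms, of b] by linarith+
  have "(\<lambda>n. (1 / real n) * (\<Sum>k<n. exp ((real k + 1/2) / real n * a) * (a - b) * exp ((1 - (real k + 1/2) / real n) * b)) / c)
    \<longlonglongrightarrow> (exp a - exp b) / c"
    using nz by (intro tendsto_divide midpoint_sum_exp_tendsto tendsto_const) (auto simp: c_def)
  moreover have "(exp a - exp b) / c = damp \<epsilon> 1 a - damp \<epsilon> 1 b"
    using nz by (simp add: damp_def c_def field_simps)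
  moreover have "(1 / real n) * (\<Sum>k<n. exp ((real k + 1/2) / real n * a) * (a - b) * exp ((1 - (real k + 1/2) / real n) * b)) / c
     = (1 / real n) * (\<Sum>k<n. damp \<epsilon> ((real k + 1/2) / real n) a * (a - b) * damp \<epsilon> (1 - (real k + 1/2) / real n) b)" for n
    by (simp add: damp_def c_def sum_divide_distrib sum_distrib_left)
  ultimately show ?thesis by simp
qed

lemma matrix_diff_mult: "(A - B) ** C = A ** C - B ** (C :: complex^'n^'n)"
  by (simp add: vec_eq_iff matrix_matrix_mult_def sum_subtractf algebra_simps)

lemma matrix_mult_diff: "A ** (B - C) = A ** B - A ** (C :: complex^'n^'n)"
  by (simp add: vec_eq_iff matrix_matrix_mult_def sum_subtractf algebra_simps)

lemma matrix_sum_mult: "(\<Sum>k\<in>S. f k) ** (Q :: complex^'n^'n) = (\<Sum>k\<in>S. f k ** Q)"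
  by (simp add: vec_eq_iff matrix_matrix_mult_def sum_distrib_right) (auto intro: sum.swap)

lemma matrix_mult_sum: "(Q :: complex^'n^'n) ** (\<Sum>k\<in>S. f k) = (\<Sum>k\<in>S. Q ** f k)"
  by (simp add: vec_eq_iff matrix_matrix_mult_def sum_distrib_left) (auto intro: sum.swap)

lemma tendsto_matrix_mult [tendsto_intros]:
  fixes f g :: "'a \<Rightarrow> complex^'n^'n"
  assumes "(f \<longlongrightarrow> A) F" "(g \<longlongrightarrow> B) F"
  shows "((\<lambda>x. f x ** g x) \<longlongrightarrow> A ** B) F"
  unfolding matrix_matrix_mult_def using assms by (intro tendsto_intros) 

text \<open>Relative to an eigenbasis of \<open>A\<close> on the left and one of \<open>B\<close> on
  the right, both matrices are entrywise multiples of \<open>cadjoint U ** V\<close>, with scalar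
  functions of the pair \<open>a i\<close>, \<open>b j\<close> as multipliers. Noncommuting
  \<open>A\<close> and \<open>B\<close> are thereby reduced to scalars.\<close>

lemma spectral_difference:
  fixes A B :: "complex^'n^'n"
  assumes U: "unitary_mat U" and A: "A = conj_diag U a"
    and V: "unitary_mat V" and B: "B = conj_diag V b"
  shows "hermitian_fun \<phi> A ** (A - B) ** hermitian_fun \<psi> B
     = U ** (\<chi> i j. of_real (\<phi> (a i) * (a i - b j) * \<psi> (b j)) * (cadjoint U ** V) $ i $ j) ** cadjoint V"
    and "hermitian_fun \<phi> A - hermitian_fun \<phi> B
     = U ** (\<chi> i j. of_real (\<phi> (a i) - \<phi> (b j)) * (cadjoint U ** V) $ i $ j) ** cadjoint V"
proof -
  define N where "N = cadjoint U ** V"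
  have diff: "conj_diag U c - conj_diag V d
      = U ** (real_diag c ** N - N ** real_diag d) ** cadjoint V" for c d
  proof -
    have "U ** real_diag c ** N ** cadjoint V = conj_diag U c"
      by (simp add: N_def unitary_matD[OF V] flip: matrix_mul_assoc)
    moreover have "U ** N ** real_diag d ** cadjoint V = conj_diag V d"
      by (simp add: N_def unitary_matD[OF U] matrix_mul_assoc)
    ultimately show ?thesis
      by (simp add: matrix_diff_mult matrix_mult_diff matrix_mul_assoc)
  qed
  have entries: "real_diag c ** N - N ** real_diag d = (\<chi> i j. of_real (c i - d j) * N $ i $ j)" for c d
    by (simp add: vec_eq_iff real_diag_mult_left real_diag_mult_right algebra_simps)
  show "hermitian_fun \<phi> A - hermitian_fun \<phi> B
     = U ** (\<chi> i j. of_real (\<phi> (a i) - \<phi> (b j)) * (cadjoint U ** V) $ i $ j) ** cadjoint V"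
    unfolding hermitian_fun_eq[OF U A] hermitian_fun_eq[OF V B] diff entries by (simp add: N_def)
  have AB: "A - B = U ** (\<chi> i j. of_real (a i - b j) * N $ i $ j) ** cadjoint V"
    by (simp only: A B diff entries)
  have "hermitian_fun \<phi> A ** (A - B) ** hermitian_fun \<psi> B
      = U ** real_diag (\<lambda>i. \<phi> (a i)) ** (cadjoint U ** U) ** (\<chi> i j. of_real (a i - b j) * N $ i $ j)
        ** (cadjoint V ** V) ** real_diag (\<lambda>i. \<psi> (b i)) ** cadjoint V"
    unfolding hermitian_fun_eq[OF U A] hermitian_fun_eq[OF V B] AB by (simp only: matrix_mul_assoc)
  also have "\<dots> = U ** (real_diag (\<lambda>i. \<phi> (a i)) ** ((\<chi> i j. of_real (a i - b j) * N $ i $ j) ** real_diag (\<lambda>i. \<psi> (b i)))) ** cadjoint V"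
    by (simp add: unitary_matD[OF U] unitary_matD[OF V] matrix_mul_assoc)
  also have "real_diag (\<lambda>i. \<phi> (a i)) ** ((\<chi> i j. of_real (a i - b j) * N $ i $ j) ** real_diag (\<lambda>i. \<psi> (b i)))
      = (\<chi> i j. of_real (\<phi> (a i) * (a i - b j) * \<psi> (b j)) * N $ i $ j)"
    by (simp add: vec_eq_iff real_diag_mult_left real_diag_mult_right mult_ac)
  finally show "hermitian_fun \<phi> A ** (A - B) ** hermitian_fun \<psi> B
     = U ** (\<chi> i j. of_real (\<phi> (a i) * (a i - b j) * \<psi> (b j)) * (cadjoint U ** V) $ i $ j) ** cadjoint V"
    by (simp add: N_def)
qed

definition midpoint_term :: "real \<Rightarrow> complex^'n^'n \<Rightarrow> complex^'n^'n \<Rightarrow> complex^'n^'n \<Rightarrow> real \<Rightarrow> complex^'n^'n" where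
  "midpoint_term \<epsilon> Q A B s = hermitian_fun (damp \<epsilon> s) A ** (A - B) ** hermitian_fun (damp \<epsilon> (1 - s)) B ** Q"

lemma scaleR_matrix_mult: "c *\<^sub>R (A :: complex^'n^'n) ** B = c *\<^sub>R (A ** B)"
  by (simp add: vec_eq_iff matrix_matrix_mult_def scaleR_sum_right)

lemma matrix_mult_scaleR: "(A :: complex^'n^'n) ** (c *\<^sub>R B) = c *\<^sub>R (A ** B)"
  by (simp add: vec_eq_iff matrix_matrix_mult_def scaleR_sum_right)

text \<open>By \<open>spectral_difference\<close> the multipliers \<open>c n i j\<close> of the sum
  are scalar midpoint sums, while the eigenbases stay fixed as \<open>n\<close> grows.\<close>

lemma midpoint_sum_tendsto:
  fixes A B Q :: "complex^'n^'n"
  assumes A: "hermitian_mat A" and B: "hermitian_mat B" and \<epsilon>: "0 < \<epsilon>"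
  shows "(\<lambda>n. (1 / real n) *\<^sub>R (\<Sum>k<n. midpoint_term \<epsilon> Q A B ((real k + 1/2) / real n)))
    \<longlonglongrightarrow> (hermitian_fun (damp \<epsilon> 1) A - hermitian_fun (damp \<epsilon> 1) B) ** Q"
proof -
  obtain U a where U: "unitary_mat U" and Aa: "A = conj_diag U a"
    using hermitian_spectral[OF A] .
  obtain V b where V: "unitary_mat V" and Bb: "B = conj_diag V b"
    using hermitian_spectral[OF B] .
  define N where "N = cadjoint U ** V"
  define c where "c n i j = (1 / real n) * (\<Sum>k<n. damp \<epsilon> ((real k + 1/2) / real n) (a i) * (a i - b j)
      * damp \<epsilon> (1 - (real k + 1/2) / real n) (b j))" for n i j
  have sum_eq: "(1 / real n) *\<^sub>R (\<Sum>k<n. midpoint_term \<epsilon> Q A B ((real k + 1/2) / real n))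
      = U ** (\<chi> i j. of_real (c n i j) * N $ i $ j) ** cadjoint V ** Q" for n
  proof -
    have "(1 / real n) *\<^sub>R (\<Sum>k<n. (\<chi> i j. of_real (damp \<epsilon> ((real k + 1/2) / real n) (a i) * (a i - b j)
        * damp \<epsilon> (1 - (real k + 1/2) / real n) (b j)) * N $ i $ j)) = (\<chi> i j. of_real (c n i j) * N $ i $ j)"
      by (simp add: vec_eq_iff c_def scaleR_conv_of_real[where 'a=complex] sum_distrib_left sum_distrib_right mult_ac)
    then show ?thesis
      unfolding midpoint_term_def spectral_difference(1)[OF U Aa V Bb] N_def[symmetric]
      by (simp only: matrix_sum_mult matrix_mult_sum scaleR_matrix_mult matrix_mult_scaleR flip: \<open>_ = (\<chi> i j. of_real (c n i j) * N $ i $ j)\<close>)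
  qed
  have "(\<lambda>n. c n i j) \<longlonglongrightarrow> damp \<epsilon> 1 (a i) - damp \<epsilon> 1 (b j)" for i j
    unfolding c_def by (rule damp_midpoint_sum_tendsto[OF \<epsilon>])
  then have "(\<lambda>n. U ** (\<chi> i j. of_real (c n i j) * N $ i $ j) ** cadjoint V ** Q)
      \<longlonglongrightarrow> U ** (\<chi> i j. of_real (damp \<epsilon> 1 (a i) - damp \<epsilon> 1 (b j)) * N $ i $ j) ** cadjoint V ** Q"
    by (intro tendsto_intros)
  then show ?thesis unfolding sum_eq spectral_difference(2)[OF U Aa V Bb] N_def[symmetric] .
qed

lemma norm_mean_sq_le:
  fixes f :: "nat \<Rightarrow> 'a::real_normed_vector"
  shows "(norm ((1 / real n) *\<^sub>R (\<Sum>k<n. f k)))\<^sup>2 \<le> (1 / real n) * (\<Sum>k<n. (norm (f k))\<^sup>2)"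
proof (cases "n = 0")
  case False
  have "(norm (\<Sum>k<n. f k))\<^sup>2 \<le> (\<Sum>k<n. norm (f k))\<^sup>2"
    by (intro power_mono norm_sum) simp
  also have "\<dots> \<le> (\<Sum>k<n. (norm (f k))\<^sup>2) * card {..<n}" by (rule sum_squared_le_sum_of_squares)
  finally show ?thesis using False by (simp add: power_mult_distrib power_divide field_simps power2_eq_square)
qed simp

section \<open>Measurability of the functional calculus\<close>

definition mat_measurable :: "'a measure \<Rightarrow> ('a \<Rightarrow> complex^'n^'n) \<Rightarrow> bool" where
  "mat_measurable M f \<longleftrightarrow> (\<forall>i j. (\<lambda>x. f x $ i $ j) \<in> borel_measurable M)"

lemma mat_measurable_const: "mat_measurable M (\<lambda>x. A)"
  by (simp add: mat_measurable_def)

lemma mat_measurable_mult: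
  "mat_measurable M f \<Longrightarrow> mat_measurable M g \<Longrightarrow> mat_measurable M (\<lambda>x. f x ** g x)"
  by (auto simp: mat_measurable_def matrix_matrix_mult_def intro!: borel_measurable_sum borel_measurable_times)

lemma mat_measurable_diff:
  "mat_measurable M f \<Longrightarrow> mat_measurable M g \<Longrightarrow> mat_measurable M (\<lambda>x. f x - g x)"
  by (auto simp: mat_measurable_def intro!: borel_measurable_diff)

lemma mat_measurable_scaleR: "mat_measurable M f \<Longrightarrow> mat_measurable M (\<lambda>x. c *\<^sub>R f x)"
  by (auto simp: mat_measurable_def intro!: borel_measurable_scaleR)

lemma mat_measurable_compose:
  "mat_measurable N f \<Longrightarrow> h \<in> measurable M N \<Longrightarrow> mat_measurable M (\<lambda>x. f (h x))"
  by (auto simp: mat_measurable_def intro: measurable_compose)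

lemma borel_measurable_norm_mat:
  "mat_measurable M f \<Longrightarrow> (\<lambda>x. (norm (f x))\<^sup>2) \<in> borel_measurable M"
  by (auto simp: norm_matrix_sq mat_measurable_def intro!: borel_measurable_sum borel_measurable_power measurable_compose[OF _ borel_measurable_norm])

lemma borel_measurable_trace:
  "mat_measurable M f \<Longrightarrow> (\<lambda>x. trace (f x)) \<in> borel_measurable M"
  by (auto simp: trace_def mat_measurable_def intro!: borel_measurable_sum)

text \<open>Iterated left multiplication stands for the matrix power, because \<open>^\<close> on
  vectors acts componentwise.\<close>

lemma power_spectral:
  assumes "unitary_mat U" "A = conj_diag U l"
  shows "((**) A ^^ k) (mat 1) = conj_diag U (\<lambda>i. l i ^ k)"
proof (induction k)
  case 0
  have "real_diag (\<lambda>i. 1) = (mat 1 :: complex^'a^'a)" by (simp add: real_diag_def mat_def vec_eq_iff)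
  then show ?case by (simp add: unitary_matD[OF assms(1)])
next
  case (Suc k)
  have "A ** (conj_diag U (\<lambda>i. l i ^ k)) = U ** real_diag l ** (cadjoint U ** U) ** real_diag (\<lambda>i. l i ^ k) ** cadjoint U"
    unfolding assms(2) by (simp only: matrix_mul_assoc)
  also have "\<dots> = U ** (real_diag l ** real_diag (\<lambda>i. l i ^ k)) ** cadjoint U"
    by (simp add: unitary_matD[OF assms(1)] matrix_mul_assoc)
  finally show ?case by (simp add: Suc real_diag_mult)
qed

lemma mat_measurable_power: "mat_measurable M f \<Longrightarrow> mat_measurable M (\<lambda>x. ((**) (f x) ^^ k) (mat 1))"
  by (induction k) (auto intro: mat_measurable_const mat_measurable_mult)

text \<open>The intervals grow with \<open>n\<close> since the spectra of the values of an
  observable have no common bound; any fixed point is eventually covered with error tending to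
  zero.\<close>

lemma uniform_polynomial_approximation:
  fixes \<phi> :: "real \<Rightarrow> real"
  assumes "continuous_on UNIV \<phi>"
  shows "\<exists>d a. \<forall>n x. \<bar>x\<bar> \<le> real n \<longrightarrow> \<bar>\<phi> x - (\<Sum>i\<le>d n. a n i * x ^ i)\<bar> < 1 / real (Suc n)"
proof -
  have "\<exists>d a. \<forall>x. \<bar>x\<bar> \<le> real n \<longrightarrow> \<bar>\<phi> x - (\<Sum>i\<le>d. a i * x ^ i)\<bar> < 1 / real (Suc n)" for n :: nat
  proof -
    obtain q where q: "real_polynomial_function q" "\<And>x. x \<in> {- real n .. real n} \<Longrightarrow> \<bar>\<phi> x - q x\<bar> < 1 / real (Suc n)"
      using Stone_Weierstrass_real_polynomial_function[of "{- real n .. real n}" \<phi> "1 / real (Suc n)"]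
        continuous_on_subset[OF assms] by auto
    then show ?thesis unfolding real_polynomial_function_iff_sum
      by (metis abs_le_iff atLeastAtMost_iff minus_le_iff)
  qed
  then show ?thesis by metis
qed

text \<open>Avoids any measurable choice of eigenvectors: polynomials in \<open>f x\<close> have
  entries polynomial in those of \<open>f x\<close>, and they converge pointwise to the functional
  calculus, as a glance in a diagonalisation at each fixed \<open>x\<close> shows.\<close>

lemma mat_measurable_hermitian_fun:
  fixes f :: "'a \<Rightarrow> complex^'n^'n"
  assumes f: "mat_measurable M f" and herm: "\<And>x. hermitian_mat (f x)" and \<phi>: "continuous_on UNIV \<phi>"
  shows "mat_measurable M (\<lambda>x. hermitian_fun \<phi> (f x))"
proof -
  obtain d a where approx: "\<And>n x. \<bar>x\<bar> \<le> real n \<Longrightarrow> \<bar>\<phi> x - (\<Sum>i\<le>d n. a n i * x ^ i)\<bar> < 1 / real (Suc n)"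
    using uniform_polynomial_approximation[OF \<phi>] by blast
  have "(\<lambda>x. hermitian_fun \<phi> (f x) $ i $ j) \<in> borel_measurable M" for i j
  proof (rule borel_measurable_LIMSEQ_metric)
    show "(\<lambda>x. \<Sum>k\<le>d n. of_real (a n k) * ((**) (f x) ^^ k) (mat 1) $ i $ j) \<in> borel_measurable M" for n
      using mat_measurable_power[OF f]
      by (auto simp: mat_measurable_def intro!: borel_measurable_sum borel_measurable_times)
  next
    fix x
    obtain U l where U: "unitary_mat U" and fl: "f x = conj_diag U l"
      using hermitian_spectral[OF herm] .
    define p where "p n y = (\<Sum>k\<le>d n. a n k * y ^ k)" for n y
    have p_lim: "(\<lambda>n. p n y) \<longlonglongrightarrow> \<phi> y" for y
    proof (rule metric_LIMSEQ_I)
      fix e :: real assume "0 < e"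
      then obtain n0 where n0: "1 / real (Suc n0) < e" using nat_approx_posE by blast
      obtain n1 where n1: "\<bar>y\<bar> \<le> real n1" using real_arch_simple by blast
      have "dist (p n y) (\<phi> y) < e" if "n \<ge> max n0 n1" for n
      proof -
        have "\<bar>\<phi> y - p n y\<bar> < 1 / real (Suc n)" unfolding p_def using n1 that by (intro approx) auto
        also have "\<dots> \<le> 1 / real (Suc n0)" using that by (intro divide_left_mono) auto
        finally show ?thesis using n0 by (simp add: dist_real_def abs_minus_commute)
      qed
      then show "\<exists>no. \<forall>n\<ge>no. dist (p n y) (\<phi> y) < e" by blast
    qed
    have "(\<Sum>k\<le>d n. of_real (a n k) * ((**) (f x) ^^ k) (mat 1) $ i $ j)
        = (\<Sum>m\<in>UNIV. complex_of_real (p n (l m)) * (U $ i $ m * cnj (U $ j $ m)))" for n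
      unfolding power_spectral[OF U fl] real_diag_conj_entry p_def sum_distrib_left of_real_sum sum_distrib_right
      by (subst sum.swap) (simp add: mult_ac)
    moreover have "(\<lambda>n. \<Sum>m\<in>UNIV. complex_of_real (p n (l m)) * (U $ i $ m * cnj (U $ j $ m)))
        \<longlonglongrightarrow> (\<Sum>m\<in>UNIV. complex_of_real (\<phi> (l m)) * (U $ i $ m * cnj (U $ j $ m)))"
      by (intro tendsto_intros p_lim)
    ultimately show "(\<lambda>n. \<Sum>k\<le>d n. of_real (a n k) * ((**) (f x) ^^ k) (mat 1) $ i $ j) \<longlonglongrightarrow> hermitian_fun \<phi> (f x) $ i $ j"
      by (simp only: hermitian_fun_eq[OF U fl] real_diag_conj_entry)
  qed
  then show ?thesis by (simp add: mat_measurable_def)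
qed

lemma mat_measurable_young_weight:
  fixes g :: "'a \<Rightarrow> complex^'n^'n"
  assumes g: "mat_measurable M g" and herm: "\<And>x. hermitian_mat (g x)" and Q: "hermitian_mat Q"
    and "0 < \<epsilon>" "s < p" "0 < p"
  shows "mat_measurable M (\<lambda>x. young_weight \<epsilon> p s Q (g x))"
proof -
  have K: "mat_measurable M (\<lambda>x. hermitian_fun (damp \<epsilon> (1 - s)) (g x))"
    using assms by (intro mat_measurable_hermitian_fun continuous_on_damp)
  have sp: "0 < 1 - s / p" using assms by (simp add: divide_less_eq)
  have "continuous_on UNIV (\<lambda>y::real. max 0 y powr (1 / (1 - s / p)))"
    using sp by (intro continuous_on_powr' continuous_intros) auto
  moreover have "hermitian_mat (hermitian_fun (damp \<epsilon> (1 - s)) (g x) ** Q ** Q ** hermitian_fun (damp \<epsilon> (1 - s)) (g x))" for x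
    using herm Q by (subst hermitian_sandwich) (auto intro: psd_hermitian psd_mult_cadjoint hermitian_hermitian_fun)
  ultimately show ?thesis unfolding young_weight_def Let_def
    by (intro mat_measurable_scaleR mat_measurable_hermitian_fun mat_measurable_mult K mat_measurable_const)
qed

lemma mat_measurable_power_weight:
  fixes g :: "'a \<Rightarrow> complex^'n^'n"
  assumes g: "mat_measurable M g" and herm: "\<And>x. hermitian_mat (g x)" and "0 < \<epsilon>"
  shows "mat_measurable M (\<lambda>x. power_weight \<epsilon> p (g x))"
proof -
  have "continuous_on UNIV (\<lambda>x. damp \<epsilon> 1 x powr (2 * p))"
    using damp_pos[OF \<open>0 < \<epsilon>\<close>, of 1] \<open>0 < \<epsilon>\<close>
    by (intro continuous_on_powr continuous_on_damp continuous_on_const) (auto simp: less_le)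
  then show ?thesis unfolding power_weight_def using g herm by (intro mat_measurable_hermitian_fun)
qed

section \<open>Integration against kernels and square-integrable functions\<close>

text \<open>Tonelli applied to \<open>norm f\<close> makes the inner integral finite almost
  everywhere. Unbounded integrands must be covered, as square-integrable functions are integrated
  against the joint law.\<close>

lemma integrable_bind_kernel:
  fixes f :: "_ \<Rightarrow> 'c::{banach, second_countable_topology}"
  assumes N[measurable]: "N \<in> measurable M (subprob_algebra B)" and M: "space M \<noteq> {}"
    and f: "integrable (M \<bind> N) f"
  shows "AE x in M. integrable (N x) f"
    and "integrable M (\<lambda>x. \<integral>y. norm (f y) \<partial>N x)"
    and "integrable M (\<lambda>x. \<integral>y. f y \<partial>N x)"
proof -
  have fB[measurable]: "f \<in> borel_measurable B"
    using borel_measurable_integrable[OF f] by (simp add: measurable_cong_sets[OF sets_bind[OF sets_kernel[OF N] M] refl])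
  have meas: "f \<in> borel_measurable (N x)" if "x \<in> space M" for x
    by (simp add: subprob_measurableD(3)[OF N that] fB)
  have fin: "(\<integral>\<^sup>+x. \<integral>\<^sup>+y. norm (f y) \<partial>N x \<partial>M) < \<infinity>"
    using f by (simp add: integrable_iff_bounded nn_integral_bind[of _ B])
  have "AE x in M. (\<integral>\<^sup>+y. norm (f y) \<partial>N x) \<noteq> \<infinity>"
    by (intro nn_integral_PInf_AE measurable_compose[OF N nn_integral_measurable_subprob_algebra]) (use fin in auto)
  then show AE: "AE x in M. integrable (N x) f"
    using meas by (auto simp: integrable_iff_bounded top.not_eq_extremum elim!: AE_mp intro!: AE_I2)
  have "AE x in M. (\<integral>\<^sup>+y. norm (f y) \<partial>N x) = ennreal (\<integral>y. norm (f y) \<partial>N x)"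
    using AE by eventually_elim (intro nn_integral_eq_integral integrable_norm, auto)
  then have "(\<integral>\<^sup>+x. ennreal (\<integral>y. norm (f y) \<partial>N x) \<partial>M) < \<infinity>"
    using fin by (subst nn_integral_cong_AE[of _ "\<lambda>x. \<integral>\<^sup>+y. norm (f y) \<partial>N x"]) auto
  then show norm_int: "integrable M (\<lambda>x. \<integral>y. norm (f y) \<partial>N x)"
    by (intro integrableI_nonneg measurable_compose[OF N integral_measurable_subprob_algebra]) auto
  show "integrable M (\<lambda>x. \<integral>y. f y \<partial>N x)"
    by (rule Bochner_Integration.integrable_bound[OF norm_int])
       (auto intro!: measurable_compose[OF N integral_measurable_subprob_algebra] AE_I2
         order.trans[OF integral_norm_bound])
qed

text \<open>Fubini for kernels, by induction from indicators through sums to dominated limits. Inner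
  integrals exist only almost everywhere, so additivity and convergence are claimed only there;
  \<open>2 * norm f\<close> is the dominating function.\<close>

lemma integral_bind_kernel:
  fixes f :: "_ \<Rightarrow> 'c::{banach, second_countable_topology}"
  assumes N[measurable]: "N \<in> measurable M (subprob_algebra B)" and M: "space M \<noteq> {}"
    and f: "integrable (M \<bind> N) f"
  shows "(\<integral>y. f y \<partial>(M \<bind> N)) = (\<integral>x. \<integral>y. f y \<partial>N x \<partial>M)"
  using f
proof (induction rule: integrable_induct)
  case (base A c)
  have A[measurable]: "A \<in> sets B" using base(1) by (simp add: sets_bind[OF sets_kernel[OF N] M])
  have fin: "integrable (M \<bind> N) (\<lambda>x. indicator A x :: real)" using base by simp
  have "ennreal (measure (M \<bind> N) A) = (\<integral>\<^sup>+x. emeasure (N x) A \<partial>M)"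
    using base(2) by (simp add: emeasure_bind[OF M N A] emeasure_eq_ennreal_measure[symmetric])
  also have "\<dots> = (\<integral>\<^sup>+x. ennreal (measure (N x) A) \<partial>M)"
    using subprob_space_kernel[OF N]
    by (intro nn_integral_cong finite_measure.emeasure_eq_measure) (auto simp: subprob_space_def)
  finally have E: "ennreal (measure (M \<bind> N) A) = \<dots>" .
  have *: "measure (M \<bind> N) A = (\<integral>x. measure (N x) A \<partial>M)"
    by (subst integral_eq_nn_integral)
       (auto intro!: measurable_compose[OF N measurable_measure_subprob_algebra] simp flip: E)
  have "(\<integral>y. indicator A y *\<^sub>R c \<partial>(M \<bind> N)) = measure (M \<bind> N) A *\<^sub>R c"
    using base by simp
  also have "\<dots> = (\<integral>x. measure (N x) A *\<^sub>R c \<partial>M)"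
  proof -
    have "integrable M (\<lambda>x. \<integral>y. indicator A y \<partial>N x :: real)"
      by (rule integrable_bind_kernel(3)[OF N M fin])
    moreover have "(\<integral>y. indicator A y \<partial>N x :: real) = measure (N x) A" if "x \<in> space M" for x
      using subprob_measurableD(2)[OF N that] A sets.sets_into_space[of A "N x"] by (simp add: Int_absorb2)
    ultimately have "integrable M (\<lambda>x. measure (N x) A)"
      by (simp cong: Bochner_Integration.integrable_cong)
    then show ?thesis by (simp add: *)
  qed
  also have "\<dots> = (\<integral>x. \<integral>y. indicator A y *\<^sub>R c \<partial>N x \<partial>M)"
    using subprob_measurableD(2)[OF N] subprob_space.emeasure_space_le_1 subprob_space_kernel[OF N]
    by (intro Bochner_Integration.integral_cong refl)
       (simp add: finite_measure.emeasure_finite subprob_space_def top.not_eq_extremum[symmetric])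
  finally show ?case .
next
  case (add f g)
  have "(\<integral>x. \<integral>y. f y + g y \<partial>N x \<partial>M) = (\<integral>x. (\<integral>y. f y \<partial>N x) + (\<integral>y. g y \<partial>N x) \<partial>M)"
    using integrable_bind_kernel(1)[OF N M add(1)] integrable_bind_kernel(1)[OF N M add(2)]
    by (intro integral_cong_AE) (use borel_measurable_integrable[OF add(1)] borel_measurable_integrable[OF add(2)] in
      \<open>auto simp: measurable_cong_sets[OF sets_bind[OF sets_kernel[OF N] M] refl]
        intro!: measurable_compose[OF N integral_measurable_subprob_algebra] borel_measurable_add\<close>)
  then show ?case
    using add integrable_bind_kernel(3)[OF N M add(1)] integrable_bind_kernel(3)[OF N M add(2)] by simp
next
  case (lim f s)
  have meas: "h \<in> borel_measurable B" if "integrable (M \<bind> N) h" for h :: "_ \<Rightarrow> 'c"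
    using borel_measurable_integrable[OF that] by (simp add: measurable_cong_sets[OF sets_bind[OF sets_kernel[OF N] M] refl])
  have sp: "space (M \<bind> N) = space B" by (rule space_bind[OF sets_kernel[OF N] M])
  have "(\<lambda>i. \<integral>y. s i y \<partial>(M \<bind> N)) \<longlonglongrightarrow> (\<integral>y. f y \<partial>(M \<bind> N))"
    using lim by (intro integral_dominated_convergence[where w = "\<lambda>y. 2 * norm (f y)"]) (auto intro!: AE_I2)
  moreover have "(\<lambda>i. \<integral>x. \<integral>y. s i y \<partial>N x \<partial>M) \<longlonglongrightarrow> (\<integral>x. \<integral>y. f y \<partial>N x \<partial>M)"
  proof (rule integral_dominated_convergence[where w = "\<lambda>x. 2 * (\<integral>y. norm (f y) \<partial>N x)"])
    show "(\<lambda>x. \<integral>y. f y \<partial>N x) \<in> borel_measurable M" "\<And>i. (\<lambda>x. \<integral>y. s i y \<partial>N x) \<in> borel_measurable M"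
      using meas lim by (auto intro!: measurable_compose[OF N integral_measurable_subprob_algebra])
    show "integrable M (\<lambda>x. 2 * (\<integral>y. norm (f y) \<partial>N x))"
      using integrable_bind_kernel(2)[OF N M lim(4)] by simp
    show "AE x in M. (\<lambda>i. \<integral>y. s i y \<partial>N x) \<longlonglongrightarrow> (\<integral>y. f y \<partial>N x)"
      using integrable_bind_kernel(1)[OF N M lim(4)] AE_space
    proof eventually_elim
      case (elim x)
      have m: "borel_measurable (N x) = (borel_measurable B :: (_ \<Rightarrow> 'c) set)"
        by (rule subprob_measurableD(3)[OF N elim(2)])
      show ?case
        using lim elim meas[OF lim(4)] meas[OF lim(1)] subprob_measurableD(1)[OF N elim(2)]
        by (intro integral_dominated_convergence[where w = "\<lambda>y. 2 * norm (f y)"])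
           (auto intro!: AE_I2 simp: m sp)
    qed
    show "AE x in M. norm (\<integral>y. s i y \<partial>N x) \<le> 2 * (\<integral>y. norm (f y) \<partial>N x)" for i
      using integrable_bind_kernel(1)[OF N M lim(4)] integrable_bind_kernel(1)[OF N M lim(1)[of i]] AE_space
    proof eventually_elim
      case (elim x)
      have "norm (\<integral>y. s i y \<partial>N x) \<le> (\<integral>y. norm (s i y) \<partial>N x)" by (rule integral_norm_bound)
      also have "\<dots> \<le> (\<integral>y. 2 * norm (f y) \<partial>N x)"
        using elim lim(3) subprob_measurableD(1)[OF N elim(3)] by (intro integral_mono) (auto simp: sp)
      finally show ?case by simp
    qed
  qed
  ultimately show ?case using lim(5) by (auto intro: LIMSEQ_unique)
qed

section \<open>Square-integrable functions\<close>

abbreviation incr :: "('a \<Rightarrow> 'b::minus) \<Rightarrow> 'a \<times> 'a \<Rightarrow> 'b" where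
  "incr u z \<equiv> u (fst z) - u (snd z)"

lemma L2_measurable: "f \<in> L2 \<mu> \<Longrightarrow> f \<in> borel_measurable \<mu>"
  and L2_integrable: "f \<in> L2 \<mu> \<Longrightarrow> integrable \<mu> (\<lambda>x. (cmod (f x))\<^sup>2)"
  by (auto simp: L2_def)

lemma two_mult_le_sum_squares: "(a :: real) * b \<le> a\<^sup>2 + b\<^sup>2"
  using sum_squares_bound[of a b] zero_le_power2[of a] zero_le_power2[of b]
  by linarith

lemma L2_mult_integrable:
  assumes "f \<in> L2 \<mu>" "g \<in> L2 \<mu>" shows "integrable \<mu> (\<lambda>x. f x * g x)"
proof (rule Bochner_Integration.integrable_bound)
  show "integrable \<mu> (\<lambda>x. (cmod (f x))\<^sup>2 + (cmod (g x))\<^sup>2)"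
    using assms by (intro Bochner_Integration.integrable_add L2_integrable)
  show "(\<lambda>x. f x * g x) \<in> borel_measurable \<mu>"
    using assms by (intro borel_measurable_times L2_measurable)
  show "AE x in \<mu>. norm (f x * g x) \<le> norm ((cmod (f x))\<^sup>2 + (cmod (g x))\<^sup>2)"
    by (simp add: norm_mult two_mult_le_sum_squares)
qed

lemma cmod_add_sq_le: "(cmod (a + b))\<^sup>2 \<le> 2 * (cmod a)\<^sup>2 + 2 * (cmod b)\<^sup>2"
proof -
  have "(cmod (a + b))\<^sup>2 \<le> (cmod a + cmod b)\<^sup>2" by (intro power_mono norm_triangle_ineq) auto
  also have "\<dots> \<le> 2 * (cmod a)\<^sup>2 + 2 * (cmod b)\<^sup>2"
    using sum_squares_bound[of "cmod a" "cmod b"] by (simp add: power2_sum)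
  finally show ?thesis .
qed

lemma L2_add:
  assumes "f \<in> L2 \<mu>" "g \<in> L2 \<mu>" shows "(\<lambda>x. f x + g x) \<in> L2 \<mu>"
proof -
  have [measurable]: "f \<in> borel_measurable \<mu>" "g \<in> borel_measurable \<mu>"
    using assms by (auto intro: L2_measurable)
  have "integrable \<mu> (\<lambda>x. (cmod (f x + g x))\<^sup>2)"
  proof (rule Bochner_Integration.integrable_bound)
    show "integrable \<mu> (\<lambda>x. 2 * (cmod (f x))\<^sup>2 + 2 * (cmod (g x))\<^sup>2)"
      using assms by (intro Bochner_Integration.integrable_add integrable_mult_right L2_integrable)
  qed (auto simp: cmod_add_sq_le)
  then show ?thesis by (simp add: L2_def)
qed

lemma L2_cmult:
  assumes "f \<in> L2 \<mu>" shows "(\<lambda>x. c * f x) \<in> L2 \<mu>"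
  using assms by (auto simp: L2_def norm_mult power_mult_distrib)

lemma L2_diff: "f \<in> L2 \<mu> \<Longrightarrow> g \<in> L2 \<mu> \<Longrightarrow> (\<lambda>x. f x - g x) \<in> L2 \<mu>"
  using L2_add[OF _ L2_cmult[of g \<mu> "-1"]] by auto

lemma borel_measurable_cnj: "cnj \<in> borel_measurable borel"
  by (intro borel_measurable_continuous_onI continuous_intros)

lemma L2_cnj: "f \<in> L2 \<mu> \<Longrightarrow> (\<lambda>x. cnj (f x)) \<in> L2 \<mu>"
  by (auto simp: L2_def intro!: measurable_compose[OF _ borel_measurable_cnj])

lemma L2_sum: "(\<And>k. k \<in> S \<Longrightarrow> f k \<in> L2 \<mu>) \<Longrightarrow> (\<lambda>x. \<Sum>k\<in>S. f k x) \<in> L2 \<mu>"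
proof (induction S rule: infinite_finite_induct)
  case (insert k S)
  then show ?case by (simp add: L2_add)
qed (auto simp: L2_def)

lemma L2_bounded_mult:
  assumes f: "f \<in> L2 \<mu>" and v[measurable]: "v \<in> borel_measurable \<mu>" and M: "\<And>x. cmod (v x) \<le> M"
  shows "(\<lambda>x. v x * f x) \<in> L2 \<mu>"
proof -
  have [measurable]: "f \<in> borel_measurable \<mu>" using f by (rule L2_measurable)
  have "integrable \<mu> (\<lambda>x. (cmod (v x * f x))\<^sup>2)"
  proof (rule Bochner_Integration.integrable_bound)
    show "integrable \<mu> (\<lambda>x. M\<^sup>2 * (cmod (f x))\<^sup>2)"
      using f by (intro integrable_mult_right L2_integrable)
    show "AE x in \<mu>. norm ((cmod (v x * f x))\<^sup>2) \<le> norm (M\<^sup>2 * (cmod (f x))\<^sup>2)"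
      using M by (auto simp: norm_mult power_mult_distrib intro!: AE_I2 mult_right_mono power_mono)
  qed measurable
  then show ?thesis by (simp add: L2_def)
qed

lemma L2_bounded:
  assumes "finite_measure \<mu>" "v \<in> borel_measurable \<mu>" "\<And>x. cmod (v x) \<le> M"
  shows "v \<in> L2 \<mu>"
proof -
  interpret finite_measure \<mu> by fact
  have "integrable \<mu> (\<lambda>x. (cmod (v x))\<^sup>2)"
    using assms by (intro integrable_const_bound[where B = "M\<^sup>2"]) (auto intro!: power_mono)
  then show ?thesis using assms by (simp add: L2_def)
qed

lemma cnj_L2_inner: "cnj (L2_inner \<mu> f h) = L2_inner \<mu> h f"
  unfolding L2_inner_def Bochner_Integration.integral_cnj[symmetric] complex_cnj_mult complex_cnj_cnj by (simp only: mult.commute)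

section \<open>The joint law of a reversible process at two times\<close>

locale reversible_process = markov_process F X Pr
  for F :: "'s measure" and X :: "real \<Rightarrow> 's \<Rightarrow> 'w::polish_space" and Pr +
  fixes \<mu> :: "'w measure"
  assumes stationary: "stationary_measure X Pr \<mu>"
    and reversible: "reversible \<mu> (markov_semigroup X Pr)"
begin

abbreviation P :: "real \<Rightarrow> ('w \<Rightarrow> complex) \<Rightarrow> 'w \<Rightarrow> complex" where
  "P \<equiv> markov_semigroup X Pr"

definition transition :: "real \<Rightarrow> 'w \<Rightarrow> 'w measure" where
  "transition t x = distr (Pr x) borel (X t)"

text \<open>The joint law of \<open>(X\<^sub>0, X\<^sub>t)\<close> when \<open>X\<^sub>0\<close> has law \<open>\<mu>\<close>.\<close>

definition joint :: "real \<Rightarrow> ('w \<times> 'w) measure" where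
  "joint t = \<mu> \<bind> (\<lambda>x. distr (transition t x) (borel \<Otimes>\<^sub>M borel) (Pair x))"

lemma prob_\<mu>: "prob_space \<mu>" and sets_\<mu> [simp, measurable_cong]: "sets \<mu> = sets borel"
  using stationary by (auto simp: stationary_measure_def)

lemma space_\<mu> [simp]: "space \<mu> = UNIV"
  using sets_eq_imp_space_eq[OF sets_\<mu>] by simp

lemma measurable_\<mu> [simp]: "measurable \<mu> N = measurable borel N"
  by (rule measurable_cong_sets) auto

sublocale prob_space \<mu> by (rule prob_\<mu>)

lemma Pr_space: "prob_space (Pr x)" "sets (Pr x) = sets F"
  using measurable_space[OF kernel, of x] by (auto simp: space_prob_algebra)

lemma transition_kernel: "0 \<le> t \<Longrightarrow> transition t \<in> measurable borel (prob_algebra borel)"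
  unfolding transition_def
  by (rule measurable_compose[OF kernel measurable_distr_prob_space[OF measurable_X]])

lemmas transition_subkernel = transition_kernel[THEN measurable_prob_algebraD]

lemma transition_space:
  assumes "0 \<le> t" shows "prob_space (transition t x)" "sets (transition t x) = sets borel"
  using measurable_space[OF transition_kernel[OF assms], of x] by (auto simp: space_prob_algebra)

lemma measurable_transition [simp]: "0 \<le> t \<Longrightarrow> measurable (transition t x) N = measurable borel N"
  by (intro measurable_cong_sets transition_space(2)) auto

lemma P_eq: "0 \<le> t \<Longrightarrow> f \<in> borel_measurable borel \<Longrightarrow> P t f x = (\<integral>y. f y \<partial>transition t x)"
  unfolding transition_def markov_semigroup_def
  by (subst integral_distr) (auto simp: measurable_X measurable_cong_sets[OF Pr_space(2) refl])

lemma P_measurable: "0 \<le> t \<Longrightarrow> f \<in> borel_measurable borel \<Longrightarrow> P t f \<in> borel_measurable borel"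
  using measurable_compose[OF transition_subkernel integral_measurable_subprob_algebra, of t f]
  by (subst measurable_cong[of _ _ "\<lambda>x. \<integral>y. f y \<partial>transition t x"]) (auto simp: P_eq)

lemma joint_kernel:
  assumes "0 \<le> t"
  shows "(\<lambda>x. distr (transition t x) (borel \<Otimes>\<^sub>M borel) (Pair x)) \<in> measurable \<mu> (subprob_algebra (borel \<Otimes>\<^sub>M borel))"
proof -
  have "(\<lambda>x. distr (transition t x) (borel \<Otimes>\<^sub>M borel) (Pair x)) \<in> measurable borel (subprob_algebra (borel \<Otimes>\<^sub>M borel))"
    by (rule measurable_distr2[OF _ transition_subkernel[OF assms]]) simp
  then show ?thesis by simp
qed

lemma sets_joint: "0 \<le> t \<Longrightarrow> sets (joint t) = sets (borel \<Otimes>\<^sub>M borel)"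
  unfolding joint_def by (rule sets_bind[OF sets_kernel[OF joint_kernel]]) auto

lemma measurable_joint [simp]: "0 \<le> t \<Longrightarrow> measurable (joint t) N = measurable (borel \<Otimes>\<^sub>M borel) N"
  by (intro measurable_cong_sets sets_joint) auto

lemma nn_integral_joint:
  assumes t: "0 \<le> t" and f: "f \<in> borel_measurable (borel \<Otimes>\<^sub>M borel)"
  shows "(\<integral>\<^sup>+z. f z \<partial>joint t) = (\<integral>\<^sup>+x. \<integral>\<^sup>+y. f (x, y) \<partial>transition t x \<partial>\<mu>)"
  unfolding joint_def using t f
  by (subst nn_integral_bind[OF f joint_kernel[OF t]])
     (auto intro!: nn_integral_cong nn_integral_distr)

lemma integral_joint:
  fixes f :: "_ \<Rightarrow> 'c::{banach, second_countable_topology}"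
  assumes t: "0 \<le> t" and f: "integrable (joint t) f"
  shows "(\<integral>z. f z \<partial>joint t) = (\<integral>x. \<integral>y. f (x, y) \<partial>transition t x \<partial>\<mu>)"
proof -
  have [measurable]: "f \<in> borel_measurable (borel \<Otimes>\<^sub>M borel)"
    using borel_measurable_integrable[OF f] t by simp
  show ?thesis using t f unfolding joint_def
    by (subst integral_bind_kernel[OF joint_kernel[OF t]])
       (auto intro!: Bochner_Integration.integral_cong integral_distr)
qed

lemma prob_joint: "0 \<le> t \<Longrightarrow> prob_space (joint t)"
proof (rule prob_spaceI)
  assume t: "0 \<le> t"
  have "emeasure (joint t) (space (joint t)) = (\<integral>\<^sup>+z. 1 \<partial>joint t)" by simp
  also have "\<dots> = (\<integral>\<^sup>+x. \<integral>\<^sup>+y. 1 \<partial>transition t x \<partial>\<mu>)" by (rule nn_integral_joint[OF t]) simp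
  also have "\<dots> = 1"
    using prob_space.emeasure_space_1[OF transition_space(1)[OF t]] emeasure_space_1 by simp
  finally show "emeasure (joint t) (space (joint t)) = 1" .
qed

lemma distr_joint_fst:
  assumes t: "0 \<le> t" shows "distr (joint t) borel fst = \<mu>"
proof (rule measure_eqI)
  fix A assume A: "A \<in> sets (distr (joint t) borel fst)"
  then have [measurable]: "A \<in> sets borel" by simp
  have "emeasure (distr (joint t) borel fst) A = (\<integral>\<^sup>+z. indicator A z \<partial>distr (joint t) borel fst)"
    by simp
  also have "\<dots> = (\<integral>\<^sup>+z. indicator A (fst z) \<partial>joint t)" using t by (intro nn_integral_distr) auto
  also have "\<dots> = (\<integral>\<^sup>+x. \<integral>\<^sup>+y. indicator A x \<partial>transition t x \<partial>\<mu>)"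
    by (subst nn_integral_joint[OF t]) auto
  also have "\<dots> = (\<integral>\<^sup>+x. indicator A x \<partial>\<mu>)"
    using prob_space.emeasure_space_1[OF transition_space(1)[OF t]] by simp
  also have "\<dots> = emeasure \<mu> A" by simp
  finally show "emeasure (distr (joint t) borel fst) A = emeasure \<mu> A" .
qed simp

text \<open>Reversibility tested on indicators: the mass of \<open>A \<times> B\<close> is the inner
  product of \<open>indicator A\<close> with \<open>P t (indicator B)\<close>, and rectangles form
  an intersection-stable generator.\<close>

lemma joint_symmetric:
  assumes t: "0 \<le> t" shows "distr (joint t) (borel \<Otimes>\<^sub>M borel) (\<lambda>(x, y). (y, x)) = joint t"
proof (rule measure_eqI_generator_eq[OF Int_stable_pair_measure_generator[of borel borel],
      where A = "\<lambda>_. UNIV" and \<Omega> = UNIV])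
  interpret J: prob_space "joint t" by (rule prob_joint[OF t])
  show "sets (distr (joint t) (borel \<Otimes>\<^sub>M borel) (\<lambda>(x, y). (y, x))) = sigma_sets UNIV {a \<times> b |a b. a \<in> sets borel \<and> b \<in> sets borel}"
    by (simp add: sets_pair_measure)
  show "sets (joint t) = sigma_sets UNIV {a \<times> b |a b. a \<in> sets borel \<and> b \<in> sets borel}"
    by (simp add: sets_joint[OF t] sets_pair_measure)
  show "range (\<lambda>_::nat. UNIV) \<subseteq> {a \<times> b |a b. a \<in> sets (borel :: 'w measure) \<and> b \<in> sets (borel :: 'w measure)}"
    by (auto intro!: exI[of _ UNIV])
  have swap[measurable]: "(\<lambda>(x, y). (y, x)) \<in> measurable (joint t) (borel \<Otimes>\<^sub>M borel)"
    using t by simp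
  interpret S: prob_space "distr (joint t) (borel \<Otimes>\<^sub>M borel) (\<lambda>(x, y). (y, x))"
    by (rule J.prob_space_distr) (rule swap)
  show "emeasure (distr (joint t) (borel \<Otimes>\<^sub>M borel) (\<lambda>(x, y). (y, x))) UNIV \<noteq> \<infinity>" by simp
  have rect: "emeasure (joint t) (A \<times> B) = ennreal (Re (L2_inner \<mu> (indicator A) (P t (indicator B))))"
    if A[measurable]: "A \<in> sets borel" and B[measurable]: "B \<in> sets borel" for A B
  proof -
    have "emeasure (joint t) (A \<times> B) = (\<integral>\<^sup>+z. indicator (A \<times> B) z \<partial>joint t)"
      using t by (simp add: sets_joint)
    also have "\<dots> = (\<integral>\<^sup>+x. \<integral>\<^sup>+y. indicator A x * indicator B y \<partial>transition t x \<partial>\<mu>)"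
      by (subst nn_integral_joint[OF t]) (auto simp: indicator_times)
    also have "\<dots> = (\<integral>\<^sup>+x. ennreal (indicator A x * measure (transition t x) B) \<partial>\<mu>)"
    proof (intro nn_integral_cong)
      fix x
      interpret T: prob_space "transition t x" by (rule transition_space(1)[OF t])
      show "(\<integral>\<^sup>+y. indicator A x * indicator B y \<partial>transition t x) = ennreal (indicator A x * measure (transition t x) B)"
        using t by (subst nn_integral_cmult) (auto simp: transition_space T.emeasure_eq_measure ennreal_mult' split: split_indicator)
    qed
    also have "\<dots> = ennreal (\<integral>x. indicator A x * measure (transition t x) B \<partial>\<mu>)"
    proof (rule nn_integral_eq_integral)
      have "(\<lambda>x. measure (transition t x) B) \<in> borel_measurable borel"
        by (rule measurable_compose[OF transition_subkernel[OF t] measurable_measure_subprob_algebra[OF B]])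
      then show "integrable \<mu> (\<lambda>x. indicator A x * measure (transition t x) B)"
        using prob_space.prob_le_1[OF transition_space(1)[OF t]]
        by (intro integrable_const_bound[where B = 1]) (auto split: split_indicator)
    qed (auto split: split_indicator)
    also have "(\<integral>x. indicator A x * measure (transition t x) B \<partial>\<mu>) = Re (\<integral>x. complex_of_real (indicator A x * measure (transition t x) B) \<partial>\<mu>)"
      by (subst integral_complex_of_real) simp
    also have "(\<integral>x. complex_of_real (indicator A x * measure (transition t x) B) \<partial>\<mu>) = L2_inner \<mu> (indicator A) (P t (indicator B))"
    proof -
      have "P t (indicator B) x = complex_of_real (measure (transition t x) B)" for x
      proof -
        interpret T: prob_space "transition t x" by (rule transition_space(1)[OF t])
        have "(\<integral>y. indicator B y \<partial>transition t x) = (\<integral>y. complex_of_real (indicator B y) \<partial>transition t x)"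
          by (intro Bochner_Integration.integral_cong) (auto split: split_indicator)
        also have "\<dots> = complex_of_real (measure (transition t x) B)"
          using t B sets_eq_imp_space_eq[OF transition_space(2)[OF t]] by (simp add: transition_space)
        finally show ?thesis using t by (simp add: P_eq)
      qed
      then show ?thesis unfolding L2_inner_def
        by (intro Bochner_Integration.integral_cong) (auto split: split_indicator)
    qed
    finally show ?thesis .
  qed
  fix Z assume "Z \<in> {a \<times> b |a b. a \<in> sets (borel :: 'w measure) \<and> b \<in> sets (borel :: 'w measure)}"
  then obtain A B :: "'w set" where Z: "Z = A \<times> B" and A[measurable]: "A \<in> sets borel" and B[measurable]: "B \<in> sets borel"
    by auto
  have ind: "indicator C \<in> L2 \<mu>" if "C \<in> sets borel" for C
    using that by (intro L2_bounded[where M = 1] finite_measure_axioms) (auto split: split_indicator)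
  have "(\<lambda>(x, y). (y, x)) -` (A \<times> B) \<inter> space (joint t) = B \<times> A"
    using sets_eq_imp_space_eq[OF sets_joint[OF t]] by (auto simp: space_pair_measure)
  then have "emeasure (distr (joint t) (borel \<Otimes>\<^sub>M borel) (\<lambda>(x, y). (y, x))) (A \<times> B) = emeasure (joint t) (B \<times> A)"
    using swap by (subst emeasure_distr) auto
  also have "\<dots> = ennreal (Re (L2_inner \<mu> (indicator B) (P t (indicator A))))" by (rule rect) auto
  \<comment> \<open>Moving the semigroup to the other factor exchanges the two sets up to a
    conjugation, which the real part removes.\<close>
  also have "L2_inner \<mu> (indicator B) (P t (indicator A)) = L2_inner \<mu> (P t (indicator B)) (indicator A)"
    using reversible ind[OF A] ind[OF B] t by (auto simp: reversible_def)
  also have "\<dots> = cnj (L2_inner \<mu> (indicator A) (P t (indicator B)))"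
    by (rule cnj_L2_inner[symmetric])
  also have "ennreal (Re (cnj (L2_inner \<mu> (indicator A) (P t (indicator B))))) = emeasure (joint t) (A \<times> B)"
    by (simp add: rect)
  finally show "emeasure (distr (joint t) (borel \<Otimes>\<^sub>M borel) (\<lambda>(x, y). (y, x))) Z = emeasure (joint t) Z"
    by (simp add: Z)
qed auto

end

section \<open>Cauchy-Schwarz and the action of the semigroup on square-integrable functions\<close>

lemma cauchy_schwarz_L2:
  assumes f: "f \<in> L2 \<mu>" and g: "g \<in> L2 \<mu>"
  shows "cmod (\<integral>x. f x * g x \<partial>\<mu>) \<le> L2_norm \<mu> f * L2_norm \<mu> g"
proof -
  have [measurable]: "f \<in> borel_measurable \<mu>" "g \<in> borel_measurable \<mu>"
    using f g by (auto intro: L2_measurable)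
  have int: "integrable \<mu> (\<lambda>x. cmod (f x) * cmod (g x))"
    using integrable_norm[OF L2_mult_integrable[OF f g]] by (simp add: norm_mult)
  have sq: "(\<integral>\<^sup>+x. (ennreal (cmod (h x)))\<^sup>2 \<partial>\<mu>) = ennreal (\<integral>x. (cmod (h x))\<^sup>2 \<partial>\<mu>)" if "h \<in> L2 \<mu>" for h
    using nn_integral_eq_integral[OF L2_integrable[OF that]] by (simp add: ennreal_power)
  have "(\<integral>\<^sup>+x. ennreal (cmod (f x)) * ennreal (cmod (g x)) \<partial>\<mu>)\<^sup>2
      \<le> (\<integral>\<^sup>+x. (ennreal (cmod (f x)))\<^sup>2 \<partial>\<mu>) * (\<integral>\<^sup>+x. (ennreal (cmod (g x)))\<^sup>2 \<partial>\<mu>)"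
    by (rule Cauchy_Schwarz_nn_integral) auto
  moreover have "(\<integral>\<^sup>+x. ennreal (cmod (f x)) * ennreal (cmod (g x)) \<partial>\<mu>) = ennreal (\<integral>x. cmod (f x) * cmod (g x) \<partial>\<mu>)"
    using nn_integral_eq_integral[OF int] by (simp add: ennreal_mult)
  ultimately have "(\<integral>x. cmod (f x) * cmod (g x) \<partial>\<mu>)\<^sup>2 \<le> (\<integral>x. (cmod (f x))\<^sup>2 \<partial>\<mu>) * (\<integral>x. (cmod (g x))\<^sup>2 \<partial>\<mu>)"
    unfolding sq[OF f] sq[OF g] by (simp add: ennreal_power ennreal_mult[symmetric] ennreal_le_iff)
  then have "(\<integral>x. cmod (f x) * cmod (g x) \<partial>\<mu>) \<le> L2_norm \<mu> f * L2_norm \<mu> g"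
    unfolding L2_norm_def real_sqrt_mult[symmetric] by (rule real_le_rsqrt)
  moreover have "cmod (\<integral>x. f x * g x \<partial>\<mu>) \<le> (\<integral>x. cmod (f x) * cmod (g x) \<partial>\<mu>)"
    using integral_norm_bound[of \<mu> "\<lambda>x. f x * g x"] by (simp add: norm_mult)
  ultimately show ?thesis by linarith
qed

context reversible_process
begin

lemma measurable_swap_joint: "0 \<le> t \<Longrightarrow> (\<lambda>(x, y). (y, x)) \<in> measurable (joint t) (borel \<Otimes>\<^sub>M borel)"
  by simp

lemma nn_integral_joint_swap:
  assumes t: "0 \<le> t" and f: "f \<in> borel_measurable (borel \<Otimes>\<^sub>M borel)"
  shows "(\<integral>\<^sup>+z. f (snd z, fst z) \<partial>joint t) = (\<integral>\<^sup>+z. f z \<partial>joint t)"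
proof -
  have "(\<integral>\<^sup>+z. f z \<partial>distr (joint t) (borel \<Otimes>\<^sub>M borel) (\<lambda>(x, y). (y, x))) = (\<integral>\<^sup>+z. f (snd z, fst z) \<partial>joint t)"
    using measurable_swap_joint[OF t] f by (subst nn_integral_distr) (auto simp: case_prod_beta)
  then show ?thesis by (simp add: joint_symmetric[OF t])
qed

lemma integrable_joint_swap:
  fixes f :: "_ \<Rightarrow> complex"
  assumes t: "0 \<le> t" and f: "integrable (joint t) f"
  shows "integrable (joint t) (\<lambda>z. f (snd z, fst z))"
    and "(\<integral>z. f (snd z, fst z) \<partial>joint t) = (\<integral>z. f z \<partial>joint t)"
proof -
  have m: "f \<in> borel_measurable (borel \<Otimes>\<^sub>M borel)" using borel_measurable_integrable[OF f] t by simp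
  have "integrable (distr (joint t) (borel \<Otimes>\<^sub>M borel) (\<lambda>(x, y). (y, x))) f"
    using f by (simp add: joint_symmetric[OF t])
  then show "integrable (joint t) (\<lambda>z. f (snd z, fst z))"
    using integrable_distr[OF measurable_swap_joint[OF t]] by (simp add: case_prod_beta)
  have "(\<integral>z. f z \<partial>distr (joint t) (borel \<Otimes>\<^sub>M borel) (\<lambda>(x, y). (y, x))) = (\<integral>z. f (snd z, fst z) \<partial>joint t)"
    using measurable_swap_joint[OF t] m by (subst integral_distr) (auto simp: case_prod_beta)
  then show "(\<integral>z. f (snd z, fst z) \<partial>joint t) = (\<integral>z. f z \<partial>joint t)" by (simp add: joint_symmetric[OF t])
qed

lemma integrable_joint_fst:
  fixes u :: "'w \<Rightarrow> 'c::{banach, second_countable_topology}"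
  assumes t: "0 \<le> t" and u: "integrable \<mu> u"
  shows "integrable (joint t) (\<lambda>z. u (fst z))" and "(\<integral>z. u (fst z) \<partial>joint t) = (\<integral>x. u x \<partial>\<mu>)"
proof -
  have [measurable]: "u \<in> borel_measurable borel" using borel_measurable_integrable[OF u] by simp
  have fst: "fst \<in> measurable (joint t) (borel :: 'w measure)" using t by simp
  show "integrable (joint t) (\<lambda>z. u (fst z))"
    using u integrable_distr[OF fst, of u] by (simp add: distr_joint_fst[OF t])
  show "(\<integral>z. u (fst z) \<partial>joint t) = (\<integral>x. u x \<partial>\<mu>)"
    using integral_distr[OF fst, of u] by (simp add: distr_joint_fst[OF t])
qed

lemma L2_borel: "f \<in> L2 \<mu> \<Longrightarrow> f \<in> borel_measurable borel"
  using L2_measurable[of f \<mu>] by simp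

lemma integrable_joint_snd_sq:
  assumes t: "0 \<le> t" and b: "b \<in> L2 \<mu>"
  shows "integrable (joint t) (\<lambda>z. (cmod (b (snd z)))\<^sup>2)"
proof -
  have "integrable \<mu> (\<lambda>x. complex_of_real ((cmod (b x))\<^sup>2))" using L2_integrable[OF b] by (rule integrable_of_real)
  from integrable_joint_swap(1)[OF t integrable_joint_fst(1)[OF t this]]
  have "integrable (joint t) (\<lambda>z. complex_of_real ((cmod (b (snd z)))\<^sup>2))" by simp
  from integrable_norm[OF this] show ?thesis by (simp add: norm_power)
qed

lemma integrable_joint_mult:
  assumes t: "0 \<le> t" and a: "a \<in> L2 \<mu>" and b: "b \<in> L2 \<mu>"
  shows "integrable (joint t) (\<lambda>z. a (fst z) * b (snd z))"
proof (rule Bochner_Integration.integrable_bound)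
  have [measurable]: "a \<in> borel_measurable borel" "b \<in> borel_measurable borel" using a b by (auto intro: L2_borel)
  show "integrable (joint t) (\<lambda>z. (cmod (a (fst z)))\<^sup>2 + (cmod (b (snd z)))\<^sup>2)"
    by (intro Bochner_Integration.integrable_add integrable_joint_fst integrable_joint_snd_sq L2_integrable t a b)
  show "(\<lambda>z. a (fst z) * b (snd z)) \<in> borel_measurable (joint t)" using t by simp
qed (simp add: norm_mult two_mult_le_sum_squares)

lemma integral_joint_mult:
  assumes t: "0 \<le> t" and a: "a \<in> L2 \<mu>" and b: "b \<in> L2 \<mu>"
  shows "(\<integral>z. a (fst z) * b (snd z) \<partial>joint t) = (\<integral>x. a x * P t b x \<partial>\<mu>)"
  by (subst integral_joint[OF t integrable_joint_mult[OF t a b]]) (simp add: P_eq[OF t L2_borel[OF b]])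

lemma integral_joint_mult_swap:
  assumes t: "0 \<le> t" and a: "a \<in> L2 \<mu>" and b: "b \<in> L2 \<mu>"
  shows "(\<integral>z. a (snd z) * b (fst z) \<partial>joint t) = (\<integral>x. a x * P t b x \<partial>\<mu>)"
  using integrable_joint_swap(2)[OF t integrable_joint_mult[OF t a b]] integral_joint_mult[OF t a b] by simp

lemma AE_transition_integrable:
  fixes f :: "'w \<Rightarrow> 'c::{banach, second_countable_topology}"
  assumes t: "0 \<le> t" and f: "integrable (joint t) (\<lambda>z. f (snd z))" and [measurable]: "f \<in> borel_measurable borel"
  shows "AE x in \<mu>. integrable (transition t x) f" and "integrable \<mu> (\<lambda>x. \<integral>y. f y \<partial>transition t x)"
proof -
  have *: "integrable (\<mu> \<bind> (\<lambda>x. distr (transition t x) (borel \<Otimes>\<^sub>M borel) (Pair x))) (\<lambda>z. f (snd z))"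
    using f by (simp add: joint_def)
  have Pair: "Pair x \<in> measurable (transition t x) (borel \<Otimes>\<^sub>M borel)" for x using t by simp
  have eq: "integrable (distr (transition t x) (borel \<Otimes>\<^sub>M borel) (Pair x)) (\<lambda>z. f (snd z)) = integrable (transition t x) f" for x
    using integrable_distr_eq[OF Pair, of "\<lambda>z. f (snd z)"] by simp
  show "AE x in \<mu>. integrable (transition t x) f"
    using integrable_bind_kernel(1)[OF joint_kernel[OF t] _ *] by (simp add: eq)
  have "(\<integral>z. f (snd z) \<partial>distr (transition t x) (borel \<Otimes>\<^sub>M borel) (Pair x)) = (\<integral>y. f y \<partial>transition t x)" for x
    using integral_distr[OF Pair, of "\<lambda>z. f (snd z)"] by simp
  then show "integrable \<mu> (\<lambda>x. \<integral>y. f y \<partial>transition t x)"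
    using integrable_bind_kernel(3)[OF joint_kernel[OF t] _ *] by simp
qed

text \<open>Nonnegativity of the variance of \<open>cmod \<circ> b\<close> under
  \<open>transition t x\<close> bounds the squared modulus of \<open>P t b\<close> by the transition
  average of that of \<open>b\<close>, whose \<open>\<mu>\<close>-integral is finite.\<close>

lemma P_L2:
  assumes t: "0 \<le> t" and b: "b \<in> L2 \<mu>" shows "P t b \<in> L2 \<mu>"
proof -
  have [measurable]: "b \<in> borel_measurable borel" by (rule L2_borel[OF b])
  have Pb[measurable]: "P t b \<in> borel_measurable borel" by (rule P_measurable[OF t]) simp
  note sq = AE_transition_integrable[OF t integrable_joint_snd_sq[OF t b]]
  have "integrable \<mu> (\<lambda>x. (cmod (P t b x))\<^sup>2)"
  proof (rule Bochner_Integration.integrable_bound)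
    show "integrable \<mu> (\<lambda>x. \<integral>y. (cmod (b y))\<^sup>2 \<partial>transition t x)" by (rule sq) simp
    have "AE x in \<mu>. integrable (transition t x) (\<lambda>y. (cmod (b y))\<^sup>2)" by (rule sq) simp
    then show "AE x in \<mu>. norm ((cmod (P t b x))\<^sup>2) \<le> norm (\<integral>y. (cmod (b y))\<^sup>2 \<partial>transition t x)"
    proof eventually_elim
      case (elim x)
      interpret T: prob_space "transition t x" by (rule transition_space(1)[OF t])
      have "integrable (transition t x) (\<lambda>y. 1 + (cmod (b y))\<^sup>2)" using elim by simp
      then have int: "integrable (transition t x) (\<lambda>y. cmod (b y))"
      proof (rule Bochner_Integration.integrable_bound)
        have "\<bar>c\<bar> \<le> \<bar>1 + c\<^sup>2\<bar>" for c :: real using two_mult_le_sum_squares[of 1 "\<bar>c\<bar>"] by simp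
        then show "AE y in transition t x. norm (cmod (b y)) \<le> norm (1 + (cmod (b y))\<^sup>2)"
          by (intro AE_I2) (simp only: real_norm_def)
      qed (use t in simp)
      have "cmod (P t b x) \<le> (\<integral>y. cmod (b y) \<partial>transition t x)"
        using t by (subst P_eq) (auto intro: integral_norm_bound)
      then have "(cmod (P t b x))\<^sup>2 \<le> (\<integral>y. cmod (b y) \<partial>transition t x)\<^sup>2" by (intro power_mono) auto
      also have "\<dots> \<le> (\<integral>y. (cmod (b y))\<^sup>2 \<partial>transition t x)"
        using T.variance_eq[OF int elim] T.variance_positive[of "\<lambda>y. cmod (b y)"] by simp
      finally show ?case by simp
    qed
  qed simp
  then show ?thesis by (simp add: L2_def)
qed

section \<open>Energies\<close>

text \<open>Bilinear rather than sesquilinear, because the entries of a matrix square are products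
  without conjugates; where a norm is meant, \<open>cnj\<close> is inserted explicitly in the first
  argument.\<close>

definition energy :: "real \<Rightarrow> ('w \<Rightarrow> complex) \<Rightarrow> ('w \<Rightarrow> complex) \<Rightarrow> complex" where
  "energy t a b = (\<integral>z. incr a z * incr b z \<partial>joint t) / (2 * t)"

text \<open>Of the four products, symmetry of the joint law identifies the two at equal times with
  each other and likewise the two mixed ones.\<close>

lemma energy_integrable:
  assumes t: "0 \<le> t" and a: "a \<in> L2 \<mu>" and b: "b \<in> L2 \<mu>"
  shows "integrable (joint t) (\<lambda>z. incr a z * incr b z)"
    and "(\<integral>z. incr a z * incr b z \<partial>joint t)
      = 2 * (\<integral>x. a x * b x \<partial>\<mu>) - 2 * (\<integral>x. a x * P t b x \<partial>\<mu>)"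
proof -
  note ab = integrable_joint_fst[OF t L2_mult_integrable[OF a b]]
  note ab' = integrable_joint_swap[OF t ab(1), simplified]
  note m = integrable_joint_mult[OF t a b]
  note m' = integrable_joint_swap[OF t m, simplified]
  have eq: "(\<lambda>z. incr a z * incr b z)
    = (\<lambda>z. a (fst z) * b (fst z) - a (fst z) * b (snd z) - a (snd z) * b (fst z) + a (snd z) * b (snd z))"
    by (simp add: algebra_simps)
  show "integrable (joint t) (\<lambda>z. incr a z * incr b z)"
    unfolding eq using ab ab' m m' by simp
  show "(\<integral>z. incr a z * incr b z \<partial>joint t)
      = 2 * (\<integral>x. a x * b x \<partial>\<mu>) - 2 * (\<integral>x. a x * P t b x \<partial>\<mu>)"
    unfolding eq using ab ab' m m' integral_joint_mult[OF t a b] by simp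
qed

lemma energy_eq:
  assumes t: "0 < t" and a: "a \<in> L2 \<mu>" and b: "b \<in> L2 \<mu>"
  shows "energy t a b = - (\<integral>x. a x * ((P t b x - b x) / t) \<partial>\<mu>)"
proof -
  have "(\<integral>x. a x * ((P t b x - b x) / t) \<partial>\<mu>) = (\<integral>x. (a x * P t b x - a x * b x) / t \<partial>\<mu>)"
    by (simp add: right_diff_distrib diff_divide_distrib)
  also have "\<dots> = ((\<integral>x. a x * P t b x \<partial>\<mu>) - (\<integral>x. a x * b x \<partial>\<mu>)) / t"
    using L2_mult_integrable[OF a b] L2_mult_integrable[OF a P_L2[OF less_imp_le[OF t] b]] by simp
  finally have *: "(\<integral>x. a x * ((P t b x - b x) / t) \<partial>\<mu>) = \<dots>" .
  have "(2 * A - 2 * B) / (2 * t) = - ((B - A) / complex_of_real t)" for A B :: complex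
    using t by (simp add: field_simps)
  then show ?thesis unfolding * energy_def energy_integrable(2)[OF less_imp_le[OF t] a b] by simp
qed

definition generator_error :: "('w \<Rightarrow> complex) \<Rightarrow> real \<Rightarrow> 'w \<Rightarrow> complex" where
  "generator_error f t x = (P t f x - f x) / t - generator \<mu> P f x"

lemma generator_properties:
  assumes "f \<in> generator_domain \<mu> P"
  shows "f \<in> L2 \<mu>" "generator \<mu> P f \<in> L2 \<mu>" "((\<lambda>t. L2_norm \<mu> (generator_error f t)) \<longlongrightarrow> 0) (at_right 0)"
proof -
  show f: "f \<in> L2 \<mu>" using assms by (simp add: generator_domain_def)
  have "is_generator_of \<mu> P f (generator \<mu> P f)"
    unfolding generator_def using assms by (intro someI_ex[of "is_generator_of \<mu> P f"]) (auto simp: generator_domain_def)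
  then show "generator \<mu> P f \<in> L2 \<mu>" "((\<lambda>t. L2_norm \<mu> (generator_error f t)) \<longlongrightarrow> 0) (at_right 0)"
    by (auto simp: is_generator_of_def generator_error_def[abs_def])
qed

lemma generator_error_L2:
  assumes "f \<in> generator_domain \<mu> P" "0 < t" shows "generator_error f t \<in> L2 \<mu>"
proof -
  note f = generator_properties[OF assms(1)]
  have "(\<lambda>x. (1 / t) * (P t f x - f x) - generator \<mu> P f x) \<in> L2 \<mu>"
    using assms by (intro L2_diff L2_cmult P_L2 f) auto
  then show ?thesis by (simp add: generator_error_def[abs_def])
qed

text \<open>By \<open>energy_eq\<close> the difference quotient falls on \<open>b\<close> alone, so
  its convergence in \<open>L2\<close> and Cauchy-Schwarz suffice.\<close>

lemma energy_tendsto: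
  assumes a: "a \<in> L2 \<mu>" and b: "b \<in> generator_domain \<mu> P"
  shows "((\<lambda>t. energy t a b) \<longlongrightarrow> - (\<integral>x. a x * generator \<mu> P b x \<partial>\<mu>)) (at_right 0)"
proof -
  note bp = generator_properties[OF b]
  have lim: "((\<lambda>t. L2_norm \<mu> a * L2_norm \<mu> (generator_error b t)) \<longlongrightarrow> 0) (at_right 0)"
    by (rule tendsto_mult_right_zero[OF bp(3)])
  have bound: "cmod (energy t a b - - (\<integral>x. a x * generator \<mu> P b x \<partial>\<mu>)) \<le> L2_norm \<mu> a * L2_norm \<mu> (generator_error b t)"
    if t: "0 < t" for t
  proof -
    have "(\<lambda>x. a x * ((P t b x - b x) / t)) = (\<lambda>x. a x * generator_error b t x + a x * generator \<mu> P b x)"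
      by (simp add: generator_error_def algebra_simps)
    then have "energy t a b - - (\<integral>x. a x * generator \<mu> P b x \<partial>\<mu>) = - (\<integral>x. a x * generator_error b t x \<partial>\<mu>)"
      using L2_mult_integrable[OF a generator_error_L2[OF b t]] L2_mult_integrable[OF a bp(2)]
      unfolding energy_eq[OF t a bp(1)] by simp
    then show ?thesis
      using cauchy_schwarz_L2[OF a generator_error_L2[OF b t]] by (simp only: norm_minus_cancel)
  qed
  have "\<forall>\<^sub>F t in at_right 0. cmod (energy t a b - - (\<integral>x. a x * generator \<mu> P b x \<partial>\<mu>)) \<le> L2_norm \<mu> a * L2_norm \<mu> (generator_error b t)"
    using bound by (intro eventually_at_rightI[of 0 1]) auto
  then have "((\<lambda>t. energy t a b - - (\<integral>x. a x * generator \<mu> P b x \<partial>\<mu>)) \<longlongrightarrow> 0) (at_right 0)"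
    using lim by (rule Lim_null_comparison)
  then show ?thesis by (rule LIM_zero_cancel)
qed


text \<open>The Chapman-Kolmogorov equation: integrate the Markov property over the sample space,
  where conditional expectation given the past up to \<open>s\<close> preserves the
  integral.\<close>

lemma transition_add:
  assumes s: "0 \<le> s" and t: "0 \<le> t"
  shows "transition (s + t) x = transition s x \<bind> transition t"
proof (rule measure_eqI)
  interpret T: prob_space "transition s x" by (rule transition_space(1)[OF s])
  have ker: "transition t \<in> measurable (transition s x) (subprob_algebra borel)"
    using transition_subkernel[OF t] s by simp
  have sb: "sets (transition s x \<bind> transition t) = sets borel"
    by (rule sets_bind[OF sets_kernel[OF ker] T.not_empty])
  then show "sets (transition (s + t) x) = sets (transition s x \<bind> transition t)"
    using s t by (simp add: transition_space)
  fix B assume "B \<in> sets (transition (s + t) x)"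
  then have B[measurable]: "B \<in> sets borel" using s t by (simp add: transition_space)
  interpret Q: prob_space "Pr x" by (rule Pr_space)
  have mF: "measurable (Pr x) N = measurable F N" for N :: "'z measure"
    by (rule measurable_cong_sets[OF Pr_space(2) refl])
  have spF: "space (Pr x) = space F" by (rule sets_eq_imp_space_eq[OF Pr_space(2)])
  have Xs: "X s \<in> measurable F borel" and Xt: "X t \<in> measurable F borel" and Xst: "X (s + t) \<in> measurable F borel"
    using s t by (auto intro: measurable_X)
  have "{X u -` B \<inter> space F | u B. 0 \<le> u \<and> u \<le> s \<and> B \<in> sets borel} \<subseteq> sets F"
    using measurable_X by (auto intro: measurable_sets)
  then have "sets (past F X s) \<subseteq> sets F"
    unfolding past_def by (subst sets_measure_of) (auto dest: sets.sets_into_space intro: sets.sigma_sets_subset[THEN subsetD])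
  then interpret S: finite_measure_subalgebra "Pr x" "past F X s"
    by unfold_locales (auto simp: subalgebra_def spF past_def Pr_space space_measure_of_conv)
  define h where "h \<omega> = measure (transition t (X s \<omega>)) B" for \<omega>
  have h_meas: "h \<in> borel_measurable F"
    unfolding h_def
    by (rule measurable_compose[OF Xs measurable_compose[OF transition_subkernel[OF t] measurable_measure_subprob_algebra[OF B]]])
  have h_le: "h \<omega> \<le> 1" "0 \<le> h \<omega>" for \<omega>
    unfolding h_def by (auto intro: prob_space.prob_le_1[OF transition_space(1)[OF t]])
  have ind_meas: "(\<lambda>\<omega>. indicator B (X (s + t) \<omega>) :: real) \<in> borel_measurable F"
    using Xst by measurable
  have ind_int: "integrable (Pr x) (\<lambda>\<omega>. indicator B (X (s + t) \<omega>) :: real)"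
    using ind_meas by (intro Q.integrable_const_bound[where B = 1]) (auto simp: mF split: split_indicator)
  have "AE \<omega> in Pr x. real_cond_exp (Pr x) (past F X s) (\<lambda>\<omega>'. indicator B (X (s + t) \<omega>')) \<omega> = h \<omega>"
    using markov[OF s t B]
  proof eventually_elim
    case (elim \<omega>)
    have "X t -` B \<inter> space (Pr (X s \<omega>)) = {\<omega>' \<in> space F. X t \<omega>' \<in> B}"
      using sets_eq_imp_space_eq[OF Pr_space(2)] by auto
    then have "h \<omega> = measure (Pr (X s \<omega>)) {\<omega>' \<in> space F. X t \<omega>' \<in> B}"
      unfolding h_def transition_def
      using Xt by (subst measure_distr) (auto simp: measurable_cong_sets[OF Pr_space(2) refl])
    then show ?case using elim by simp
  qed
  then have "(\<integral>\<omega>. real_cond_exp (Pr x) (past F X s) (\<lambda>\<omega>'. indicator B (X (s + t) \<omega>')) \<omega> \<partial>Pr x) = (\<integral>\<omega>. h \<omega> \<partial>Pr x)"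
    using h_meas borel_measurable_cond_exp2[of "Pr x" "past F X s" "\<lambda>\<omega>'. indicator B (X (s + t) \<omega>')"]
    by (intro integral_cong_AE) (auto simp: mF)
  then have int_eq: "(\<integral>\<omega>. indicator B (X (s + t) \<omega>) \<partial>Pr x) = (\<integral>\<omega>. h \<omega> \<partial>Pr x)"
    using S.real_cond_exp_int(2)[OF ind_int] by simp
  have "emeasure (transition (s + t) x) B = (\<integral>\<^sup>+y. indicator B y \<partial>distr (Pr x) borel (X (s + t)))"
    by (simp add: transition_def)
  also have "\<dots> = (\<integral>\<^sup>+\<omega>. ennreal (indicator B (X (s + t) \<omega>)) \<partial>Pr x)"
    using Xst by (subst nn_integral_distr) (auto simp: mF ennreal_indicator)
  also have "\<dots> = ennreal (\<integral>\<omega>. h \<omega> \<partial>Pr x)"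
    using ind_int by (subst nn_integral_eq_integral) (auto simp: int_eq)
  also have "\<dots> = (\<integral>\<^sup>+\<omega>. ennreal (h \<omega>) \<partial>Pr x)"
    using h_le h_meas by (intro nn_integral_eq_integral[symmetric] Q.integrable_const_bound[where B = 1]) (auto simp: mF)
  also have "\<dots> = (\<integral>\<^sup>+\<omega>. emeasure (transition t (X s \<omega>)) B \<partial>Pr x)"
    unfolding h_def
    by (intro nn_integral_cong finite_measure.emeasure_eq_measure[symmetric] prob_space.finite_measure transition_space t)
  also have "\<dots> = (\<integral>\<^sup>+y. emeasure (transition t y) B \<partial>transition s x)"
    unfolding transition_def[of s] using Xs
    by (subst nn_integral_distr)
       (auto simp: mF intro!: measurable_compose[OF transition_subkernel[OF t] measurable_emeasure_subprob_algebra])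
  also have "\<dots> = emeasure (transition s x \<bind> transition t) B"
    by (rule emeasure_bind[OF T.not_empty ker B, symmetric])
  finally show "emeasure (transition (s + t) x) B = emeasure (transition s x \<bind> transition t) B" .
qed

lemma const_L2: "(\<lambda>x. c) \<in> L2 \<mu>"
  by (rule L2_bounded[where M = "cmod c"]) (auto intro: finite_measure_axioms)

text \<open>Only almost everywhere: at a point where \<open>u\<close> fails to be integrable for the
  law at time \<open>s + t\<close>, the single and the iterated Bochner integral need not
  agree.\<close>

lemma P_add:
  assumes s: "0 \<le> s" and t: "0 \<le> t" and u: "u \<in> L2 \<mu>"
  shows "AE x in \<mu>. P (s + t) u x = P s (P t u) x"
proof -
  have st: "0 \<le> s + t" using s t by simp
  have [measurable]: "u \<in> borel_measurable borel" by (rule L2_borel[OF u])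
  have "integrable (joint (s + t)) (\<lambda>z. u (snd z))"
    using integrable_joint_mult[OF st const_L2[of 1] u] by simp
  from AE_transition_integrable(1)[OF st this] have "AE x in \<mu>. integrable (transition (s + t) x) u" by simp
  then show ?thesis
  proof eventually_elim
    case (elim x)
    interpret T: prob_space "transition s x" by (rule transition_space(1)[OF s])
    have ker: "transition t \<in> measurable (transition s x) (subprob_algebra borel)"
      using transition_subkernel[OF t] s by simp
    have "P (s + t) u x = (\<integral>y. u y \<partial>(transition s x \<bind> transition t))"
      using st by (simp add: P_eq transition_add[OF s t])
    also have "\<dots> = (\<integral>y. P t u y \<partial>transition s x)"
    proof -
      have "P t u = (\<lambda>y. \<integral>z. u z \<partial>transition t y)" using t by (intro ext P_eq) auto
      then show ?thesis
        using elim by (subst integral_bind_kernel[OF ker T.not_empty]) (simp_all add: transition_add[OF s t])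
    qed
    also have "\<dots> = P s (P t u) x" using s P_measurable[OF t, of u] by (simp add: P_eq)
    finally show ?case .
  qed
qed

lemma P_cnj: "P t (\<lambda>x. cnj (u x)) x = cnj (P t u x)"
  unfolding markov_semigroup_def by (rule Bochner_Integration.integral_cnj)

lemma P_symmetric:
  assumes "0 \<le> t" "a \<in> L2 \<mu>" "b \<in> L2 \<mu>"
  shows "(\<integral>x. a x * P t b x \<partial>\<mu>) = (\<integral>x. b x * P t a x \<partial>\<mu>)"
  using integral_joint_mult[OF assms] integral_joint_mult_swap[OF assms(1,3,2)] by (simp add: mult.commute)

text \<open>With \<open>w = P\<^bsub>t/2\<^esub> u\<close> the difference of the two sides is \<open>\<parallel>u - w\<parallel>\<^sup>2 / t\<close>.\<close>

lemma energy_le_half: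
  assumes t: "0 < t" and u: "u \<in> L2 \<mu>"
  shows "Re (energy t (\<lambda>x. cnj (u x)) u) \<le> Re (energy (t / 2) (\<lambda>x. cnj (u x)) u)"
proof -
  define w where "w = P (t / 2) u"
  have t0: "0 \<le> t" "0 \<le> t / 2" "0 < t / 2" using t by auto
  have w: "w \<in> L2 \<mu>" unfolding w_def by (rule P_L2[OF t0(2) u])
  note cu = L2_cnj[OF u] and cw = L2_cnj[OF w]
  have Ptu: "P t u \<in> L2 \<mu>" and Pw: "P (t / 2) w \<in> L2 \<mu>" using P_L2 t0 u w by auto
  \<comment> \<open>The semigroup law splits \<open>P t\<close> into two half steps, one of which is
    moved to the other factor, leaving the squared norm of \<open>w\<close>.\<close>
  have "(\<integral>x. cnj (u x) * P t u x \<partial>\<mu>) = (\<integral>x. cnj (u x) * P (t / 2) w x \<partial>\<mu>)"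
  proof (rule integral_cong_AE)
    show "AE x in \<mu>. cnj (u x) * P t u x = cnj (u x) * P (t / 2) w x"
      using P_add[OF t0(2) t0(2) u] by eventually_elim (simp add: w_def)
  qed (use L2_measurable[OF cu] L2_measurable[OF Ptu] L2_measurable[OF Pw] in \<open>auto intro: borel_measurable_times\<close>)
  also have "\<dots> = (\<integral>x. w x * P (t / 2) (\<lambda>x. cnj (u x)) x \<partial>\<mu>)"
    by (rule P_symmetric[OF t0(2) cu w])
  also have "\<dots> = (\<integral>x. cnj (w x) * w x \<partial>\<mu>)" by (simp add: P_cnj w_def mult.commute)
  finally have Pt: "(\<integral>x. cnj (u x) * P t u x \<partial>\<mu>) = (\<integral>x. cnj (w x) * w x \<partial>\<mu>)" .
  define U W Z where "U = (\<integral>x. cnj (u x) * u x \<partial>\<mu>)" and "W = (\<integral>x. cnj (w x) * w x \<partial>\<mu>)"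
    and "Z = (\<integral>x. cnj (u x) * w x \<partial>\<mu>)"
  have Z': "(\<integral>x. cnj (w x) * u x \<partial>\<mu>) = cnj Z"
    unfolding Z_def Bochner_Integration.integral_cnj[symmetric] by (simp add: mult.commute)
  note int = L2_mult_integrable[OF cu u] L2_mult_integrable[OF cw w] L2_mult_integrable[OF cu w] L2_mult_integrable[OF cw u]
  have "0 \<le> (\<integral>x. (cmod (u x - w x))\<^sup>2 \<partial>\<mu>)" by simp
  also have "\<dots> = Re (\<integral>x. complex_of_real ((cmod (u x - w x))\<^sup>2) \<partial>\<mu>)"
    by (subst integral_complex_of_real) simp
  also have "(\<integral>x. complex_of_real ((cmod (u x - w x))\<^sup>2) \<partial>\<mu>)
      = (\<integral>x. cnj (u x) * u x - cnj (u x) * w x - cnj (w x) * u x + cnj (w x) * w x \<partial>\<mu>)"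
    by (intro Bochner_Integration.integral_cong refl) (simp only: cnj_mult_self[symmetric] complex_cnj_diff, simp add: algebra_simps)
  also have "\<dots> = U - Z - cnj Z + W"
    using int by (simp add: U_def W_def Z_def Z'[unfolded Z_def])
  finally have ineq: "0 \<le> Re U - 2 * Re Z + Re W" by simp
  have "energy t (\<lambda>x. cnj (u x)) u = (2 * U - 2 * W) / (2 * t)"
    unfolding energy_def energy_integrable(2)[OF t0(1) cu u] Pt by (simp add: U_def W_def)
  moreover have "energy (t / 2) (\<lambda>x. cnj (u x)) u = (2 * U - 2 * Z) / (2 * (t / 2))"
    unfolding energy_def energy_integrable(2)[OF t0(2) cu u] by (simp add: U_def Z_def w_def)
  moreover have "(2 * U - 2 * W) / (2 * t) = complex_of_real (1 / t) * (U - W)"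
    "(2 * U - 2 * Z) / (2 * (t / 2)) = complex_of_real (1 / t) * (2 * U - 2 * Z)"
    using t by (simp_all add: field_simps)
  ultimately have "Re (energy t (\<lambda>x. cnj (u x)) u) = (1 / t) * (Re U - Re W)"
    "Re (energy (t / 2) (\<lambda>x. cnj (u x)) u) = (1 / t) * (2 * Re U - 2 * Re Z)"
    by (simp_all only: Re_complex_of_real Im_complex_of_real times_complex.sel minus_complex.sel) auto
  moreover have "(1 / t) * (Re U - Re W) \<le> (1 / t) * (2 * Re U - 2 * Re Z)"
    using ineq t by (intro mult_left_mono) auto
  ultimately show ?thesis by simp
qed

section \<open>Weighted energies and their limit at time zero\<close>

lemma L2_norm_bounded_mult_le:
  assumes f: "f \<in> L2 \<mu>" and v: "v \<in> borel_measurable \<mu>" and M: "\<And>x. cmod (v x) \<le> M"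
  shows "L2_norm \<mu> (\<lambda>x. v x * f x) \<le> M * L2_norm \<mu> f"
proof -
  have M0: "0 \<le> M" using M[of undefined] norm_ge_zero order.trans by blast
  have "(\<integral>x. (cmod (v x * f x))\<^sup>2 \<partial>\<mu>) \<le> (\<integral>x. M\<^sup>2 * (cmod (f x))\<^sup>2 \<partial>\<mu>)"
    using M L2_integrable[OF L2_bounded_mult[OF f v M]] L2_integrable[OF f]
    by (intro integral_mono) (auto simp: norm_mult power_mult_distrib intro!: mult_right_mono power_mono)
  then have "L2_norm \<mu> (\<lambda>x. v x * f x) \<le> sqrt (M\<^sup>2 * (\<integral>x. (cmod (f x))\<^sup>2 \<partial>\<mu>))"
    unfolding L2_norm_def by simp
  also have "\<dots> = M * L2_norm \<mu> f" using M0 by (simp add: L2_norm_def real_sqrt_mult)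
  finally show ?thesis .
qed

lemma integral_P_eq_error:
  assumes a: "a \<in> L2 \<mu>" and b: "b \<in> generator_domain \<mu> P" and t: "0 < t"
  shows "(\<integral>x. a x * P t b x \<partial>\<mu>) = t * (\<integral>x. a x * generator_error b t x \<partial>\<mu>)
    + t * (\<integral>x. a x * generator \<mu> P b x \<partial>\<mu>) + (\<integral>x. a x * b x \<partial>\<mu>)"
proof -
  note bp = generator_properties[OF b]
  have "(\<lambda>x. a x * P t b x) = (\<lambda>x. t * (a x * generator_error b t x) + t * (a x * generator \<mu> P b x) + a x * b x)"
    using t by (simp add: generator_error_def field_simps)
  then show ?thesis
    using L2_mult_integrable[OF a generator_error_L2[OF b t]] L2_mult_integrable[OF a bp(2)] L2_mult_integrable[OF a bp(1)]
    by simp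
qed

text \<open>Integrating out the second point replaces each function there by its image under
  \<open>P t\<close>, and \<open>P t\<close> is expanded to first order in \<open>t\<close>. The
  error is explicit and linear in the bound \<open>M\<close>, instead of a mere limit, because the
  weights to be inserted for \<open>v\<close> vary with the node \<open>s\<close>, and the estimate
  has to be uniform over them.\<close>

lemma weighted_energy_error:
  fixes a b :: "'k::finite \<Rightarrow> 'w \<Rightarrow> complex"
  assumes a: "\<And>k. a k \<in> generator_domain \<mu> P" and b: "\<And>k. b k \<in> generator_domain \<mu> P"
    and ab: "\<And>k. (\<lambda>x. a k x * b k x) \<in> L2 \<mu>" and c: "(\<lambda>x. \<Sum>k\<in>UNIV. a k x * b k x) \<in> generator_domain \<mu> P"
    and v: "v \<in> borel_measurable \<mu>" and M: "\<And>x. cmod (v x) \<le> M" and t: "0 < t"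
  defines "C \<equiv> \<lambda>x. \<Sum>k\<in>UNIV. a k x * b k x"
  defines "G \<equiv> \<lambda>x. (1 / 2) * (generator \<mu> P C x - (\<Sum>k\<in>UNIV. a k x * generator \<mu> P (b k) x)
      - (\<Sum>k\<in>UNIV. b k x * generator \<mu> P (a k) x))"
  shows "integrable (joint t) (\<lambda>z. v (fst z) * (\<Sum>k\<in>UNIV. incr (a k) z * incr (b k) z))" (is "integrable _ ?F")
    and "integrable \<mu> (\<lambda>x. v x * G x)"
    and "cmod ((\<integral>z. v (fst z) * (\<Sum>k\<in>UNIV. incr (a k) z * incr (b k) z) \<partial>joint t) / (2 * t)
       - (\<integral>x. v x * G x \<partial>\<mu>))
      \<le> M * (L2_norm \<mu> (\<lambda>x. 1) * L2_norm \<mu> (generator_error C t)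
        + (\<Sum>k\<in>UNIV. L2_norm \<mu> (a k) * L2_norm \<mu> (generator_error (b k) t))
        + (\<Sum>k\<in>UNIV. L2_norm \<mu> (b k) * L2_norm \<mu> (generator_error (a k) t)))"
proof -
  have t0: "0 \<le> t" using t by simp
  have M0: "0 \<le> M" using M[of undefined] norm_ge_zero order.trans by blast
  note ap = generator_properties[OF a] and bp = generator_properties[OF b] and cp = generator_properties[OF c, folded C_def]
  have c': "C \<in> generator_domain \<mu> P" using c by (simp add: C_def)
  have va: "(\<lambda>x. v x * a k x) \<in> L2 \<mu>" and vb: "(\<lambda>x. v x * b k x) \<in> L2 \<mu>" for k
    by (rule L2_bounded_mult[OF ap(1) v M] L2_bounded_mult[OF bp(1) v M])+
  have vL: "v \<in> L2 \<mu>" by (rule L2_bounded[OF finite_measure_axioms v M])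
  have vab: "integrable \<mu> (\<lambda>x. v x * a k x * b k x)" for k by (rule L2_mult_integrable[OF va bp(1)])
  have vC: "integrable \<mu> (\<lambda>x. v x * C x)" by (rule L2_mult_integrable[OF vL cp(1)])
  have vC_eq: "(\<integral>x. v x * C x \<partial>\<mu>) = (\<Sum>k\<in>UNIV. \<integral>x. v x * a k x * b k x \<partial>\<mu>)"
    using vab by (subst Bochner_Integration.integral_sum[symmetric]) (auto simp: C_def sum_distrib_left mult_ac)
  note j1 = integrable_joint_fst[OF t0 vC]
  note j2 = integrable_joint_mult[OF t0 va bp(1)] integral_joint_mult[OF t0 va bp(1)]
  note j3 = integrable_joint_mult[OF t0 vb ap(1)] integral_joint_mult[OF t0 vb ap(1)]
  note j4 = integrable_joint_mult[OF t0 vL cp(1)] integral_joint_mult[OF t0 vL cp(1)]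
  have expand: "?F
     = (\<lambda>z. v (fst z) * C (fst z) + v (fst z) * C (snd z) - (\<Sum>k\<in>UNIV. v (fst z) * a k (fst z) * b k (snd z))
        - (\<Sum>k\<in>UNIV. v (fst z) * b k (fst z) * a k (snd z)))"
    by (simp add: C_def algebra_simps sum.distrib sum_subtractf sum_distrib_left)
  show "integrable (joint t) ?F"
    unfolding expand using j1 j2 j3 j4 by simp
  note int_L = L2_mult_integrable[OF vL cp(2)] L2_mult_integrable[OF va bp(2)] L2_mult_integrable[OF vb ap(2)]
  have vG: "(\<lambda>x. v x * G x) = (\<lambda>x. (1 / 2) * (v x * generator \<mu> P C x - (\<Sum>k\<in>UNIV. v x * a k x * generator \<mu> P (b k) x)
      - (\<Sum>k\<in>UNIV. v x * b k x * generator \<mu> P (a k) x)))"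
    by (simp add: G_def algebra_simps sum_distrib_left)
  show "integrable \<mu> (\<lambda>x. v x * G x)" unfolding vG using int_L by simp
  define E0 where "E0 = (\<integral>x. v x * generator_error C t x \<partial>\<mu>)"
  define E1 where "E1 k = (\<integral>x. v x * a k x * generator_error (b k) t x \<partial>\<mu>)" for k
  define E2 where "E2 k = (\<integral>x. v x * b k x * generator_error (a k) t x \<partial>\<mu>)" for k
  define L0 where "L0 = (\<integral>x. v x * generator \<mu> P C x \<partial>\<mu>)"
  define L1 where "L1 k = (\<integral>x. v x * a k x * generator \<mu> P (b k) x \<partial>\<mu>)" for k
  define L2' where "L2' k = (\<integral>x. v x * b k x * generator \<mu> P (a k) x \<partial>\<mu>)" for k
  define S where "S k = (\<integral>x. v x * a k x * b k x \<partial>\<mu>)" for k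
  have S': "(\<integral>x. v x * b k x * a k x \<partial>\<mu>) = S k" for k by (simp add: S_def mult_ac)
  have "(\<integral>z. ?F z \<partial>joint t)
     = (\<integral>x. v x * C x \<partial>\<mu>) + (\<integral>x. v x * P t C x \<partial>\<mu>) - (\<Sum>k\<in>UNIV. \<integral>x. v x * a k x * P t (b k) x \<partial>\<mu>)
       - (\<Sum>k\<in>UNIV. \<integral>x. v x * b k x * P t (a k) x \<partial>\<mu>)"
    unfolding expand using j1 j2 j3 j4 by simp
  also have "\<dots> = (\<Sum>k\<in>UNIV. S k) + (t * E0 + t * L0 + (\<Sum>k\<in>UNIV. S k))
       - (\<Sum>k\<in>UNIV. t * E1 k + t * L1 k + S k) - (\<Sum>k\<in>UNIV. t * E2 k + t * L2' k + S k)"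
    unfolding integral_P_eq_error[OF vL c' t] integral_P_eq_error[OF va b t] integral_P_eq_error[OF vb a t] vC_eq
    by (simp only: E0_def E1_def E2_def L0_def L1_def L2'_def S_def[symmetric] S')
  \<comment> \<open>The terms of order zero cancel: \<open>S k\<close> occurs twice with each
    sign.\<close>
  also have "\<dots> = t * (E0 - (\<Sum>k\<in>UNIV. E1 k) - (\<Sum>k\<in>UNIV. E2 k) + (L0 - (\<Sum>k\<in>UNIV. L1 k) - (\<Sum>k\<in>UNIV. L2' k)))"
    by (simp add: sum.distrib sum_distrib_left algebra_simps)
  finally have "(\<integral>z. ?F z \<partial>joint t) / (2 * t)
     = (1 / 2) * (E0 - (\<Sum>k\<in>UNIV. E1 k) - (\<Sum>k\<in>UNIV. E2 k)) + (1 / 2) * (L0 - (\<Sum>k\<in>UNIV. L1 k) - (\<Sum>k\<in>UNIV. L2' k))"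
  proof -
    have "t * (X + Y) / (2 * t) = (1 / 2) * X + (1 / 2) * Y" for X Y :: complex
      using t by (simp add: field_simps)
    moreover assume "(\<integral>z. ?F z \<partial>joint t)
      = t * (E0 - (\<Sum>k\<in>UNIV. E1 k) - (\<Sum>k\<in>UNIV. E2 k) + (L0 - (\<Sum>k\<in>UNIV. L1 k) - (\<Sum>k\<in>UNIV. L2' k)))"
    ultimately show ?thesis by (simp only:)
  qed
  moreover have "(\<integral>x. v x * G x \<partial>\<mu>) = (1 / 2) * (L0 - (\<Sum>k\<in>UNIV. L1 k) - (\<Sum>k\<in>UNIV. L2' k))"
    unfolding vG using int_L by (simp add: L0_def L1_def L2'_def)
  ultimately have "cmod ((\<integral>z. ?F z \<partial>joint t) / (2 * t)
       - (\<integral>x. v x * G x \<partial>\<mu>)) = cmod ((1 / 2) * (E0 - (\<Sum>k\<in>UNIV. E1 k) - (\<Sum>k\<in>UNIV. E2 k)))"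
    by (simp only: add_diff_cancel_right')
  also have "\<dots> = (1 / 2) * cmod (E0 - (\<Sum>k\<in>UNIV. E1 k) - (\<Sum>k\<in>UNIV. E2 k))"
    by (simp add: norm_mult)
  also have "\<dots> \<le> cmod E0 + (\<Sum>k\<in>UNIV. cmod (E1 k)) + (\<Sum>k\<in>UNIV. cmod (E2 k))"
  proof -
    have "cmod (E0 - (\<Sum>k\<in>UNIV. E1 k) - (\<Sum>k\<in>UNIV. E2 k)) \<le> cmod E0 + cmod (\<Sum>k\<in>UNIV. E1 k) + cmod (\<Sum>k\<in>UNIV. E2 k)"
      by (intro order.trans[OF norm_triangle_ineq4] add_right_mono norm_triangle_ineq4)
    moreover have "cmod (\<Sum>k\<in>UNIV. E1 k) \<le> (\<Sum>k\<in>UNIV. cmod (E1 k))" "cmod (\<Sum>k\<in>UNIV. E2 k) \<le> (\<Sum>k\<in>UNIV. cmod (E2 k))"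
      by (rule norm_sum)+
    ultimately show ?thesis
      using norm_ge_zero[of "E0 - (\<Sum>k\<in>UNIV. E1 k) - (\<Sum>k\<in>UNIV. E2 k)"] by linarith
  qed
  also have "\<dots> \<le> M * (L2_norm \<mu> (\<lambda>x. 1) * L2_norm \<mu> (generator_error C t))
        + (\<Sum>k\<in>UNIV. M * (L2_norm \<mu> (a k) * L2_norm \<mu> (generator_error (b k) t)))
        + (\<Sum>k\<in>UNIV. M * (L2_norm \<mu> (b k) * L2_norm \<mu> (generator_error (a k) t)))"
  proof -
    have *: "cmod (\<integral>x. v x * f x * generator_error h t x \<partial>\<mu>) \<le> M * (L2_norm \<mu> f * L2_norm \<mu> (generator_error h t))"
      if "f \<in> L2 \<mu>" "h \<in> generator_domain \<mu> P" for f h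
    proof -
      have "cmod (\<integral>x. v x * f x * generator_error h t x \<partial>\<mu>) \<le> L2_norm \<mu> (\<lambda>x. v x * f x) * L2_norm \<mu> (generator_error h t)"
        using that t by (intro cauchy_schwarz_L2 L2_bounded_mult[OF _ v M] generator_error_L2)
      also have "\<dots> \<le> (M * L2_norm \<mu> f) * L2_norm \<mu> (generator_error h t)"
        using that by (intro mult_right_mono L2_norm_bounded_mult_le[OF _ v M]) (auto simp: L2_norm_def)
      finally show ?thesis by (simp add: mult_ac)
    qed
    show ?thesis
      unfolding E0_def E1_def E2_def using *[OF const_L2[of 1] c'] *[OF ap(1) b] *[OF bp(1) a]
      by (intro add_mono sum_mono) auto
  qed
  also have "\<dots> = M * (L2_norm \<mu> (\<lambda>x. 1) * L2_norm \<mu> (generator_error C t)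
        + (\<Sum>k\<in>UNIV. L2_norm \<mu> (a k) * L2_norm \<mu> (generator_error (b k) t))
        + (\<Sum>k\<in>UNIV. L2_norm \<mu> (b k) * L2_norm \<mu> (generator_error (a k) t)))"
    by (simp add: sum_distrib_left distrib_left)
  finally show "cmod ((\<integral>z. ?F z \<partial>joint t) / (2 * t)
       - (\<integral>x. v x * G x \<partial>\<mu>)) \<le> \<dots>" .
qed

end

section \<open>Matrix energies and the matrix Dirichlet form\<close>

lemma trace_mult_square:
  "trace (V ** (D ** D)) = (\<Sum>i\<in>UNIV. \<Sum>j\<in>UNIV. V $ i $ j * (\<Sum>k\<in>UNIV. D $ j $ k * D $ k $ i))"
  by (simp add: trace_def matrix_matrix_mult_def)

lemma Re_trace_psd_square_nonneg:
  assumes "psd V" "hermitian_mat D" shows "0 \<le> Re (trace (V ** (D ** D)))"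
proof -
  obtain U l where "V = conj_diag U l" "\<And>i. 0 \<le> l i"
    using assms(1) by (auto simp: psd_def)
  then show ?thesis
    by (simp only: trace_spectral_mult_sq[OF assms(2)]) (intro sum_nonneg mult_nonneg_nonneg, auto)
qed

lemma hermitian_diff: "hermitian_mat A \<Longrightarrow> hermitian_mat B \<Longrightarrow> hermitian_mat (A - B)"
  by (simp add: hermitian_mat_def cadjoint_def vec_eq_iff)

lemma energy_cmod:
  "(cnj (u x) - cnj (u y)) * (u x - u y) = complex_of_real ((cmod (u x - u y))\<^sup>2)"
  by (metis cnj_mult_self complex_cnj_diff)

context reversible_process
begin

text \<open>The mean squared Hilbert-Schmidt norm of the increment of \<open>f\<close>, divided by
  \<open>2 * t\<close>. Writing it through scalar energies makes \<open>energy_le_half\<close>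
  applicable to each entry.\<close>

definition mat_energy :: "real \<Rightarrow> ('w \<Rightarrow> complex^'d^'d) \<Rightarrow> real" where
  "mat_energy t f = (\<Sum>i\<in>UNIV. \<Sum>j\<in>UNIV. Re (energy t (\<lambda>x. cnj (f x $ i $ j)) (\<lambda>x. f x $ i $ j)))"

lemma cmod_diff_sq_integral:
  assumes t: "0 < t" and u: "u \<in> L2 \<mu>"
  shows "integrable (joint t) (\<lambda>z. (cmod (incr u z))\<^sup>2)"
    and "(\<integral>z. (cmod (incr u z))\<^sup>2 \<partial>joint t) = 2 * t * Re (energy t (\<lambda>x. cnj (u x)) u)"
proof -
  have int: "integrable (joint t) (\<lambda>z. complex_of_real ((cmod (incr u z))\<^sup>2))"
    using energy_integrable(1)[OF less_imp_le[OF t] L2_cnj[OF u] u] by (simp only: energy_cmod)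
  then show int': "integrable (joint t) (\<lambda>z. (cmod (incr u z))\<^sup>2)"
    using integrable_Re[OF int] by simp
  have "energy t (\<lambda>x. cnj (u x)) u = complex_of_real (\<integral>z. (cmod (incr u z))\<^sup>2 \<partial>joint t) / (2 * t)"
    unfolding energy_def energy_cmod integral_complex_of_real ..
  also have "\<dots> = complex_of_real ((\<integral>z. (cmod (incr u z))\<^sup>2 \<partial>joint t) / (2 * t))" by simp
  finally have "Re (energy t (\<lambda>x. cnj (u x)) u) = (\<integral>z. (cmod (incr u z))\<^sup>2 \<partial>joint t) / (2 * t)"
    by (simp only: Re_complex_of_real)
  then show "(\<integral>z. (cmod (incr u z))\<^sup>2 \<partial>joint t) = 2 * t * Re (energy t (\<lambda>x. cnj (u x)) u)"
    using t by simp
qed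

lemma norm_diff_sq_integral:
  assumes t: "0 < t" and f: "entries_in (L2 \<mu>) f"
  shows "integrable (joint t) (\<lambda>z. (norm (incr f z))\<^sup>2)"
    and "(\<integral>z. (norm (incr f z))\<^sup>2 \<partial>joint t) = 2 * t * mat_energy t f"
    and "(\<integral>\<^sup>+z. ennreal ((norm (incr f z))\<^sup>2) \<partial>joint t) = ennreal (2 * t * mat_energy t f)"
    and "0 \<le> mat_energy t f"
proof -
  have u: "(\<lambda>x. f x $ i $ j) \<in> L2 \<mu>" for i j using f by (simp add: entries_in_def)
  show int: "integrable (joint t) (\<lambda>z. (norm (incr f z))\<^sup>2)"
    unfolding norm_matrix_sq using cmod_diff_sq_integral(1)[OF t u]
    by (simp add: Bochner_Integration.integrable_sum)
  show eq: "(\<integral>z. (norm (incr f z))\<^sup>2 \<partial>joint t) = 2 * t * mat_energy t f"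
    unfolding norm_matrix_sq mat_energy_def using cmod_diff_sq_integral[OF t u]
    by (simp add: Bochner_Integration.integral_sum Bochner_Integration.integrable_sum sum_distrib_left)
  show "(\<integral>\<^sup>+z. ennreal ((norm (incr f z))\<^sup>2) \<partial>joint t) = ennreal (2 * t * mat_energy t f)"
    unfolding eq[symmetric] using int by (intro nn_integral_eq_integral) auto
  have "0 \<le> 2 * t * mat_energy t f" unfolding eq[symmetric] by simp
  then show "0 \<le> mat_energy t f" using t by (simp add: zero_le_mult_iff)
qed

text \<open>Repeated halving reaches only the times \<open>t / 2 ^ n\<close>, but these tend to
  zero, which is enough for a comparison with the limit.\<close>

lemma mat_energy_mono:
  assumes t: "0 < t" and f: "entries_in (L2 \<mu>) f"
  shows "mat_energy t f \<le> mat_energy (t / 2 ^ n) f"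
proof (induction n)
  case (Suc n)
  have "mat_energy (t / 2 ^ n) f \<le> mat_energy (t / 2 ^ n / 2) f"
    unfolding mat_energy_def using t f by (intro sum_mono energy_le_half) (auto simp: entries_in_def)
  then show ?case using Suc by (simp add: mult.commute)
qed simp

lemma entries_in_L2_mult_const:
  assumes "entries_in (L2 \<mu>) f" shows "entries_in (L2 \<mu>) (\<lambda>x. f x ** Q)"
proof -
  have "(\<lambda>x. \<Sum>k\<in>UNIV. Q $ k $ j * f x $ i $ k) \<in> L2 \<mu>" for i j
    using assms by (intro L2_sum L2_cmult) (simp add: entries_in_def)
  then show ?thesis by (simp add: entries_in_def matrix_matrix_mult_def mult.commute)
qed

text \<open>For a Hermitian increment \<open>D\<close>, cyclicity turns the squared norm of
  \<open>D ** Q\<close> into the trace of \<open>Q ** Q ** (D ** D)\<close>. No conjugates remain,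
  and the energies on the right are those whose limits are the entries of the Dirichlet
  form.\<close>

lemma mat_energy_mult_eq:
  fixes f :: "'w \<Rightarrow> complex^'d^'d"
  assumes t: "0 < t" and f: "entries_in (L2 \<mu>) f" and herm: "\<And>x. hermitian_mat (f x)" and Q: "hermitian_mat Q"
  shows "complex_of_real (mat_energy t (\<lambda>x. f x ** Q))
    = (\<Sum>i\<in>UNIV. \<Sum>j\<in>UNIV. (Q ** Q) $ i $ j * (\<Sum>k\<in>UNIV. energy t (\<lambda>x. f x $ j $ k) (\<lambda>x. f x $ k $ i)))"
proof -
  have u: "(\<lambda>x. f x $ i $ j) \<in> L2 \<mu>" for i j using f by (simp add: entries_in_def)
  let ?D = "\<lambda>z i j. f (fst z) $ i $ j - f (snd z) $ i $ j"
  have pt: "complex_of_real ((norm (f (fst z) ** Q - f (snd z) ** Q))\<^sup>2)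
      = (\<Sum>i\<in>UNIV. \<Sum>j\<in>UNIV. (Q ** Q) $ i $ j * (\<Sum>k\<in>UNIV. ?D z j k * ?D z k i))" for z
  proof -
    define D where "D = incr f z"
    have D: "cadjoint D = D" using hermitian_diff[OF herm herm] by (simp add: D_def hermitian_mat_def)
    have "complex_of_real ((norm (f (fst z) ** Q - f (snd z) ** Q))\<^sup>2) = trace (cadjoint (D ** Q) ** (D ** Q))"
      unfolding trace_cadjoint_mult by (simp add: D_def matrix_diff_mult)
    also have "\<dots> = trace (Q ** (D ** D ** Q))"
      using D Q by (simp add: cadjoint_mult hermitian_mat_def matrix_mul_assoc)
    also have "\<dots> = trace (D ** D ** Q ** Q)" by (rule trace_mul_sym)
    also have "\<dots> = trace (D ** D ** (Q ** Q))" by (simp only: matrix_mul_assoc)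
    also have "\<dots> = trace (Q ** Q ** (D ** D))" by (rule trace_mul_sym)
    also have "\<dots> = (\<Sum>i\<in>UNIV. \<Sum>j\<in>UNIV. (Q ** Q) $ i $ j * (\<Sum>k\<in>UNIV. ?D z j k * ?D z k i))"
      by (simp add: trace_mult_square D_def)
    finally show ?thesis .
  qed
  have int: "integrable (joint t) (\<lambda>z. ?D z j k * ?D z k i)" for i j k
    using energy_integrable(1)[OF less_imp_le[OF t] u u] .
  have "complex_of_real (2 * t * mat_energy t (\<lambda>x. f x ** Q))
      = (\<integral>z. complex_of_real ((norm (f (fst z) ** Q - f (snd z) ** Q))\<^sup>2) \<partial>joint t)"
    unfolding integral_complex_of_real norm_diff_sq_integral(2)[OF t entries_in_L2_mult_const[OF f], symmetric] ..
  also have "\<dots> = (\<Sum>i\<in>UNIV. \<Sum>j\<in>UNIV. (Q ** Q) $ i $ j * (\<Sum>k\<in>UNIV. \<integral>z. ?D z j k * ?D z k i \<partial>joint t))"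
    unfolding pt using int by (simp add: Bochner_Integration.integral_sum Bochner_Integration.integrable_sum)
  also have "\<dots> = (\<Sum>i\<in>UNIV. \<Sum>j\<in>UNIV. (Q ** Q) $ i $ j * (\<Sum>k\<in>UNIV. 2 * t * energy t (\<lambda>x. f x $ j $ k) (\<lambda>x. f x $ k $ i)))"
    using t by (simp add: energy_def)
  also have "\<dots> = complex_of_real (2 * t) * (\<Sum>i\<in>UNIV. \<Sum>j\<in>UNIV. (Q ** Q) $ i $ j * (\<Sum>k\<in>UNIV. energy t (\<lambda>x. f x $ j $ k) (\<lambda>x. f x $ k $ i)))"
    by (simp add: sum_distrib_left mult_ac)
  finally have "complex_of_real (2 * t) * complex_of_real (mat_energy t (\<lambda>x. f x ** Q)) = \<dots>"
    by (simp only: of_real_mult)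
  moreover have "complex_of_real (2 * t) \<noteq> 0" using t by simp
  ultimately show ?thesis by (simp only: mult_cancel_left simp_thms)
qed

lemma dirichlet_form_entry_tendsto:
  fixes f :: "'w \<Rightarrow> complex^'d^'d"
  assumes f: "entries_in (generator_domain \<mu> P) f"
  shows "((\<lambda>t. \<Sum>k\<in>UNIV. energy t (\<lambda>x. f x $ i $ k) (\<lambda>x. f x $ k $ j)) \<longlongrightarrow> dirichlet_form \<mu> P f $ i $ j) (at_right 0)"
proof -
  have fD: "(\<lambda>x. f x $ i $ j) \<in> generator_domain \<mu> P" for i j using f by (simp add: entries_in_def)
  have "dirichlet_form \<mu> P f $ i $ j = - (\<integral>x. (\<Sum>k\<in>UNIV. f x $ i $ k * generator \<mu> P (\<lambda>x. f x $ k $ j) x) \<partial>\<mu>)"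
    by (simp add: dirichlet_form_def mat_expectation_def matrix_matrix_mult_def entrywise_def)
  also have "\<dots> = (\<Sum>k\<in>UNIV. - (\<integral>x. f x $ i $ k * generator \<mu> P (\<lambda>x. f x $ k $ j) x \<partial>\<mu>))"
    using L2_mult_integrable[OF generator_properties(1)[OF fD] generator_properties(2)[OF fD]]
    by (simp add: Bochner_Integration.integral_sum sum_negf)
  finally show ?thesis
    by (simp only:) (intro tendsto_sum energy_tendsto generator_properties(1) fD)
qed

lemma entries_in_domain_L2: "entries_in (generator_domain \<mu> P) f \<Longrightarrow> entries_in (L2 \<mu>) f"
  by (auto simp: entries_in_def intro: generator_properties(1))

lemma mat_energy_tendsto:
  fixes f :: "'w \<Rightarrow> complex^'d^'d"
  assumes f: "entries_in (generator_domain \<mu> P) f" and herm: "\<And>x. hermitian_mat (f x)" and Q: "hermitian_mat Q"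
  shows "((\<lambda>t. mat_energy t (\<lambda>x. f x ** Q)) \<longlongrightarrow> Re (trace (Q ** Q ** dirichlet_form \<mu> P f))) (at_right 0)"
proof -
  let ?S = "\<lambda>t. \<Sum>i\<in>UNIV. \<Sum>j\<in>UNIV. (Q ** Q) $ i $ j * (\<Sum>k\<in>UNIV. energy t (\<lambda>x. f x $ j $ k) (\<lambda>x. f x $ k $ i))"
  have trace_eq: "trace (Q ** Q ** dirichlet_form \<mu> P f) = (\<Sum>i\<in>UNIV. \<Sum>j\<in>UNIV. (Q ** Q) $ i $ j * dirichlet_form \<mu> P f $ j $ i)"
    unfolding trace_def by (subst matrix_matrix_mult_def) simp
  have "((\<lambda>t. Re (?S t)) \<longlongrightarrow> Re (trace (Q ** Q ** dirichlet_form \<mu> P f))) (at_right 0)"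
    unfolding trace_eq
    by (intro tendsto_Re tendsto_sum tendsto_mult tendsto_const dirichlet_form_entry_tendsto f)
  moreover have "\<forall>\<^sub>F t in at_right 0. Re (?S t) = mat_energy t (\<lambda>x. f x ** Q)"
  proof (rule eventually_at_rightI[of 0 1])
    fix t :: real assume "t \<in> {0<..<1}"
    then have "complex_of_real (mat_energy t (\<lambda>x. f x ** Q)) = ?S t"
      by (intro mat_energy_mult_eq entries_in_domain_L2 f herm Q) auto
    then have "Re (complex_of_real (mat_energy t (\<lambda>x. f x ** Q))) = Re (?S t)" by (rule arg_cong)
    then show "Re (?S t) = mat_energy t (\<lambda>x. f x ** Q)" by (simp only: Re_complex_of_real)
  qed simp
  ultimately show ?thesis by (rule Lim_transform_eventually)
qed

text \<open>The symmetry is exact for the energies at each time and passes to the limit, so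
  pointwise properties of the generator are not involved.\<close>

lemma dirichlet_form_hermitian:
  fixes f :: "'w \<Rightarrow> complex^'d^'d"
  assumes f: "entries_in (generator_domain \<mu> P) f" and herm: "\<And>x. hermitian_mat (f x)"
  shows "hermitian_mat (dirichlet_form \<mu> P f)"
proof -
  have cnj_f: "cnj (f x $ i $ j) = f x $ j $ i" for x i j
  proof -
    have "cadjoint (f x) $ j $ i = f x $ j $ i" using herm[of x] by (simp add: hermitian_mat_def)
    then show ?thesis by (simp add: cadjoint_def)
  qed
  have "cnj (energy t (\<lambda>x. f x $ i $ k) (\<lambda>x. f x $ k $ j)) = energy t (\<lambda>x. f x $ j $ k) (\<lambda>x. f x $ k $ i)" for t i j k
    unfolding energy_def complex_cnj_divide Bochner_Integration.integral_cnj[symmetric]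
    by (simp add: cnj_f mult.commute)
  then have "((\<lambda>t. \<Sum>k\<in>UNIV. energy t (\<lambda>x. f x $ j $ k) (\<lambda>x. f x $ k $ i)) \<longlongrightarrow> cnj (dirichlet_form \<mu> P f $ i $ j)) (at_right 0)" for i j
    using tendsto_cnj[OF dirichlet_form_entry_tendsto[OF f, of i j]] by simp
  then have "cnj (dirichlet_form \<mu> P f $ i $ j) = dirichlet_form \<mu> P f $ j $ i" for i j
    by (rule tendsto_unique[rotated, OF _ dirichlet_form_entry_tendsto[OF f]]) simp
  then show ?thesis by (simp add: hermitian_mat_def cadjoint_def vec_eq_iff)
qed

lemma dirichlet_form_psd:
  fixes f :: "'w \<Rightarrow> complex^'d^'d"
  assumes f: "entries_in (generator_domain \<mu> P) f" and herm: "\<And>x. hermitian_mat (f x)"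
  shows "psd (dirichlet_form \<mu> P f)"
proof -
  obtain U l where U: "unitary_mat U" and G: "dirichlet_form \<mu> P f = conj_diag U l"
    using hermitian_spectral[OF dirichlet_form_hermitian[OF f herm]] .
  have "0 \<le> l m" for m
  proof -
    \<comment> \<open>Makes \<open>Q\<close> the projection onto eigenvector \<open>m\<close>; the
      limit of the nonnegative energies of \<open>f ** Q\<close> is then the eigenvalue
      \<open>l m\<close> itself.\<close>
    define e where "e i = (if i = m then 1 else 0 :: real)" for i
    define Q where "Q = conj_diag U e"
    have Q: "hermitian_mat Q" unfolding Q_def by (rule hermitian_real_diag_conj)
    have "Q ** Q ** dirichlet_form \<mu> P f = U ** real_diag e ** (cadjoint U ** U) ** real_diag e ** (cadjoint U ** U) ** real_diag l ** cadjoint U"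
      unfolding Q_def G by (simp only: matrix_mul_assoc)
    also have "\<dots> = U ** (real_diag e ** real_diag e ** real_diag l) ** cadjoint U"
      by (simp add: unitary_matD[OF U] matrix_mul_assoc)
    finally have "Re (trace (Q ** Q ** dirichlet_form \<mu> P f)) = (\<Sum>i\<in>UNIV. e i * e i * l i)"
      by (simp add: real_diag_mult trace_real_diag_conj[OF U])
    also have "\<dots> = l m" by (simp add: e_def if_distrib[of "\<lambda>c. c * _"] cong: if_cong)
    finally have "((\<lambda>t. mat_energy t (\<lambda>x. f x ** Q)) \<longlongrightarrow> l m) (at_right 0)"
      using mat_energy_tendsto[OF f herm Q] by simp
    then show ?thesis
    proof (rule tendsto_lowerbound)
      show "\<forall>\<^sub>F t in at_right 0. 0 \<le> mat_energy t (\<lambda>x. f x ** Q)"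
        using norm_diff_sq_integral(4)[OF _ entries_in_L2_mult_const[OF entries_in_domain_L2[OF f]]]
        by (intro eventually_at_rightI[of 0 1]) auto
    qed simp
  qed
  then show ?thesis unfolding psd_def using U G by blast
qed

end

section \<open>Limits, scaled powers and traces in functional calculus\<close>

lemma hermitian_fun_tendsto:
  fixes A :: "complex^'n^'n"
  assumes A: "hermitian_mat A" and \<phi>: "\<And>x. ((\<lambda>m. \<phi> m x) \<longlongrightarrow> \<psi> x) F"
  shows "((\<lambda>m. hermitian_fun (\<phi> m) A) \<longlongrightarrow> hermitian_fun \<psi> A) F"
proof -
  obtain U l where U: "unitary_mat U" and Al: "A = conj_diag U l"
    using hermitian_spectral[OF A] .
  show ?thesis unfolding hermitian_fun_eq[OF U Al]
    by (intro vec_tendstoI) (simp only: real_diag_conj_entry, intro tendsto_intros \<phi>)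
qed

text \<open>For \<open>p = 1\<close> the matrix \<open>Q\<close> is the projection onto the range of \<open>G\<close>, as \<open>0 powr 0 = 0\<close>.\<close>

lemma psd_scaled_powers:
  fixes G :: "complex^'n^'n" and p :: real
  assumes G: "psd G" and \<kappa>: "0 < \<kappa>"
  defines "Y \<equiv> \<kappa> *\<^sub>R G"
  defines "Q \<equiv> hermitian_fun (\<lambda>x. x powr ((p - 1) / 2)) Y"
  shows "\<kappa> * Re (trace (Q ** Q ** G)) = Re (trace (herm_powr Y p))"
    and "Re (trace (herm_powr Y p)) = \<kappa> powr p * Re (trace (herm_powr G p))"
proof -
  obtain U l where U: "unitary_mat U" and Gl: "G = conj_diag U l" and l: "\<And>i. 0 \<le> l i"
    using G by (auto simp: psd_def)
  have Yl: "Y = conj_diag U (\<lambda>i. \<kappa> * l i)"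
    unfolding Y_def Gl by (rule scaleR_real_diag_conj)
  define q where "q i = (\<kappa> * l i) powr ((p - 1) / 2)" for i
  have Qq: "Q = conj_diag U q"
    unfolding Q_def hermitian_fun_eq[OF U Yl] q_def ..
  have "Q ** Q ** G = U ** real_diag q ** (cadjoint U ** U) ** real_diag q ** (cadjoint U ** U) ** real_diag l ** cadjoint U"
    unfolding Qq Gl by (simp only: matrix_mul_assoc)
  also have "\<dots> = U ** (real_diag q ** real_diag q ** real_diag l) ** cadjoint U"
    by (simp add: unitary_matD[OF U] matrix_mul_assoc)
  finally have "Re (trace (Q ** Q ** G)) = (\<Sum>i\<in>UNIV. q i * q i * l i)"
    by (simp add: real_diag_mult trace_real_diag_conj[OF U])
  moreover have "\<kappa> * (q i * q i * l i) = (\<kappa> * l i) powr p" for i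
  proof -
    have "q i * q i = (\<kappa> * l i) powr (p - 1)" by (simp add: q_def flip: powr_add)
    then have "\<kappa> * (q i * q i * l i) = (\<kappa> * l i) * (\<kappa> * l i) powr (p - 1)" by (simp add: mult_ac)
    also have "\<dots> = (\<kappa> * l i) powr p"
      using l[of i] \<kappa> by (cases "l i = 0") (simp_all add: powr_mult_base)
    finally show ?thesis .
  qed
  moreover have trY: "Re (trace (herm_powr Y p)) = (\<Sum>i\<in>UNIV. (\<kappa> * l i) powr p)"
    by (simp add: herm_powr_def hermitian_fun_eq[OF U Yl] trace_real_diag_conj[OF U])
  ultimately show "\<kappa> * Re (trace (Q ** Q ** G)) = Re (trace (herm_powr Y p))"
    by (simp add: sum_distrib_left)
  show "Re (trace (herm_powr Y p)) = \<kappa> powr p * Re (trace (herm_powr G p))"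
    unfolding trY using \<kappa> l
    by (simp add: herm_powr_def hermitian_fun_eq[OF U Gl] trace_real_diag_conj[OF U] powr_mult sum_distrib_left)
qed

lemma trace_herm_exp_pos:
  fixes A :: "complex^'n^'n"
  assumes A: "hermitian_mat A" shows "0 < Re (trace (herm_exp A))"
proof -
  obtain U l where U: "unitary_mat U" and Al: "A = conj_diag U l"
    using hermitian_spectral[OF A] .
  have "0 < (\<Sum>i\<in>UNIV. exp (l i))" by (intro sum_pos) auto
  then show ?thesis by (simp add: herm_exp_def hermitian_fun_eq[OF U Al] trace_real_diag_conj[OF U])
qed

lemma hermitian_scaleR: "hermitian_mat A \<Longrightarrow> hermitian_mat (c *\<^sub>R A)"
  by (simp add: hermitian_mat_def cadjoint_def vec_eq_iff)

lemma Re_trace_mat_expectation: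
  assumes "\<And>i j. integrable \<mu> (\<lambda>x. f x $ i $ j)"
  shows "integrable \<mu> (\<lambda>x. Re (trace (f x)))" and "Re (trace (mat_expectation \<mu> f)) = (\<integral>x. Re (trace (f x)) \<partial>\<mu>)"
  using assms by (simp_all add: trace_def mat_expectation_def Bochner_Integration.integral_sum Bochner_Integration.integrable_sum)

section \<open>The carre du champ and truncated exponentials\<close>

locale hermitian_observable = reversible_process F X Pr \<mu>
  for F :: "'s measure" and X :: "real \<Rightarrow> 's \<Rightarrow> 'w::polish_space" and Pr \<mu> +
  fixes A :: "('w \<Rightarrow> complex) set" and g :: "'w \<Rightarrow> complex^'d^'d"
  assumes A: "function_algebra A" "A \<subseteq> generator_domain \<mu> P"
    and g: "entries_in A g" and herm: "\<And>x. hermitian_mat (g x)"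
begin

lemma observable_measurable: "mat_measurable borel g"
  using g A(2) unfolding mat_measurable_def entries_in_def by (intro allI L2_borel generator_properties(1)) auto

abbreviation \<Gamma> :: "'w \<Rightarrow> complex^'d^'d" where "\<Gamma> \<equiv> carre_du_champ \<mu> P g"

abbreviation sq_trace :: "complex^'d^'d \<Rightarrow> 'w \<times> 'w \<Rightarrow> complex" where
  "sq_trace W z \<equiv> trace (W ** (incr g z ** incr g z))"

definition entry :: "'d \<Rightarrow> 'd \<Rightarrow> 'w \<Rightarrow> complex" where
  "entry j k x = g x $ j $ k"

definition sq_entry :: "'d \<Rightarrow> 'd \<Rightarrow> 'w \<Rightarrow> complex" where
  "sq_entry j i x = (\<Sum>k\<in>UNIV. entry j k x * entry k i x)"

text \<open>The parenthesis on the right of \<open>weighted_energy_error\<close>, for one entry of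
  the matrix square: it depends on \<open>g\<close> and \<open>t\<close> but on no weight.\<close>

definition entry_error :: "'d \<Rightarrow> 'd \<Rightarrow> real \<Rightarrow> real" where
  "entry_error i j t = L2_norm \<mu> (\<lambda>x. 1) * L2_norm \<mu> (generator_error (sq_entry j i) t)
    + (\<Sum>k\<in>UNIV. L2_norm \<mu> (entry j k) * L2_norm \<mu> (generator_error (entry k i) t))
    + (\<Sum>k\<in>UNIV. L2_norm \<mu> (entry k i) * L2_norm \<mu> (generator_error (entry j k) t))"

definition carre_error :: "real \<Rightarrow> real" where
  "carre_error t = (\<Sum>i\<in>UNIV. \<Sum>j\<in>UNIV. entry_error i j t)"

lemma entry_algebra: "entry j k \<in> A" "(\<lambda>x. entry j k x * entry k i x) \<in> A" "sq_entry j i \<in> A"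
proof -
  show e: "entry j k \<in> A" for j k using g by (simp add: entries_in_def entry_def[abs_def])
  then show prod: "(\<lambda>x. entry j k x * entry k i x) \<in> A" for k
    using A(1) by (auto simp: function_algebra_def)
  have "(\<lambda>x. \<Sum>k\<in>S. entry j k x * entry k i x) \<in> A" if "finite S" for S
    using that prod A(1) by (induction S rule: finite_induct) (auto simp: function_algebra_def)
  then show "sq_entry j i \<in> A" by (simp add: sq_entry_def[abs_def])
qed

lemma carre_error_tendsto: "(carre_error \<longlongrightarrow> 0) (at_right 0)"
proof -
  have "(entry_error i j \<longlongrightarrow> 0 + 0 + 0) (at_right 0)" for i j
    unfolding entry_error_def[abs_def] using entry_algebra A(2)
    by (intro tendsto_add tendsto_mult_right_zero tendsto_null_sum generator_properties(3)) auto
  then show ?thesis unfolding carre_error_def[abs_def] by (intro tendsto_null_sum) simp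
qed

lemma carre_error_nonneg: "0 \<le> carre_error t"
proof -
  have "0 \<le> L2_norm \<mu> f" for f by (simp add: L2_norm_def)
  then show ?thesis unfolding carre_error_def entry_error_def
    by (intro sum_nonneg add_nonneg_nonneg mult_nonneg_nonneg)
qed

text \<open>Expanding the trace gives, for each pair of indices, a scalar weighted energy whose sum
  over \<open>k\<close> is an entry of a matrix square; the corresponding entry of
  \<open>\<Gamma>\<close> is the \<open>G\<close> of \<open>weighted_energy_error\<close>.\<close>

lemma weighted_carre_error:
  assumes t: "0 < t" and V: "mat_measurable borel V" and M: "\<And>x i j. cmod (V x $ i $ j) \<le> M"
  shows "integrable (joint t) (\<lambda>z. sq_trace (V (fst z)) z)" and "integrable \<mu> (\<lambda>x. trace (V x ** \<Gamma> x))"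
    and "cmod ((\<integral>z. sq_trace (V (fst z)) z \<partial>joint t) / (2 * t) - (\<integral>x. trace (V x ** \<Gamma> x) \<partial>\<mu>)) \<le> M * carre_error t"
proof -
  define G where "G j i x = (1 / 2) * (generator \<mu> P (sq_entry j i) x
      - (\<Sum>k\<in>UNIV. entry j k x * generator \<mu> P (entry k i) x)
      - (\<Sum>k\<in>UNIV. entry k i x * generator \<mu> P (entry j k) x))" for i j x
  have carre: "\<Gamma> x $ j $ i = G j i x" for i j x
    by (simp add: carre_du_champ_def G_def entrywise_def matrix_matrix_mult_def sq_entry_def[abs_def]
        entry_def[abs_def] scaleR_conv_of_real[where 'a=complex] mult.commute)
  have v: "(\<lambda>x. V x $ i $ j) \<in> borel_measurable \<mu>" for i j using V by (simp add: mat_measurable_def)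
  have dom: "entry j k \<in> generator_domain \<mu> P" "(\<lambda>x. entry j k x * entry k i x) \<in> L2 \<mu>"
    "(\<lambda>x. \<Sum>k\<in>UNIV. entry j k x * entry k i x) \<in> generator_domain \<mu> P" for i j k
    using subsetD[OF A(2) entry_algebra(1)] generator_properties(1)[OF subsetD[OF A(2) entry_algebra(2)]]
      subsetD[OF A(2) entry_algebra(3)] by (simp_all add: sq_entry_def[abs_def])
  note W = weighted_energy_error[of "\<lambda>k. entry j k" "\<lambda>k. entry k i" "\<lambda>x. V x $ i $ j" M t for i j,
      OF dom(1) dom(1) dom(2) dom(3) v M t, folded sq_entry_def]
  define I1 where "I1 i j z = V (fst z) $ i $ j * (\<Sum>k\<in>UNIV. incr (entry j k) z * incr (entry k i) z)" for i j z
  have W1: "integrable (joint t) (I1 i j)" for i j using W(1)[of i j] by (simp add: I1_def[abs_def])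
  have W2: "integrable \<mu> (\<lambda>x. V x $ i $ j * G j i x)" for i j using W(2)[of i j] by (simp add: G_def)
  have W3: "cmod ((\<integral>z. I1 i j z \<partial>joint t) / (2 * t) - (\<integral>x. V x $ i $ j * G j i x \<partial>\<mu>)) \<le> M * entry_error i j t" for i j
    using W(3)[of i j] by (simp add: I1_def G_def entry_error_def)
  have tr1: "sq_trace (V (fst z)) z = (\<Sum>i\<in>UNIV. \<Sum>j\<in>UNIV. I1 i j z)" for z
    by (simp add: trace_mult_square I1_def entry_def)
  have tr2: "trace (V x ** \<Gamma> x) = (\<Sum>i\<in>UNIV. \<Sum>j\<in>UNIV. V x $ i $ j * G j i x)" for x
    by (simp add: trace_def matrix_matrix_mult_def carre)
  note sums = Bochner_Integration.integral_sum Bochner_Integration.integrable_sum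
  show "integrable (joint t) (\<lambda>z. sq_trace (V (fst z)) z)" "integrable \<mu> (\<lambda>x. trace (V x ** \<Gamma> x))"
    unfolding tr1 tr2 by (intro Bochner_Integration.integrable_sum W1 W2)+
  have "(\<integral>z. sq_trace (V (fst z)) z \<partial>joint t) / (2 * t) - (\<integral>x. trace (V x ** \<Gamma> x) \<partial>\<mu>)
    = (\<Sum>i\<in>UNIV. \<Sum>j\<in>UNIV. (\<integral>z. I1 i j z \<partial>joint t) / (2 * t) - (\<integral>x. V x $ i $ j * G j i x \<partial>\<mu>))"
    unfolding tr1 tr2 using W1 W2 by (simp add: sums sum_subtractf sum_divide_distrib)
  also have "cmod \<dots> \<le> (\<Sum>i\<in>UNIV. \<Sum>j\<in>UNIV. M * entry_error i j t)"
    by (intro sum_norm_le W3)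
  finally show "cmod ((\<integral>z. sq_trace (V (fst z)) z \<partial>joint t) / (2 * t) - (\<integral>x. trace (V x ** \<Gamma> x) \<partial>\<mu>)) \<le> M * carre_error t"
    by (simp only: carre_error_def sum_distrib_left)
qed

text \<open>In the limit the weight meets \<open>\<Gamma>\<close> at the same point, where the
  operator norm can be pulled out of the trace. The second estimate follows from the first by
  symmetry of the joint law, as the square of the increment does not change when the two points are
  exchanged.\<close>

lemma psd_weighted_energy_le:
  assumes C: "AE x in \<mu>. op_norm (\<Gamma> x) \<le> C"
    and t: "0 < t" and V: "mat_measurable borel V" and psd: "\<And>x. psd (V x)" and M: "\<And>x. Re (trace (V x)) \<le> M"
  shows "(\<integral>\<^sup>+z. ennreal (Re (sq_trace (V (fst z)) z)) \<partial>joint t)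
      \<le> ennreal (2 * t * (C * (\<integral>x. Re (trace (V x)) \<partial>\<mu>) + M * carre_error t))" (is "?I \<le> ennreal ?b")
    and "(\<integral>\<^sup>+z. ennreal (Re (sq_trace (V (snd z)) z)) \<partial>joint t)
      \<le> ennreal (2 * t * (C * (\<integral>x. Re (trace (V x)) \<partial>\<mu>) + M * carre_error t))"
proof -
  let ?f = "\<lambda>z. sq_trace (V (fst z)) z"
  note L = weighted_carre_error[OF t V order.trans[OF psd_entry_le_trace[OF psd] M]]
  have tr0: "0 \<le> Re (trace (V x))" for x by (intro psd_trace_nonneg psd)
  have trV_int: "integrable \<mu> (\<lambda>x. Re (trace (V x)))"
    using borel_measurable_trace[OF V] M tr0 by (intro integrable_const_bound[where B = M]) auto
  have "Re ((\<integral>z. ?f z \<partial>joint t) / (2 * t) - (\<integral>x. trace (V x ** \<Gamma> x) \<partial>\<mu>)) \<le> M * carre_error t"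
    using L(3) complex_Re_le_cmod order.trans by blast
  moreover have "Re (w / (2 * t)) = Re w / (2 * t)" for w
    using Re_divide_of_real[of w "2 * t"] by simp
  moreover have "Re (\<integral>x. trace (V x ** \<Gamma> x) \<partial>\<mu>) \<le> C * (\<integral>x. Re (trace (V x)) \<partial>\<mu>)"
  proof -
    have "Re (\<integral>x. trace (V x ** \<Gamma> x) \<partial>\<mu>) = (\<integral>x. Re (trace (V x ** \<Gamma> x)) \<partial>\<mu>)"
      using L(2) by simp
    also have "\<dots> \<le> (\<integral>x. C * Re (trace (V x)) \<partial>\<mu>)"
    proof (rule integral_mono_AE)
      show "AE x in \<mu>. Re (trace (V x ** \<Gamma> x)) \<le> C * Re (trace (V x))"
        using C
      proof eventually_elim
        case (elim x)
        have "Re (trace (V x ** \<Gamma> x)) \<le> Re (trace (V x)) * op_norm (\<Gamma> x)"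
          by (rule Re_trace_psd_mult_le[OF psd])
        also have "\<dots> \<le> Re (trace (V x)) * C"
          using elim tr0 by (intro mult_left_mono) auto
        finally show ?case by (simp add: mult.commute)
      qed
    qed (use L(2) trV_int in auto)
    finally show ?thesis by simp
  qed
  ultimately have "Re (\<integral>z. ?f z \<partial>joint t) / (2 * t) \<le> C * (\<integral>x. Re (trace (V x)) \<partial>\<mu>) + M * carre_error t"
    by simp
  then have "Re (\<integral>z. ?f z \<partial>joint t) \<le> ?b"
    using t by (simp add: pos_divide_le_eq mult_ac)
  moreover have "?I = ennreal (\<integral>z. Re (?f z) \<partial>joint t)"
    using L(1) psd herm by (intro nn_integral_eq_integral AE_I2 Re_trace_psd_square_nonneg hermitian_diff) auto
  ultimately show first: "?I \<le> ennreal ?b"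
    using L(1) by (simp add: ennreal_leI)
  have D: "mat_measurable (borel \<Otimes>\<^sub>M borel) (incr g)"
    by (intro mat_measurable_diff mat_measurable_compose[OF observable_measurable]) auto
  have "(\<lambda>z. ?f z) \<in> borel_measurable (borel \<Otimes>\<^sub>M borel)"
    by (intro borel_measurable_trace mat_measurable_mult D mat_measurable_compose[OF V]) auto
  then have "(\<lambda>z. ennreal (Re (?f z))) \<in> borel_measurable (borel \<Otimes>\<^sub>M borel)" by simp
  from nn_integral_joint_swap[OF less_imp_le[OF t] this]
  have "(\<integral>\<^sup>+z. ennreal (Re (sq_trace (V (snd z)) (snd z, fst z))) \<partial>joint t) = ?I" by simp
  moreover have "(g (snd z) - g (fst z)) ** (g (snd z) - g (fst z)) = incr g z ** incr g z" for z :: "'w \<times> 'w"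
    by (simp add: vec_eq_iff matrix_matrix_mult_def algebra_simps)
  ultimately show "(\<integral>\<^sup>+z. ennreal (Re (sq_trace (V (snd z)) z)) \<partial>joint t) \<le> ennreal ?b"
    using first by simp
qed

text \<open>The estimate of \<open>Tr (Y\<^bsup>p-1\<^esup> \<E>(f))\<close> for the truncation \<open>f\<close> of \<open>e\<^sup>g\<close>, when \<open>\<parallel>\<Gamma>(g)\<parallel> \<le> C\<close>.\<close>

definition dual_bound :: "real \<Rightarrow> complex^'d^'d \<Rightarrow> real \<Rightarrow> real \<Rightarrow> real" where
  "dual_bound C Y p \<epsilon> = C * ((1 - 1 / p) * Re (trace (herm_powr Y p))
    + (1 / p) * (\<integral>x. Re (trace (power_weight \<epsilon> p (g x))) \<partial>\<mu>))"

abbreviation midpoint_sq :: "real \<Rightarrow> complex^'d^'d \<Rightarrow> real \<Rightarrow> 'w \<times> 'w \<Rightarrow> real" where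
  "midpoint_sq \<epsilon> Q s z \<equiv> (norm (midpoint_term \<epsilon> Q (g (fst z)) (g (snd z)) s))\<^sup>2"

text \<open>After Young's inequality one weight sits at the later point and the other at the initial
  point, so each is covered by \<open>psd_weighted_energy_le\<close>. Neither the main term nor
  \<open>K\<close> depends on \<open>s\<close>; otherwise averaging over midpoints would not be
  possible.\<close>

lemma midpoint_term_energy_le:
  assumes C: "AE x in \<mu>. op_norm (\<Gamma> x) \<le> C" "0 \<le> C"
    and Y: "psd Y" and Q: "Q = hermitian_fun (\<lambda>x. x powr ((p - 1) / 2)) Y"
    and \<epsilon>: "0 < \<epsilon>" and p: "1 \<le> p"
  shows "\<exists>K. \<forall>t s. 0 < t \<longrightarrow> 0 < s \<longrightarrow> s < 1 \<longrightarrow>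
    (\<integral>\<^sup>+z. ennreal (midpoint_sq \<epsilon> Q s z) \<partial>joint t)
      \<le> ennreal (2 * t * (dual_bound C Y p \<epsilon> + K * carre_error t))"
proof -
  have QH: "hermitian_mat Q" unfolding Q by (intro hermitian_hermitian_fun psd_hermitian Y)
  define S where "S = Re (trace (herm_powr Y p))"
  define T where "T = real CARD('d) * (1 / \<epsilon>) powr (2 * p)"
  define N where "N = (\<integral>x. Re (trace (power_weight \<epsilon> p (g x))) \<partial>\<mu>)"
  have S: "0 \<le> S" unfolding S_def herm_powr_def
    by (intro psd_trace_nonneg psd_hermitian_fun psd_hermitian Y) auto
  have T: "0 \<le> T" by (simp add: T_def)
  have pw_le: "Re (trace (power_weight \<epsilon> p (g x))) \<le> T" for x
    unfolding T_def using \<epsilon> p by (intro Re_trace_power_weight_le herm) auto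
  have pw_psd: "psd (power_weight \<epsilon> p (g x))" for x by (intro psd_power_weight herm)
  have pw_m: "mat_measurable borel (\<lambda>x. power_weight \<epsilon> p (g x))" by (intro mat_measurable_power_weight observable_measurable herm \<epsilon>)
  have pw_int: "integrable \<mu> (\<lambda>x. Re (trace (power_weight \<epsilon> p (g x))))"
    using borel_measurable_trace[OF pw_m] pw_le psd_trace_nonneg[OF pw_psd]
    by (intro integrable_const_bound[where B = T]) auto
  have N: "0 \<le> N" unfolding N_def using psd_trace_nonneg[OF pw_psd] by simp
  show ?thesis
  \<comment> \<open>Each of the two weights has trace at most \<open>S + T\<close>, hence
    contributes \<open>S + T\<close> times \<open>carre_error t\<close>.\<close>
  proof (intro exI[of _ "2 * (S + T)"] allI impI)
    fix t s :: real assume t: "0 < t" and s: "0 < s" "s < 1"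
    define V1 where "V1 x = young_weight \<epsilon> p s Q (g x)" for x
    define V2 where "V2 x = (s / p) *\<^sub>R power_weight \<epsilon> p (g x)" for x
    have sp: "0 \<le> s / p" "s / p \<le> 1" "0 \<le> (1 - s) / p" "(1 - s) / p \<le> 1" "0 \<le> 1 - 1 / p" "1 - 1 / p \<le> 1"
      using s p by (auto simp: divide_le_eq)
    have V1_le: "Re (trace (V1 x)) \<le> (1 - 1 / p) * S + ((1 - s) / p) * Re (trace (power_weight \<epsilon> p (g x)))" for x
      unfolding V1_def S_def by (intro Re_trace_young_weight_le herm Y Q \<epsilon> p s)
    have V1_bound: "Re (trace (V1 x)) \<le> S + T" for x
    proof -
      have "(1 - 1 / p) * S \<le> 1 * S" using S sp by (intro mult_right_mono) auto
      moreover have "((1 - s) / p) * Re (trace (power_weight \<epsilon> p (g x))) \<le> 1 * T"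
        using pw_le[of x] psd_trace_nonneg[OF pw_psd[of x]] sp by (intro mult_mono) auto
      ultimately show ?thesis using V1_le[of x] by linarith
    qed
    have V2_tr: "Re (trace (V2 x)) = (s / p) * Re (trace (power_weight \<epsilon> p (g x)))" for x
      by (simp add: V2_def Re_trace_scaleR)
    have V2_bound: "Re (trace (V2 x)) \<le> S + T" for x
    proof -
      have "(s / p) * Re (trace (power_weight \<epsilon> p (g x))) \<le> 1 * T"
        using pw_le[of x] psd_trace_nonneg[OF pw_psd[of x]] sp by (intro mult_mono) auto
      then show ?thesis using S by (simp add: V2_tr)
    qed
    have V1_psd: "psd (V1 x)" for x unfolding V1_def using s p by (intro psd_young_weight herm QH) auto
    have V2_psd: "psd (V2 x)" for x unfolding V2_def using sp by (intro psd_scaleR pw_psd) auto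
    have V1_m: "mat_measurable borel V1"
      unfolding V1_def[abs_def] using s p by (intro mat_measurable_young_weight observable_measurable herm QH \<epsilon>) auto
    have V2_m: "mat_measurable borel V2" unfolding V2_def[abs_def] by (intro mat_measurable_scaleR pw_m)
    have V1_int: "(\<integral>x. Re (trace (V1 x)) \<partial>\<mu>) \<le> (1 - 1 / p) * S + ((1 - s) / p) * N"
    proof -
      have "integrable \<mu> (\<lambda>x. Re (trace (V1 x)))"
        using borel_measurable_trace[OF V1_m] V1_bound psd_trace_nonneg[OF V1_psd]
        by (intro integrable_const_bound[where B = "S + T"]) auto
      then have "(\<integral>x. Re (trace (V1 x)) \<partial>\<mu>) \<le> (\<integral>x. (1 - 1 / p) * S + ((1 - s) / p) * Re (trace (power_weight \<epsilon> p (g x))) \<partial>\<mu>)"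
        using pw_int V1_le by (intro integral_mono) auto
      then show ?thesis using pw_int by (simp add: N_def prob_space[unfolded space_\<mu>])
    qed
    have V2_int: "(\<integral>x. Re (trace (V2 x)) \<partial>\<mu>) = (s / p) * N" by (simp add: V2_tr N_def)
    let ?q1 = "\<lambda>z. Re (sq_trace (V1 (snd z)) z)" and ?q2 = "\<lambda>z. Re (sq_trace (V2 (fst z)) z)"
    let ?b = "\<lambda>V. 2 * t * (C * (\<integral>x. Re (trace (V x)) \<partial>\<mu>) + (S + T) * carre_error t)"
    have nonneg: "0 \<le> ?q1 z" "0 \<le> ?q2 z" for z
      by (intro Re_trace_psd_square_nonneg V1_psd V2_psd hermitian_diff herm)+
    have Dm: "mat_measurable (borel \<Otimes>\<^sub>M borel) (incr g)"
      by (intro mat_measurable_diff mat_measurable_compose[OF observable_measurable]) auto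
    have m1: "(\<lambda>z. sq_trace (V1 (snd z)) z) \<in> borel_measurable (borel \<Otimes>\<^sub>M borel)"
      by (intro borel_measurable_trace mat_measurable_mult Dm mat_measurable_compose[OF V1_m]) auto
    have m2: "(\<lambda>z. sq_trace (V2 (fst z)) z) \<in> borel_measurable (borel \<Otimes>\<^sub>M borel)"
      by (intro borel_measurable_trace mat_measurable_mult Dm mat_measurable_compose[OF V2_m]) auto
    have "(\<integral>\<^sup>+z. ennreal (midpoint_sq \<epsilon> Q s z) \<partial>joint t)
        \<le> (\<integral>\<^sup>+z. ennreal (?q1 z) + ennreal (?q2 z) \<partial>joint t)"
    proof (intro nn_integral_mono)
      fix z
      have "midpoint_sq \<epsilon> Q s z
          \<le> ?q1 z + (s / p) * Re (sq_trace (power_weight \<epsilon> p (g (fst z))) z)"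
        unfolding midpoint_term_def V1_def
        by (intro weighted_difference_young herm QH hermitian_diff \<epsilon> p s)
      also have "\<dots> = ?q1 z + ?q2 z"
        by (simp only: V2_def Re_trace_scaleR_mult)
      finally show "ennreal (midpoint_sq \<epsilon> Q s z)
          \<le> ennreal (?q1 z) + ennreal (?q2 z)"
        using nonneg[of z] by (simp add: ennreal_plus[symmetric] ennreal_leI del: ennreal_plus)
    qed
    also have "\<dots> = (\<integral>\<^sup>+z. ennreal (?q1 z) \<partial>joint t)
        + (\<integral>\<^sup>+z. ennreal (?q2 z) \<partial>joint t)"
      using m1 m2 t by (intro nn_integral_add) auto
    also have "\<dots> \<le> ennreal (?b V1) + ennreal (?b V2)"
    proof (rule add_mono)
      show "(\<integral>\<^sup>+z. ennreal (?q1 z) \<partial>joint t) \<le> ennreal (?b V1)"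
        by (rule psd_weighted_energy_le(2)[OF C(1) t V1_m V1_psd V1_bound])
      show "(\<integral>\<^sup>+z. ennreal (?q2 z) \<partial>joint t) \<le> ennreal (?b V2)"
        by (rule psd_weighted_energy_le(1)[OF C(1) t V2_m V2_psd V2_bound])
    qed
    also have "\<dots> = ennreal (?b V1 + ?b V2)"
    proof -
      have "0 \<le> ?b V1" "0 \<le> ?b V2"
        using t C(2) S T carre_error_nonneg psd_trace_nonneg[OF V1_psd] psd_trace_nonneg[OF V2_psd]
        by (auto intro!: mult_nonneg_nonneg add_nonneg_nonneg integral_nonneg)
      then show ?thesis by (rule ennreal_plus[symmetric])
    qed
    also have "\<dots> \<le> ennreal (2 * t * (C * ((1 - 1 / p) * S + (1 / p) * N) + 2 * (S + T) * carre_error t))"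
    proof (rule ennreal_leI)
      have "(\<integral>x. Re (trace (V1 x)) \<partial>\<mu>) + (\<integral>x. Re (trace (V2 x)) \<partial>\<mu>) \<le> (1 - 1 / p) * S + (1 / p) * N"
      proof -
        have "((1 - s) / p) * N + (s / p) * N = (1 / p) * N" by (simp add: diff_divide_distrib algebra_simps)
        then show ?thesis using V1_int V2_int by linarith
      qed
      then have "C * ((\<integral>x. Re (trace (V1 x)) \<partial>\<mu>) + (\<integral>x. Re (trace (V2 x)) \<partial>\<mu>)) \<le> C * ((1 - 1 / p) * S + (1 / p) * N)"
        using C(2) by (rule mult_left_mono)
      then have "2 * t * (C * ((\<integral>x. Re (trace (V1 x)) \<partial>\<mu>) + (\<integral>x. Re (trace (V2 x)) \<partial>\<mu>)) + 2 * (S + T) * carre_error t)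
          \<le> 2 * t * (C * ((1 - 1 / p) * S + (1 / p) * N) + 2 * (S + T) * carre_error t)"
        using t by (intro mult_left_mono) auto
      moreover have "?b V1 + ?b V2 = 2 * t * (C * ((\<integral>x. Re (trace (V1 x)) \<partial>\<mu>) + (\<integral>x. Re (trace (V2 x)) \<partial>\<mu>)) + 2 * (S + T) * carre_error t)"
        by (simp only: distrib_left distrib_right mult.assoc mult_2 add_ac)
      ultimately show "?b V1 + ?b V2 \<le> 2 * t * (C * ((1 - 1 / p) * S + (1 / p) * N) + 2 * (S + T) * carre_error t)" by simp
    qed
    finally show "(\<integral>\<^sup>+z. ennreal (midpoint_sq \<epsilon> Q s z) \<partial>joint t)
      \<le> ennreal (2 * t * (dual_bound C Y p \<epsilon> + 2 * (S + T) * carre_error t))"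
      by (simp only: dual_bound_def S_def N_def)
  qed
qed

text \<open>The squared norm of a midpoint average is at most the average of squared norms, so the
  bound common to all nodes survives; Fatou's lemma carries it to the limit of the sums.\<close>

lemma truncated_energy_le:
  assumes C: "AE x in \<mu>. op_norm (\<Gamma> x) \<le> C" "0 \<le> C"
    and Y: "psd Y" and Q: "Q = hermitian_fun (\<lambda>x. x powr ((p - 1) / 2)) Y"
    and \<epsilon>: "0 < \<epsilon>" and p: "1 \<le> p"
  shows "\<exists>K. \<forall>t>0.
    (\<integral>\<^sup>+z. ennreal ((norm (hermitian_fun (damp \<epsilon> 1) (g (fst z)) ** Q - hermitian_fun (damp \<epsilon> 1) (g (snd z)) ** Q))\<^sup>2) \<partial>joint t)
      \<le> ennreal (2 * t * (dual_bound C Y p \<epsilon> + K * carre_error t))"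
proof -
  obtain K where le: "\<And>t s. 0 < t \<Longrightarrow> 0 < s \<Longrightarrow> s < 1 \<Longrightarrow>
      (\<integral>\<^sup>+z. ennreal (midpoint_sq \<epsilon> Q s z) \<partial>joint t)
        \<le> ennreal (2 * t * (dual_bound C Y p \<epsilon> + K * carre_error t))"
    using midpoint_term_energy_le[OF C Y Q \<epsilon> p] by blast
  let ?B = "\<lambda>t. ennreal (2 * t * (dual_bound C Y p \<epsilon> + K * carre_error t))"
  have mid_m: "mat_measurable (borel \<Otimes>\<^sub>M borel) (\<lambda>z. midpoint_term \<epsilon> Q (g (fst z)) (g (snd z)) s)" for s
  proof -
    have "mat_measurable borel (\<lambda>x. hermitian_fun (damp \<epsilon> r) (g x))" for r
      by (intro mat_measurable_hermitian_fun observable_measurable herm continuous_on_damp \<epsilon>)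
    note dm = mat_measurable_compose[OF this]
    show ?thesis unfolding midpoint_term_def
      by (intro mat_measurable_mult mat_measurable_diff mat_measurable_const dm mat_measurable_compose[OF observable_measurable]) auto
  qed
  have "(\<integral>\<^sup>+z. ennreal ((norm (hermitian_fun (damp \<epsilon> 1) (g (fst z)) ** Q - hermitian_fun (damp \<epsilon> 1) (g (snd z)) ** Q))\<^sup>2) \<partial>joint t)
      \<le> ?B t" if t: "0 < t" for t
  proof -
    define \<sigma> where "\<sigma> n k = (real k + 1/2) / real n" for n k
    define R where "R n z = (1 / real n) *\<^sub>R (\<Sum>k<n. midpoint_term \<epsilon> Q (g (fst z)) (g (snd z)) (\<sigma> n k))" for n z
    have \<sigma>: "0 < \<sigma> n k" "\<sigma> n k < 1" if "k < n" for n k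
      using that by (auto simp: \<sigma>_def divide_less_eq)
    have lim: "(\<lambda>n. ennreal ((norm (R n z))\<^sup>2)) \<longlonglongrightarrow>
        ennreal ((norm (hermitian_fun (damp \<epsilon> 1) (g (fst z)) ** Q - hermitian_fun (damp \<epsilon> 1) (g (snd z)) ** Q))\<^sup>2)" for z
      unfolding R_def \<sigma>_def matrix_diff_mult[symmetric]
      by (intro tendsto_ennrealI tendsto_power tendsto_norm midpoint_sum_tendsto herm \<epsilon>)
    have R_le: "(\<integral>\<^sup>+z. ennreal ((norm (R n z))\<^sup>2) \<partial>joint t) \<le> ?B t" for n
    \<comment> \<open>The empty average \<open>R 0\<close> is zero because \<open>1 / real 0\<close>
      is \<open>0\<close>.\<close>
    proof (cases "n = 0")
      case False
      have sq_m: "(\<lambda>z. ennreal (midpoint_sq \<epsilon> Q s z)) \<in> borel_measurable (joint t)" for s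
        using borel_measurable_norm_mat[OF mid_m] t by simp
      have "(\<integral>\<^sup>+z. ennreal ((norm (R n z))\<^sup>2) \<partial>joint t)
          \<le> (\<integral>\<^sup>+z. ennreal (1 / real n) * (\<Sum>k<n. ennreal (midpoint_sq \<epsilon> Q (\<sigma> n k) z)) \<partial>joint t)"
      proof (intro nn_integral_mono)
        fix z
        have "ennreal ((norm (R n z))\<^sup>2) \<le> ennreal ((1 / real n) * (\<Sum>k<n. midpoint_sq \<epsilon> Q (\<sigma> n k) z))"
          unfolding R_def by (intro ennreal_leI norm_mean_sq_le)
        also have "\<dots> = ennreal (1 / real n) * (\<Sum>k<n. ennreal (midpoint_sq \<epsilon> Q (\<sigma> n k) z))"
          by (subst ennreal_mult') (auto simp: sum_ennreal intro!: sum_nonneg)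
        finally show "ennreal ((norm (R n z))\<^sup>2) \<le> \<dots>" .
      qed
      also have "\<dots> = ennreal (1 / real n) * (\<Sum>k<n. \<integral>\<^sup>+z. ennreal (midpoint_sq \<epsilon> Q (\<sigma> n k) z) \<partial>joint t)"
        by (subst nn_integral_cmult[OF borel_measurable_sum[OF sq_m]], subst nn_integral_sum[OF sq_m]) (rule refl)
      also have "\<dots> \<le> ennreal (1 / real n) * (\<Sum>k<n. ?B t)"
        using le[OF t] \<sigma> by (intro mult_left_mono sum_mono) auto
      also have "\<dots> = ?B t"
      proof -
        have "ennreal (1 / real n) * of_nat n = 1"
          using False by (simp add: ennreal_of_nat_eq_real_of_nat ennreal_mult'[symmetric])
        then show ?thesis by (simp add: mult.assoc[symmetric])
      qed
      finally show ?thesis .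
    qed (simp add: R_def)
    have R_m: "(\<lambda>z. ennreal ((norm (R n z))\<^sup>2)) \<in> borel_measurable (joint t)" for n
    proof -
      have "mat_measurable (borel \<Otimes>\<^sub>M borel) (\<lambda>z. \<Sum>k<m. midpoint_term \<epsilon> Q (g (fst z)) (g (snd z)) (\<sigma> n k))" for m
        using mid_m by (auto simp: mat_measurable_def intro!: borel_measurable_sum)
      then have "mat_measurable (borel \<Otimes>\<^sub>M borel) (R n)" unfolding R_def[abs_def] by (intro mat_measurable_scaleR)
      from borel_measurable_norm_mat[OF this] show ?thesis using t by simp
    qed
    have "(\<integral>\<^sup>+z. ennreal ((norm (hermitian_fun (damp \<epsilon> 1) (g (fst z)) ** Q - hermitian_fun (damp \<epsilon> 1) (g (snd z)) ** Q))\<^sup>2) \<partial>joint t)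
        = (\<integral>\<^sup>+z. liminf (\<lambda>n. ennreal ((norm (R n z))\<^sup>2)) \<partial>joint t)"
      using lim by (intro nn_integral_cong lim_imp_Liminf[symmetric]) auto
    also have "\<dots> \<le> liminf (\<lambda>n. \<integral>\<^sup>+z. ennreal ((norm (R n z))\<^sup>2) \<partial>joint t)"
      by (rule nn_integral_liminf[OF R_m])
    also have "\<dots> \<le> ?B t"
      using R_le by (intro Liminf_le always_eventually allI sequentially_bot)
    finally show ?thesis .
  qed
  then show ?thesis by blast
qed

lemma damped_exp_entries_L2:
  assumes \<epsilon>: "0 < \<epsilon>"
  shows "entries_in (L2 \<mu>) (\<lambda>x. hermitian_fun (damp \<epsilon> 1) (g x))"
proof -
  \<comment> \<open>The exponent in \<open>power_weight\<close> is \<open>2 * p\<close>, so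
    \<open>p = 1 / 2\<close> gives \<open>damp\<close> itself and the bounds for weights become
    available.\<close>
  have eq: "hermitian_fun (damp \<epsilon> 1) = power_weight \<epsilon> (1 / 2)"
    unfolding power_weight_def using damp_pos[OF \<epsilon>] by (simp add: less_imp_le)
  have "mat_measurable borel (\<lambda>x. hermitian_fun (damp \<epsilon> 1) (g x))"
    by (intro mat_measurable_hermitian_fun observable_measurable herm continuous_on_damp \<epsilon>)
  moreover have "cmod (hermitian_fun (damp \<epsilon> 1) (g x) $ i $ j) \<le> real CARD('d) * (1 / \<epsilon>) powr (2 * (1 / 2))" for x i j
    unfolding eq using \<epsilon>
    by (intro order.trans[OF psd_entry_le_trace[OF psd_power_weight[OF herm]]] Re_trace_power_weight_le(1) herm) auto
  ultimately show ?thesis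
    unfolding entries_in_def mat_measurable_def by (intro allI L2_bounded[OF finite_measure_axioms]) auto
qed

lemma dirichlet_form_exp_duality_bound:
  assumes eg: "entries_in (generator_domain \<mu> P) (\<lambda>x. herm_exp (g x))"
    and C: "AE x in \<mu>. op_norm (\<Gamma> x) \<le> C" "0 \<le> C"
    and Y: "psd Y" and Q: "Q = hermitian_fun (\<lambda>x. x powr ((p - 1) / 2)) Y"
    and p: "1 \<le> p" and b: "0 \<le> b"
    and b_le: "\<And>\<epsilon>. 0 < \<epsilon> \<Longrightarrow> dual_bound C Y p \<epsilon> \<le> b"
  shows "Re (trace (Q ** Q ** dirichlet_form \<mu> P (\<lambda>x. herm_exp (g x)))) \<le> b"
proof -
  have QH: "hermitian_mat Q" unfolding Q by (intro hermitian_hermitian_fun psd_hermitian Y)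
  define f where "f \<epsilon> x = hermitian_fun (damp \<epsilon> 1) (g x) ** Q" for \<epsilon> x
  have f_L2: "entries_in (L2 \<mu>) (f \<epsilon>)" if "0 < \<epsilon>" for \<epsilon>
    unfolding f_def[abs_def] by (intro entries_in_L2_mult_const damped_exp_entries_L2 that)
  \<comment> \<open>Since a truncation is not known to lie in \<open>generator_domain\<close>, no
    limit of its energies is claimed. The error term vanishes only as time tends to zero, and the
    estimate is carried back to \<open>t\<close> along \<open>t / 2 ^ n\<close>.\<close>
  have trunc: "mat_energy t (f \<epsilon>) \<le> b" if t: "0 < t" and \<epsilon>: "0 < \<epsilon>" for t \<epsilon>
  proof -
    obtain K where le: "\<And>t. 0 < t \<Longrightarrow> (\<integral>\<^sup>+z. ennreal ((norm (incr (f \<epsilon>) z))\<^sup>2) \<partial>joint t)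
        \<le> ennreal (2 * t * (dual_bound C Y p \<epsilon> + K * carre_error t))"
      using truncated_energy_le[OF C Y Q \<epsilon> p] unfolding f_def by blast
    define \<eta> where "\<eta> r = K * carre_error r" for r
    have \<eta>: "(\<eta> \<longlongrightarrow> 0) (at_right 0)"
      unfolding \<eta>_def[abs_def] by (rule tendsto_mult_right_zero[OF carre_error_tendsto])
    note le = le[folded \<eta>_def]
    \<comment> \<open>Clipping at zero is needed because \<open>ennreal\<close> sends negative reals
      to \<open>0\<close>; it disappears in the limit thanks to \<open>0 \<le> b\<close>.\<close>
    have "mat_energy r (f \<epsilon>) \<le> max 0 (b + \<eta> r)" if r: "0 < r" for r
    proof -
      have "ennreal (2 * r * mat_energy r (f \<epsilon>)) \<le> ennreal (2 * r * max 0 (b + \<eta> r))"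
        unfolding norm_diff_sq_integral(3)[OF r f_L2[OF \<epsilon>], symmetric]
        using b_le[OF \<epsilon>] r by (intro order.trans[OF le[OF r]] ennreal_leI mult_left_mono) auto
      then have "2 * r * mat_energy r (f \<epsilon>) \<le> 2 * r * max 0 (b + \<eta> r)"
        using r by (subst (asm) ennreal_le_iff) auto
      then show ?thesis using r by (simp only: mult_le_cancel_left_pos mult_pos_pos zero_less_numeral)
    qed
    then have "mat_energy t (f \<epsilon>) \<le> max 0 (b + \<eta> (t / 2 ^ n))" for n
      using t by (intro order.trans[OF mat_energy_mono[OF t f_L2[OF \<epsilon>], of n]]) auto
    moreover have "(\<lambda>n. max 0 (b + \<eta> (t / 2 ^ n))) \<longlonglongrightarrow> max 0 (b + 0)"
    proof -
      have "(\<lambda>n. t / 2 ^ n) \<longlonglongrightarrow> 0" by (rule LIMSEQ_divide_realpow_zero) simp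
      then have "filterlim (\<lambda>n. t / 2 ^ n) (at_right 0) sequentially"
        using t by (simp add: filterlim_at)
      from filterlim_compose[OF \<eta> this] show ?thesis by (intro tendsto_intros)
    qed
    ultimately have "mat_energy t (f \<epsilon>) \<le> max 0 (b + 0)" by (intro LIMSEQ_le_const) auto
    then show ?thesis using b by simp
  qed
  define F0 where "F0 x = herm_exp (g x) ** Q" for x
  have F0_L2: "entries_in (L2 \<mu>) F0"
    unfolding F0_def[abs_def] by (intro entries_in_L2_mult_const entries_in_domain_L2 eg)
  have energy_le: "mat_energy t F0 \<le> b" if t: "0 < t" for t
  proof -
    \<comment> \<open>A sequence of positive truncation parameters tending to zero; time stays fixed
      while Fatou's lemma removes the truncation.\<close>
    define e where "e m = 1 / real (Suc m)" for m
    have e: "0 < e m" for m by (simp add: e_def)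
    have f_lim: "(\<lambda>m. f (e m) x) \<longlonglongrightarrow> F0 x" for x
      unfolding f_def F0_def herm_exp_def
    proof (intro tendsto_matrix_mult hermitian_fun_tendsto herm tendsto_const)
      fix y :: real
      have "(\<lambda>m. exp (1 * y) / (1 + e m * exp y)) \<longlonglongrightarrow> exp (1 * y) / (1 + 0 * exp y)"
        unfolding e_def by (intro tendsto_intros LIMSEQ_Suc[OF lim_1_over_n]) auto
      then show "(\<lambda>m. damp (e m) 1 y) \<longlonglongrightarrow> exp y" by (simp add: damp_def)
    qed
    have m: "(\<lambda>z. ennreal ((norm (incr (f (e m)) z))\<^sup>2)) \<in> borel_measurable (joint t)" for m
      using borel_measurable_integrable[OF norm_diff_sq_integral(1)[OF t f_L2[OF e]]] by (rule measurable_compose) simp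
    have "ennreal (2 * t * mat_energy t F0) = (\<integral>\<^sup>+z. ennreal ((norm (incr F0 z))\<^sup>2) \<partial>joint t)"
      by (rule norm_diff_sq_integral(3)[OF t F0_L2, symmetric])
    also have "\<dots> = (\<integral>\<^sup>+z. liminf (\<lambda>m. ennreal ((norm (incr (f (e m)) z))\<^sup>2)) \<partial>joint t)"
      by (intro nn_integral_cong lim_imp_Liminf[symmetric] tendsto_ennrealI tendsto_power tendsto_norm tendsto_diff f_lim sequentially_bot)
    also have "\<dots> \<le> liminf (\<lambda>m. \<integral>\<^sup>+z. ennreal ((norm (incr (f (e m)) z))\<^sup>2) \<partial>joint t)"
      by (rule nn_integral_liminf[OF m])
    also have "\<dots> \<le> ennreal (2 * t * b)"
    proof (intro Liminf_le always_eventually allI sequentially_bot)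
      fix m
      show "(\<integral>\<^sup>+z. ennreal ((norm (incr (f (e m)) z))\<^sup>2) \<partial>joint t) \<le> ennreal (2 * t * b)"
        unfolding norm_diff_sq_integral(3)[OF t f_L2[OF e]]
        using trunc[OF t e[of m]] t by (intro ennreal_leI mult_left_mono) auto
    qed
    finally have "2 * t * mat_energy t F0 \<le> 2 * t * b" using t b by (subst (asm) ennreal_le_iff) auto
    then show ?thesis using t by simp
  qed
  have "((\<lambda>t. mat_energy t F0) \<longlongrightarrow> Re (trace (Q ** Q ** dirichlet_form \<mu> P (\<lambda>x. herm_exp (g x))))) (at_right 0)"
    unfolding F0_def[abs_def] by (intro mat_energy_tendsto eg QH) (simp add: herm_exp_def hermitian_hermitian_fun herm)
  then show ?thesis
    by (rule tendsto_upperbound) (auto intro!: eventually_at_rightI[of 0 1] energy_le)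
qed

text \<open>Scaling by \<open>1 / C\<close> makes \<open>Re (trace (Q ** Q ** G))\<close> equal to
  \<open>C\<close> times the trace \<open>S\<close> of the power \<open>p\<close> of
  \<open>Y\<close>, so \<open>C\<close> cancels against the factor in \<open>dual_bound\<close>. It
  reappears as \<open>C powr p\<close> when the scaling of \<open>S\<close> is undone.\<close>

lemma trace_dirichlet_form_exp_powr_le:
  assumes eg: "entries_in (generator_domain \<mu> P) (\<lambda>x. herm_exp (g x))"
    and C: "AE x in \<mu>. op_norm (\<Gamma> x) \<le> C"
    and p: "1 \<le> p"
  defines "G \<equiv> dirichlet_form \<mu> P (\<lambda>x. herm_exp (g x))"
  shows "C = 0 \<Longrightarrow> Re (trace (herm_powr G p)) \<le> 0"
    and "0 < C \<Longrightarrow> (\<And>i j. integrable \<mu> (\<lambda>x. herm_exp ((2 * p) *\<^sub>R g x) $ i $ j)) \<Longrightarrow>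
      Re (trace (herm_powr G p)) \<le> C powr p * (\<integral>x. Re (trace (herm_exp ((2 * p) *\<^sub>R g x))) \<partial>\<mu>)"
proof -
  have psdG: "psd G" unfolding G_def
    by (intro dirichlet_form_psd eg) (simp add: herm_exp_def hermitian_hermitian_fun herm)
  note bound = dirichlet_form_exp_duality_bound[OF eg C _ _ refl p, folded G_def]
  \<comment> \<open>Scaling by \<open>1 / C\<close> is impossible here, so the dual weight is built
    from \<open>G\<close> itself; \<open>dual_bound\<close> is then \<open>0\<close>.\<close>
  show "Re (trace (herm_powr G p)) \<le> 0" if C0: "C = 0"
    using bound[of "1 *\<^sub>R G" 0] psd_scaled_powers[OF psdG, of 1 p] psdG C0 by (simp add: dual_bound_def)
  show "Re (trace (herm_powr G p)) \<le> C powr p * (\<integral>x. Re (trace (herm_exp ((2 * p) *\<^sub>R g x))) \<partial>\<mu>)"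
    if C0: "0 < C" and int: "\<And>i j. integrable \<mu> (\<lambda>x. herm_exp ((2 * p) *\<^sub>R g x) $ i $ j)"
  proof -
    define N where "N = (\<integral>x. Re (trace (herm_exp ((2 * p) *\<^sub>R g x))) \<partial>\<mu>)"
    define Y where "Y = (1 / C) *\<^sub>R G"
    define S where "S = Re (trace (herm_powr Y p))"
    have Y: "psd Y" unfolding Y_def using C0 by (intro psd_scaleR psdG) auto
    have S: "0 \<le> S" unfolding S_def herm_powr_def
      by (intro psd_trace_nonneg psd_hermitian_fun psd_hermitian Y) auto
    have N: "0 \<le> N" unfolding N_def
      using trace_herm_exp_pos[OF hermitian_scaleR[OF herm]] by (intro Bochner_Integration.integral_nonneg) (auto intro: less_imp_le)
    define b where "b = C * ((1 - 1 / p) * S + (1 / p) * N)"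
    have le_b: "dual_bound C Y p \<epsilon> \<le> b" if \<epsilon>: "0 < \<epsilon>" for \<epsilon>
    proof -
      have "(\<integral>x. Re (trace (power_weight \<epsilon> p (g x))) \<partial>\<mu>) \<le> N"
        unfolding N_def
      proof (rule integral_mono_AE')
        show "integrable \<mu> (\<lambda>x. Re (trace (herm_exp ((2 * p) *\<^sub>R g x))))"
          by (rule Re_trace_mat_expectation(1)[OF int])
        show "AE x in \<mu>. Re (trace (power_weight \<epsilon> p (g x))) \<le> Re (trace (herm_exp ((2 * p) *\<^sub>R g x)))"
          using \<epsilon> p by (intro AE_I2 Re_trace_power_weight_le(2) herm) auto
        show "AE x in \<mu>. 0 \<le> Re (trace (herm_exp ((2 * p) *\<^sub>R g x)))"
          by (intro AE_I2 less_imp_le trace_herm_exp_pos hermitian_scaleR herm)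
      qed
      then show ?thesis unfolding dual_bound_def b_def S_def using C0 p by (intro mult_left_mono add_left_mono) auto
    qed
    have b0: "0 \<le> b" unfolding b_def using C0 p S N by (intro mult_nonneg_nonneg add_nonneg_nonneg) auto
    define Q where "Q = hermitian_fun (\<lambda>x. x powr ((p - 1) / 2)) Y"
    have "Re (trace (Q ** Q ** G)) \<le> b"
      unfolding Q_def by (rule bound[OF less_imp_le[OF C0] Y b0 le_b])
    moreover have "(1 / C) * Re (trace (Q ** Q ** G)) = S"
      unfolding Q_def S_def Y_def using C0 by (intro psd_scaled_powers(1) psdG) auto
    ultimately have "S \<le> (1 / C) * b" using C0 by (metis mult_left_mono less_imp_le zero_less_divide_1_iff)
    also have "\<dots> = (1 - 1 / p) * S + (1 / p) * N" using C0 by (simp add: b_def)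
    \<comment> \<open>\<open>S\<close> occurs on both sides; its share
      \<open>(1 - 1 / p) * S\<close> on the right is absorbed.\<close>
    finally have "(1 / p) * S \<le> (1 / p) * N" by (simp add: algebra_simps)
    then have SN: "S \<le> N" using p by (simp add: divide_le_cancel)
    have "S = (1 / C) powr p * Re (trace (herm_powr G p))"
      unfolding S_def Y_def using C0 by (intro psd_scaled_powers(2) psdG) auto
    then have "Re (trace (herm_powr G p)) = C powr p * S"
      using C0 by (simp add: powr_divide)
    also have "\<dots> \<le> C powr p * N" using SN by (intro mult_left_mono) auto
    finally show ?thesis by (simp add: N_def)
  qed
qed

end

theorem theorem3p1:
  fixes \<mu> :: "'w::polish_space measure"
    and F :: "'s measure"
    and X :: "real \<Rightarrow> 's \<Rightarrow> 'w"
    and Pr :: "'w \<Rightarrow> 's measure"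
    and A :: "('w \<Rightarrow> complex) set"
    and g :: "'w \<Rightarrow> complex^'d^'d"
    and p :: real
  assumes "markov_process F X Pr"
    and "stationary_measure X Pr \<mu>"
    and "reversible \<mu> (markov_semigroup X Pr)"
    and "function_algebra A"
    and "A \<subseteq> generator_domain \<mu> (markov_semigroup X Pr)"
    and "\<And>x. hermitian_mat (g x)"
    and "entries_in A g"
    and "entries_in (generator_domain \<mu> (markov_semigroup X Pr)) (\<lambda>x. herm_exp (g x))"
    and "1 \<le> p"
  shows "ennreal (Re (trace (herm_powr (dirichlet_form \<mu> (markov_semigroup X Pr) (\<lambda>x. herm_exp (g x))) p)))
    \<le> esssup \<mu> (\<lambda>x. ennreal (op_norm (carre_du_champ \<mu> (markov_semigroup X Pr) g x) powr p))
      * trace_expectation \<mu> (\<lambda>x. herm_exp ((2 * p) *\<^sub>R g x))"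
proof -
  interpret hermitian_observable F X Pr \<mu> A g
    using assms(1-7) by (intro hermitian_observable.intro hermitian_observable_axioms.intro
      reversible_process.intro reversible_process_axioms.intro)
  define G where "G = dirichlet_form \<mu> P (\<lambda>x. herm_exp (g x))"
  define c where "c = esssup \<mu> (\<lambda>x. ennreal (op_norm (\<Gamma> x) powr p))"
  define E where "E = (\<lambda>x. herm_exp ((2 * p) *\<^sub>R g x))"
  note trace_bounds = trace_dirichlet_form_exp_powr_le[OF assms(8) _ assms(9), folded G_def]
  have "ennreal (Re (trace (herm_powr G p))) \<le> c * trace_expectation \<mu> E"
  proof (cases c)
    case top
    \<comment> \<open>In \<open>ennreal\<close> infinity times zero is zero, so strict positivity of
      the trace of an exponential has to be brought in.\<close>
    have "trace_expectation \<mu> E \<noteq> 0"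
    proof (cases "\<forall>i j. integrable \<mu> (\<lambda>x. E x $ i $ j)")
      case True
      have pos: "0 < Re (trace (E x))" for x
        unfolding E_def by (intro trace_herm_exp_pos hermitian_scaleR assms(6))
      have int: "integrable \<mu> (\<lambda>x. Re (trace (E x)))"
        by (rule Re_trace_mat_expectation(1)) (use True in blast)
      have "(\<integral>x. Re (trace (E x)) \<partial>\<mu>) \<noteq> 0"
      proof
        assume "(\<integral>x. Re (trace (E x)) \<partial>\<mu>) = 0"
        then have "AE x in \<mu>. Re (trace (E x)) = 0"
          using integral_nonneg_eq_0_iff_AE[OF int] pos by (simp add: less_imp_le)
        then have "AE x in \<mu>. False" by eventually_elim (use pos in \<open>simp add: less_le\<close>)
        then show False by simp
      qed
      moreover have "0 \<le> (\<integral>x. Re (trace (E x)) \<partial>\<mu>)"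
        by (intro Bochner_Integration.integral_nonneg less_imp_le pos)
      ultimately show ?thesis
        using True Re_trace_mat_expectation(2)[of \<mu> E] by (simp add: trace_expectation_def)
    next
      case False
      then have "trace_expectation \<mu> E = \<infinity>" unfolding trace_expectation_def by (rule if_not_P)
      then show ?thesis by simp
    qed
    then show ?thesis by (simp add: top ennreal_top_mult)
  next
    case (real r)
    \<comment> \<open>The root turns the essential bound on the power of the norm of
      \<open>\<Gamma>\<close> into one on the norm; later \<open>C powr p\<close> gives back
      \<open>r\<close>.\<close>
    define C where "C = r powr (1 / p)"
    have "AE x in \<mu>. op_norm (\<Gamma> x) \<le> C"
      using esssup_AE[of "\<lambda>x. ennreal (op_norm (\<Gamma> x) powr p)" \<mu>]
    proof eventually_elim
      case (elim x)
      then have "op_norm (\<Gamma> x) powr p \<le> r"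
        using real by (simp add: c_def[symmetric])
      then have "(op_norm (\<Gamma> x) powr p) powr (1 / p) \<le> C"
        unfolding C_def using assms(9) by (intro powr_mono2) auto
      then show ?case using assms(9) op_norm_nonneg by (simp add: powr_powr)
    qed
    note bounds = trace_bounds[OF this]
    show ?thesis
    proof (cases "r = 0")
      case True
      \<comment> \<open>The right side is zero even when the expectation is infinite, so this case
        has to be settled without integrability of \<open>E\<close>.\<close>
      then have "Re (trace (herm_powr G p)) \<le> 0" by (intro bounds(1)) (simp add: C_def)
      then show ?thesis by (simp add: ennreal_neg)
    next
      case False
      then have r: "0 < r" using real by simp
      show ?thesis
      proof (cases "\<forall>i j. integrable \<mu> (\<lambda>x. E x $ i $ j)")
        case True
        have "Re (trace (herm_powr G p)) \<le> C powr p * (\<integral>x. Re (trace (E x)) \<partial>\<mu>)"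
          using bounds(2) r True by (simp add: C_def E_def)
        also have "C powr p = r" using r assms(9) by (simp add: C_def powr_powr)
        finally have "ennreal (Re (trace (herm_powr G p))) \<le> ennreal (r * (\<integral>x. Re (trace (E x)) \<partial>\<mu>))"
          by (rule ennreal_leI)
        then show ?thesis
          using True real Re_trace_mat_expectation(2)[of \<mu> E]
          by (simp add: trace_expectation_def ennreal_mult')
      next
        case False
        then have "trace_expectation \<mu> E = \<infinity>" unfolding trace_expectation_def by (rule if_not_P)
        then show ?thesis using r real by (simp add: ennreal_mult_top)
      qed
    qed
  qed
  then show ?thesis by (simp add: G_def c_def E_def)
qed

end
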